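(* Let $n$ be even and let $X$ be a random symmetric $n\times n$ matrix with independent entries (up to symmetry), $X_{ii}\sim\mathrm{N}(0,2)$ and $X_{ij}=X_{ji}\sim\mathrm{N}(0,1)$ for $i<j$. Let $\frac{1}{\sqrt n}X=\sum_{k=1}^n\lambda_ku_ku_k^T$ with $\lambda_1\ge\dots\ge\lambda_n$, and let $X^+,X^-$ be defined by $\frac1{\sqrt n}X^+=\sum_{k=1}^{n/2}\lambda_ku_ku_k^T$, $\frac1{\sqrt n}X^-=\sum_{k=n/2+1}^{n}\lambda_ku_ku_k^T$. Given $X$, define the random symmetric matrix $W$ by $W_{ii}=0$ and, for $i<j$ independently, $W_{ij}=W_{ji}=X^+_{ij}-X^-_{ij}$ with probability $1/2$ and $W_{ij}=W_{ji}=X^-_{ij}-X^+_{ij}$ with probability $1/2$. Let $L_W=\frac1n\sum_{i=1}^n\delta_{\lambda_i(W/\sqrt n)}$ be the empirical spectral distribution of $W/\sqrt n$. For $\alpha>0$ let $\mathrm{P}_\alpha$ be the semicircle law with density $\frac{1}{2\pi\alpha^2}\sqrt{4\alpha^2-x^2}\,\mathbb{1}\{x\in[-2\alpha,2\alpha]\}$. Then with probability at least $1-O(n^{-3})$ over the choice of $X$, $L_W$ converges almost surely (as $n\to\infty$) to $\mathrm{P}_\alpha$ with $\alpha=\sqrt{1-\frac{64}{9\pi^2}}$. *)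

theory Defs
  imports "HOL-Probability.Probability"
begin

(* Matrices of size n are represented as functions nat => nat => real;
   only the entries with indices < n are relevant. Indices are 0-based. *)

definition gauss_ens :: "nat \<Rightarrow> (nat \<times> nat \<Rightarrow> real) measure" where
  "gauss_ens n = (\<Pi>\<^sub>M p \<in> {(i, j). i \<le> j \<and> j < n}.
      (if fst p = snd p then density lborel (\<lambda>x. ennreal (normal_density 0 (sqrt 2) x))
       else density lborel (\<lambda>x. ennreal (normal_density 0 1 x))))"

definition sym_mat :: "(nat \<times> nat \<Rightarrow> real) \<Rightarrow> nat \<Rightarrow> nat \<Rightarrow> real" where
  "sym_mat g i j = (if i \<le> j then g (i, j) else g (j, i))"

definition spectral_decomp ::
  "nat \<Rightarrow> (nat \<Rightarrow> nat \<Rightarrow> real) \<Rightarrow> (nat \<Rightarrow> real) \<Rightarrow> (nat \<Rightarrow> nat \<Rightarrow> real) \<Rightarrow> bool" where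
  "spectral_decomp n A lam u \<longleftrightarrow>
     (\<forall>k<n. \<forall>l<n. (\<Sum>i<n. u k i * u l i) = (if k = l then 1 else 0)) \<and>
     (\<forall>i<n. \<forall>j<n. A i j = (\<Sum>k<n. lam k * u k i * u k j)) \<and>
     (\<forall>k l. k \<le> l \<longrightarrow> l < n \<longrightarrow> lam l \<le> lam k)"

definition some_decomp :: "nat \<Rightarrow> (nat \<Rightarrow> nat \<Rightarrow> real) \<Rightarrow> (nat \<Rightarrow> real) \<times> (nat \<Rightarrow> nat \<Rightarrow> real)" where
  "some_decomp n A = (SOME p. spectral_decomp n A (fst p) (snd p))"

definition Xplus :: "nat \<Rightarrow> (nat \<Rightarrow> nat \<Rightarrow> real) \<Rightarrow> nat \<Rightarrow> nat \<Rightarrow> real" where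
  "Xplus n X i j = (let (lam, u) = some_decomp n (\<lambda>a b. X a b / sqrt (real n))
     in sqrt (real n) * (\<Sum>k<n div 2. lam k * u k i * u k j))"

definition Xminus :: "nat \<Rightarrow> (nat \<Rightarrow> nat \<Rightarrow> real) \<Rightarrow> nat \<Rightarrow> nat \<Rightarrow> real" where
  "Xminus n X i j = (let (lam, u) = some_decomp n (\<lambda>a b. X a b / sqrt (real n))
     in sqrt (real n) * (\<Sum>k\<in>{n div 2..<n}. lam k * u k i * u k j))"

definition Wmat :: "nat \<Rightarrow> (nat \<Rightarrow> nat \<Rightarrow> real) \<Rightarrow> (nat \<Rightarrow> nat \<Rightarrow> bool) \<Rightarrow> nat \<Rightarrow> nat \<Rightarrow> real" where
  "Wmat n X s i j =
     (if i = j then 0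
      else let a = min i j; b = max i j in
        (if s a b then Xplus n X a b - Xminus n X a b else Xminus n X a b - Xplus n X a b))"

definition ESD :: "nat \<Rightarrow> (nat \<Rightarrow> nat \<Rightarrow> real) \<Rightarrow> real measure" where
  "ESD n A = measure_pmf (map_pmf (fst (some_decomp n (\<lambda>a b. A a b / sqrt (real n))))
                                  (pmf_of_set {..<n}))"

definition semicircle_density :: "real \<Rightarrow> real \<Rightarrow> real" where
  "semicircle_density \<alpha> x =
     (if x \<in> {-2*\<alpha>..2*\<alpha>} then sqrt (4 * \<alpha>\<^sup>2 - x\<^sup>2) / (2 * pi * \<alpha>\<^sup>2) else 0)"

definition semicircle :: "real \<Rightarrow> real measure" where
  "semicircle \<alpha> = density lborel (\<lambda>x. ennreal (semicircle_density \<alpha> x))"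

text \<open>Independent fair signs for every (n, i, j).\<close>
definition sign_space :: "(nat \<times> nat \<times> nat \<Rightarrow> bool) measure" where
  "sign_space = (\<Pi>\<^sub>M p \<in> UNIV. measure_pmf (bernoulli_pmf (1/2)))"

end

theory Submission
  imports Defs
begin

text \<open>
  The matrix \<open>B = (X\<^sup>+ - X\<^sup>-) / sqrt n\<close> satisfies \<open>B\<^sup>2 = (X / sqrt n)\<^sup>2\<close> and differs little from \<open>\<bar>X\<bar> / sqrt n\<close> in
  operator norm, because the median eigenvalue of \<open>X / sqrt n\<close> tends to 0. Hence the variance profile \<open>B\<^sub>i\<^sub>j\<^sup>2\<close>
  (\<open>i \<noteq> j\<close>) of \<open>W / sqrt n\<close> has row sums close to \<open>1 - c\<^sup>2\<close>, where \<open>c = 8 / (3 * pi)\<close> is the mean of \<open>\<bar>x\<bar>\<close> under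
  the semicircle law, provided the diagonal entries of \<open>f (X / sqrt n)\<close> are close to the integral of \<open>f\<close>.

  Both that statement about \<open>X\<close> and the conclusion about \<open>W\<close> follow from one estimate for the resolvent of a
  symmetric matrix with independent entries whose variance profile has small entries and row sums close to \<open>\<alpha>\<^sup>2\<close>:
  at \<open>z = i * q\<close> with \<open>q \<ge> 2\<close> the Schur complement formula makes the diagonal of the resolvent an approximate fixed
  point of a contraction in the averaged \<open>l\<^sup>1\<close> norm, and McDiarmid's inequality over the rows gives exponential
  tails. The functions \<open>x \<mapsto> 1 / (x - i * q)\<close> span a dense subspace of the continuous functions vanishing at
  infinity, so no analytic continuation is needed.
\<close>

section \<open>The spectral theorem for real symmetric matrices\<close>

text \<open>Two features of the matrices shape the estimate. Gaussian entries are unbounded, so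
  bounded differences cannot be read off the entries; but changing one row and column moves the
  diagonal of the resolvent by O(1 / q) in the unnormalised l^1 norm, however large the change.
  Also, W needs more than the spectrum of X: its variance profile involves single entries of B.
  Hence the deviation is measured entry by entry on the diagonal instead of through the trace, and
  off-diagonal resolvent entries are bounded separately, which makes the profile uniformly small.
  The row sums arise as sum_j B_ij^2 = (X^2)_ii / n, close to 1, minus the removed diagonal term
  B_ii^2, close to c^2. The function |x| does not vanish at infinity and is replaced by a compactly
  supported tent; the same row norms control the error. With q >= 2 both the resolvent entry and its
  limit have modulus at most 1/2, and the factor 1/4 makes the fixed-point map a contraction at
  once. The event for X may depend on neither q nor the accuracy, so q is kept rational and
  countably many requirements are imposed together.\<close>

definition orth_sphere :: "nat \<Rightarrow> (nat \<Rightarrow> nat \<Rightarrow> real) \<Rightarrow> nat \<Rightarrow> (nat \<Rightarrow> real) set" where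
  "orth_sphere n u k = {x. (\<forall>i\<ge>n. x i = 0) \<and> (\<Sum>i<n. x i * x i) = 1 \<and> (\<forall>l<k. (\<Sum>i<n. u l i * x i) = 0)}"

definition quad_form :: "nat \<Rightarrow> (nat \<Rightarrow> nat \<Rightarrow> real) \<Rightarrow> (nat \<Rightarrow> real) \<Rightarrow> real" where
  "quad_form n A x = (\<Sum>i<n. \<Sum>j<n. A i j * x i * x j)"

lemma compact_PiE_UNIV:
  fixes S :: "'i \<Rightarrow> 'a::topological_space set"
  assumes "\<And>i. compact (S i)"
  shows "compact (PiE UNIV S)"
  using assms compactin_PiE[of "\<lambda>_. euclidean" UNIV S]
  by (auto simp: euclidean_product_topology)

lemma continuous_on_quad_form: "continuous_on S (quad_form n A)"
  unfolding quad_form_def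
  by (intro continuous_intros continuous_on_product_coordinates[THEN continuous_on_subset]) auto

text \<open>Vectors live in \<open>nat => real\<close> with the product topology. Since the
  coordinates from \<open>n\<close> on are pinned to 0, the set is a closed subset of a product of
  compact intervals and Tychonoff's theorem applies.\<close>

lemma compact_orth_sphere: "compact (orth_sphere n u k)"
proof -
  let ?B = "PiE UNIV (\<lambda>i. if i < n then {-1..1} else {0::real})"
  have c: "continuous_on UNIV (\<lambda>x::nat \<Rightarrow> real. x i)" for i
    by simp
  have "closed {x::nat\<Rightarrow>real. \<forall>i. i \<ge> n \<longrightarrow> x i = 0}"
    by (intro closed_Collect_all closed_Collect_imp closed_Collect_eq) (auto intro: c)
  moreover have "closed {x::nat\<Rightarrow>real. (\<Sum>i<n. x i * x i) = 1}"
    by (intro closed_Collect_eq continuous_intros c)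
  moreover have "closed {x::nat\<Rightarrow>real. \<forall>l. l < k \<longrightarrow> (\<Sum>i<n. u l i * x i) = 0}"
    by (intro closed_Collect_all closed_Collect_imp closed_Collect_eq continuous_intros c) auto
  ultimately have "closed (orth_sphere n u k)"
    unfolding orth_sphere_def by (intro closed_Collect_conj) auto
  moreover have "compact ?B" by (rule compact_PiE_UNIV) auto
  moreover have "orth_sphere n u k \<subseteq> ?B"
  proof
    fix x assume x: "x \<in> orth_sphere n u k"
    have "x i \<in> (if i < n then {-1..1} else {0})" for i
    proof (cases "i < n")
      case True
      have "x i * x i \<le> (\<Sum>i<n. x i * x i)"
        using True by (intro member_le_sum) auto
      then have "(x i)\<^sup>2 \<le> 1\<^sup>2" using x by (simp add: orth_sphere_def power2_eq_square)
      then have "\<bar>x i\<bar> \<le> 1" using abs_le_square_iff[of "x i" 1] by simp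
      then show ?thesis using True by auto
    qed (use x in \<open>auto simp: orth_sphere_def\<close>)
    then show "x \<in> ?B" by auto
  qed
  ultimately show ?thesis
    using compact_Int_closed[of ?B "orth_sphere n u k"] by (simp add: Int_absorb1)
qed

text \<open>Pythagoras for the distance from the basis vector e_a to the span of the first
  \<open>k\<close> vectors. Positivity of some distance for k < n gives a new orthogonal direction;
  vanishing of all of them for k = n gives completeness.\<close>

lemma sum_orthonormal_coeffs:
  fixes u :: "nat \<Rightarrow> nat \<Rightarrow> real"
  assumes on: "\<And>l m. l < k \<Longrightarrow> m < k \<Longrightarrow> (\<Sum>i<n. u l i * u m i) = (if l = m then 1 else 0)"
    and "a < n"
  shows "(\<Sum>i<n. ((if i = a then 1 else 0) - (\<Sum>l<k. u l a * u l i))\<^sup>2) = 1 - (\<Sum>l<k. (u l a)\<^sup>2)"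
proof -
  have "(\<Sum>i<n. (\<Sum>l<k. u l a * u l i)\<^sup>2) = (\<Sum>i<n. \<Sum>l<k. \<Sum>m<k. u l a * u m a * (u l i * u m i))"
    by (simp add: power2_eq_square sum_product mult_ac)
  also have "\<dots> = (\<Sum>l<k. \<Sum>m<k. u l a * u m a * (\<Sum>i<n. u l i * u m i))"
    by (subst sum.swap, rule sum.cong[OF refl], subst sum.swap, simp add: sum_distrib_left)
  also have "\<dots> = (\<Sum>l<k. (u l a)\<^sup>2)"
    by (rule sum.cong[OF refl]) (simp add: on if_distrib[of "\<lambda>x. _ * x"] power2_eq_square cong: if_cong)
  finally have e1: "(\<Sum>i<n. (\<Sum>l<k. u l a * u l i)\<^sup>2) = (\<Sum>l<k. (u l a)\<^sup>2)" .
  have "(\<Sum>i<n. ((if i = a then 1 else 0) - (\<Sum>l<k. u l a * u l i))\<^sup>2)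
      = (\<Sum>i<n. (if i = a then 1 else 0) - (if i = a then 2 * (\<Sum>l<k. u l a * u l i) else 0) + (\<Sum>l<k. u l a * u l i)\<^sup>2)"
    by (intro sum.cong) (auto simp: power2_eq_square algebra_simps)
  also have "\<dots> = 1 - 2 * (\<Sum>l<k. u l a * u l a) + (\<Sum>l<k. (u l a)\<^sup>2)"
    using \<open>a < n\<close> by (simp add: sum.distrib sum_subtractf e1)
  finally show ?thesis by (simp add: power2_eq_square)
qed

text \<open>Summed over \<open>a\<close>, the squared distances of the basis vectors from the span
  equal n - k > 0. So some basis vector has a nonzero component orthogonal to the span, and this
  component is normalised.\<close>

lemma orth_sphere_nonempty:
  assumes on: "\<And>l m. l < k \<Longrightarrow> m < k \<Longrightarrow> (\<Sum>i<n. u l i * u m i) = (if l = m then 1 else 0)"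
    and "k < n"
  shows "orth_sphere n u k \<noteq> {}"
proof -
  have "(\<Sum>a<n. 1 - (\<Sum>l<k. (u l a)\<^sup>2)) = real n - (\<Sum>l<k. \<Sum>a<n. u l a * u l a)"
    by (simp add: sum_subtractf power2_eq_square) (rule sum.swap)
  also have "\<dots> = real n - real k" by (simp add: on)
  also have "\<dots> > 0" using \<open>k < n\<close> by simp
  finally have "\<exists>a<n. 1 - (\<Sum>l<k. (u l a)\<^sup>2) > 0"
    by (metis (no_types, lifting) lessThan_iff not_less sum_nonpos)
  then obtain a where a: "a < n" "1 - (\<Sum>l<k. (u l a)\<^sup>2) > 0" by auto
  define w where "w i = (if i = a then 1 else 0) - (\<Sum>l<k. u l a * u l i)" for i
  define c where "c = sqrt (1 - (\<Sum>l<k. (u l a)\<^sup>2))"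
  have c: "c > 0" "c * c = 1 - (\<Sum>l<k. (u l a)\<^sup>2)" using a by (auto simp: c_def)
  have ww: "(\<Sum>i<n. w i * w i) = c * c"
    using sum_orthonormal_coeffs[OF on a(1)] by (simp add: w_def c power2_eq_square)
  have "(\<Sum>i<n. u m i * w i) = 0" if "m < k" for m
  proof -
    have "u m i * w i = (if i = a then u m i else 0) - (\<Sum>l<k. u l a * (u m i * u l i))" for i
      unfolding w_def right_diff_distrib sum_distrib_left by (auto intro!: sum.cong)
    then have "(\<Sum>i<n. u m i * w i) = (\<Sum>i<n. (if i = a then u m i else 0)) - (\<Sum>i<n. \<Sum>l<k. u l a * (u m i * u l i))"
      by (simp add: sum_subtractf)
    also have "(\<Sum>i<n. \<Sum>l<k. u l a * (u m i * u l i)) = (\<Sum>l<k. u l a * (\<Sum>i<n. u m i * u l i))"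
      by (subst sum.swap) (simp add: sum_distrib_left)
    also have "\<dots> = u m a" using that by (simp add: on if_distrib[of "\<lambda>x. _ * x"] cong: if_cong)
    finally show ?thesis using a(1) by simp
  qed
  then have "(\<lambda>i. if i < n then w i / c else 0) \<in> orth_sphere n u k"
    using c ww by (auto simp: orth_sphere_def sum_divide_distrib[symmetric])
  then show ?thesis by auto
qed

text \<open>First-order condition for the Rayleigh quotient. The residual y = A v - L v is
  orthogonal to \<open>v\<close> and to the earlier eigenvectors, so the normalised v + t y is again
  admissible. The quadratic form gains 2 t |y|^2 to first order, which maximality permits only if y
  = 0.\<close>

lemma orth_sphere_max_eigenvector:
  assumes sym: "\<And>i j. i < n \<Longrightarrow> j < n \<Longrightarrow> A i j = A j i"
    and eig: "\<And>l i. l < k \<Longrightarrow> i < n \<Longrightarrow> (\<Sum>j<n. A i j * u l j) = lam l * u l i"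
    and v: "v \<in> orth_sphere n u k"
    and max: "\<And>x. x \<in> orth_sphere n u k \<Longrightarrow> quad_form n A x \<le> quad_form n A v"
    and "i < n"
  shows "(\<Sum>j<n. A i j * v j) = quad_form n A v * v i"
proof -
  define L where "L = quad_form n A v"
  define y where "y i = (if i < n then (\<Sum>j<n. A i j * v j) - L * v i else 0)" for i
  have vv: "(\<Sum>i<n. v i * v i) = 1" and v0: "\<And>i. i \<ge> n \<Longrightarrow> v i = 0"
    and vo: "\<And>l. l < k \<Longrightarrow> (\<Sum>i<n. u l i * v i) = 0"
    using v by (auto simp: orth_sphere_def)
  have yo: "(\<Sum>i<n. u l i * y i) = 0" if "l < k" for l
  proof -
    have "u l i * y i = (\<Sum>j<n. v j * (A j i * u l i)) - L * (u l i * v i)" if "i < n" for i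
    proof -
      have "(\<Sum>j<n. A i j * v j) = (\<Sum>j<n. A j i * v j)" using that sym by (intro sum.cong) auto
      then show ?thesis using that
        unfolding y_def by (simp add: right_diff_distrib sum_distrib_left mult_ac)
    qed
    then have "(\<Sum>i<n. u l i * y i) = (\<Sum>i<n. \<Sum>j<n. v j * (A j i * u l i)) - L * (\<Sum>i<n. u l i * v i)"
      by (simp add: sum_subtractf sum_distrib_left)
    also have "(\<Sum>i<n. \<Sum>j<n. v j * (A j i * u l i)) = (\<Sum>j<n. v j * (\<Sum>i<n. A j i * u l i))"
      by (subst sum.swap) (simp add: sum_distrib_left)
    also have "\<dots> = lam l * (\<Sum>j<n. u l j * v j)"
      using that by (simp add: eig sum_distrib_left mult_ac)
    finally show ?thesis using vo[OF that] by simp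
  qed
  have vy: "(\<Sum>i<n. v i * y i) = 0"
  proof -
    have "(\<Sum>i<n. v i * y i) = L - L * (\<Sum>i<n. v i * v i)"
    proof -
      have "v i * y i = (\<Sum>j<n. A i j * v i * v j) - L * (v i * v i)" if "i < n" for i
        using that unfolding y_def by (simp add: right_diff_distrib sum_distrib_left mult_ac)
      then show ?thesis
        by (simp add: sum_subtractf sum_distrib_left[symmetric]) (simp add: L_def quad_form_def)
    qed
    then show ?thesis using vv by simp
  qed
  define Y where "Y = (\<Sum>i<n. y i * y i)"
  have Av: "(\<Sum>i<n. \<Sum>j<n. A i j * y i * v j) = Y"
  proof -
    have "(\<Sum>i<n. \<Sum>j<n. A i j * y i * v j) = (\<Sum>i<n. y i * (y i + L * v i))"
    proof (rule sum.cong[OF refl])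
      fix i assume "i \<in> {..<n}"
      then have e: "y i + L * v i = (\<Sum>j<n. A i j * v j)" by (simp add: y_def)
      show "(\<Sum>j<n. A i j * y i * v j) = y i * (y i + L * v i)"
        unfolding e sum_distrib_left by (simp add: mult_ac)
    qed
    also have "\<dots> = Y + L * (\<Sum>i<n. v i * y i)"
      by (simp add: Y_def distrib_left sum.distrib sum_distrib_left mult_ac)
    finally show ?thesis using vy by simp
  qed
  have Av': "(\<Sum>i<n. \<Sum>j<n. A i j * v i * y j) = Y"
    unfolding Av[symmetric]
    by (subst sum.swap, intro sum.cong refl) (simp add: sym mult.commute mult.left_commute)
  have expand: "quad_form n A (\<lambda>i. v i + t * y i) = L + 2 * t * Y + t\<^sup>2 * quad_form n A y" for t
  proof -
    have "quad_form n A (\<lambda>i. v i + t * y i)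
       = (\<Sum>i<n. \<Sum>j<n. A i j * v i * v j) + t * (\<Sum>i<n. \<Sum>j<n. A i j * y i * v j)
         + t * (\<Sum>i<n. \<Sum>j<n. A i j * v i * y j) + t\<^sup>2 * (\<Sum>i<n. \<Sum>j<n. A i j * y i * y j)"
      unfolding quad_form_def sum_distrib_left sum.distrib[symmetric]
      by (intro sum.cong) (auto simp: algebra_simps power2_eq_square)
    then show ?thesis by (simp add: Av Av' L_def quad_form_def)
  qed
  have ineq: "L + 2 * t * Y + t\<^sup>2 * quad_form n A y \<le> L * (1 + t\<^sup>2 * Y)" for t
  proof -
    define N where "N = 1 + t\<^sup>2 * Y"
    have Y0: "Y \<ge> 0" unfolding Y_def by (intro sum_nonneg) auto
    have N: "N > 0" unfolding N_def using Y0 by (smt (verit) mult_nonneg_nonneg zero_le_power2)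
    define c where "c = sqrt N"
    have c: "c > 0" "c * c = N" using N by (auto simp: c_def)
    have "(\<Sum>i<n. (v i + t * y i) * (v i + t * y i)) = (\<Sum>i<n. v i * v i) + 2 * t * (\<Sum>i<n. v i * y i) + t\<^sup>2 * Y"
      unfolding Y_def sum_distrib_left sum.distrib[symmetric]
      by (intro sum.cong) (auto simp: algebra_simps power2_eq_square)
    then have nrm: "(\<Sum>i<n. (v i + t * y i) * (v i + t * y i)) = N" using vv vy by (simp add: N_def)
    let ?x = "\<lambda>i. (v i + t * y i) / c"
    have "?x i = 0" if "i \<ge> n" for i using that v0 by (simp add: y_def)
    moreover have "(\<Sum>i<n. ?x i * ?x i) = 1"
    proof -
      have "(\<Sum>i<n. ?x i * ?x i) = (\<Sum>i<n. (v i + t * y i) * (v i + t * y i)) / (c * c)"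
        by (simp add: sum_divide_distrib)
      then show ?thesis using c N by (simp add: nrm)
    qed
    moreover have "(\<Sum>i<n. u l i * ?x i) = 0" if "l < k" for l
    proof -
      have "(\<Sum>i<n. u l i * ?x i) = ((\<Sum>i<n. u l i * v i) + t * (\<Sum>i<n. u l i * y i)) / c"
        unfolding sum_distrib_left sum.distrib[symmetric] sum_divide_distrib
        by (intro sum.cong) (auto simp: algebra_simps)
      then show ?thesis using vo yo that by simp
    qed
    ultimately have "?x \<in> orth_sphere n u k" by (simp add: orth_sphere_def)
    then have "quad_form n A ?x \<le> L" unfolding L_def by (rule max)
    moreover have "quad_form n A ?x = quad_form n A (\<lambda>i. v i + t * y i) / N"
      unfolding quad_form_def sum_divide_distrib c(2)[symmetric] by simp
    ultimately show ?thesis using N unfolding expand N_def[symmetric]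
      by (simp add: divide_le_eq)
  qed
  have Y0: "Y \<ge> 0" unfolding Y_def by (intro sum_nonneg) auto
  have "Y = 0"
  proof (rule ccontr)
    assume "Y \<noteq> 0"
    with Y0 have Yp: "Y > 0" by simp
    \<comment> \<open>At t = Y / D the linear gain 2 Y^2 / D exceeds the quadratic loss, which is at
      most Y^2 / D.\<close>
    define D where "D = \<bar>L * Y - quad_form n A y\<bar> + 1"
    have D: "D > 0" by (simp add: D_def)
    have "2 * t * Y \<le> t\<^sup>2 * (L * Y - quad_form n A y)" for t
      using ineq[of t] by (simp add: algebra_simps)
    then have "2 * (Y/D) * Y \<le> (Y/D)\<^sup>2 * (L * Y - quad_form n A y)" .
    also have "\<dots> \<le> (Y/D)\<^sup>2 * D" unfolding D_def by (intro mult_left_mono) auto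
    also have "\<dots> = (Y/D) * Y" using D by (simp add: power2_eq_square)
    finally show False using Yp D by (simp add: field_simps)
  qed
  then have "y i * y i = 0"
    unfolding Y_def using \<open>i < n\<close> by (subst (asm) sum_nonneg_eq_0_iff) auto
  then show ?thesis using \<open>i < n\<close> by (simp add: y_def L_def)
qed

text \<open>The maximality clause is carried through the induction because it orders the
  eigenvalues: a later eigenvector is still admissible in every earlier maximisation.\<close>

lemma exists_orthonormal_eigenvectors:
  assumes sym: "\<And>i j. i < n \<Longrightarrow> j < n \<Longrightarrow> A i j = A j i"
  shows "k \<le> n \<Longrightarrow> \<exists>u lam. \<forall>j<k. u j \<in> orth_sphere n u j \<and> lam j = quad_form n A (u j)
     \<and> (\<forall>x\<in>orth_sphere n u j. quad_form n A x \<le> lam j)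
     \<and> (\<forall>i<n. (\<Sum>a<n. A i a * u j a) = lam j * u j i)"
proof (induction k)
  case (Suc k)
  then obtain u lam where u: "\<And>j. j<k \<Longrightarrow> u j \<in> orth_sphere n u j \<and> lam j = quad_form n A (u j)
     \<and> (\<forall>x\<in>orth_sphere n u j. quad_form n A x \<le> lam j)
     \<and> (\<forall>i<n. (\<Sum>a<n. A i a * u j a) = lam j * u j i)" by auto
  have on: "(\<Sum>i<n. u l i * u m i) = (if l = m then 1 else 0)" if "l < k" "m < k" for l m
  proof (cases l m rule: linorder_cases)
    case less then show ?thesis using u[OF that(2)] by (auto simp: orth_sphere_def)
  next
    case greater then show ?thesis using u[OF that(1)] by (auto simp: orth_sphere_def mult.commute)
  qed (use u[OF that(1)] in \<open>auto simp: orth_sphere_def\<close>)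
  have ne: "orth_sphere n u k \<noteq> {}"
    by (rule orth_sphere_nonempty[OF on]) (use Suc.prems in auto)
  obtain v where v: "v \<in> orth_sphere n u k"
    "\<And>x. x \<in> orth_sphere n u k \<Longrightarrow> quad_form n A x \<le> quad_form n A v"
    using continuous_attains_sup[OF compact_orth_sphere ne continuous_on_quad_form] by blast
  have ev: "(\<Sum>j<n. A i j * v j) = quad_form n A v * v i" if "i < n" for i
    by (rule orth_sphere_max_eigenvector[OF sym _ v, where lam = lam]) (use u that in auto)
  let ?u = "u(k := v)" and ?lam = "lam(k := quad_form n A v)"
  have K: "orth_sphere n ?u j = orth_sphere n u j" if "j \<le> k" for j
    using that by (auto simp: orth_sphere_def)
  show ?case
  proof (intro exI[of _ ?u] exI[of _ ?lam] allI impI)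
    fix j assume "j < Suc k"
    then consider "j < k" | "j = k" by linarith
    then show "?u j \<in> orth_sphere n ?u j \<and> ?lam j = quad_form n A (?u j)
     \<and> (\<forall>x\<in>orth_sphere n ?u j. quad_form n A x \<le> ?lam j)
     \<and> (\<forall>i<n. (\<Sum>a<n. A i a * ?u j a) = ?lam j * ?u j i)"
    proof cases
      case 1 then show ?thesis unfolding K[OF less_imp_le[OF 1]] using u[of j] by auto
    next
      case 2
      have K': "orth_sphere n ?u j = orth_sphere n u k" using K[of k] 2 by simp
      show ?thesis unfolding K' using v ev 2 by simp
    qed
  qed
qed simp

text \<open>Orthonormal rows of a square matrix give orthonormal columns: the squared distances of
  the basis vectors from the span are nonnegative and add up to n - n = 0.\<close>

lemma orthonormal_complete:
  fixes u :: "nat \<Rightarrow> nat \<Rightarrow> real"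
  assumes on: "\<And>l m. l < n \<Longrightarrow> m < n \<Longrightarrow> (\<Sum>i<n. u l i * u m i) = (if l = m then 1 else 0)"
    and "i < n" "j < n"
  shows "(\<Sum>k<n. u k i * u k j) = (if i = j then 1 else 0)"
proof -
  have nn: "1 - (\<Sum>l<n. (u l a)\<^sup>2) \<ge> 0" if "a < n" for a
    by (rule subst[OF sum_orthonormal_coeffs[OF on that]]) (auto intro: sum_nonneg)
  have "(\<Sum>a<n. 1 - (\<Sum>l<n. (u l a)\<^sup>2)) = real n - (\<Sum>l<n. \<Sum>a<n. u l a * u l a)"
    by (simp add: sum_subtractf power2_eq_square) (rule sum.swap)
  also have "\<dots> = 0" by (simp add: on)
  finally have "1 - (\<Sum>l<n. (u l j)\<^sup>2) = 0"
    using nn \<open>j < n\<close> by (subst (asm) sum_nonneg_eq_0_iff) auto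
  then have "(\<Sum>i<n. ((if i = j then 1 else 0) - (\<Sum>l<n. u l j * u l i))\<^sup>2) = 0"
    using sum_orthonormal_coeffs[OF on \<open>j < n\<close>] by simp
  then have "(if i = j then 1 else 0) - (\<Sum>l<n. u l j * u l i) = 0"
    using \<open>i < n\<close> by (subst (asm) sum_nonneg_eq_0_iff) auto
  then show ?thesis by (simp add: mult.commute)
qed

theorem exists_spectral_decomp:
  assumes sym: "\<And>i j. i < n \<Longrightarrow> j < n \<Longrightarrow> A i j = A j i"
  shows "\<exists>lam u. spectral_decomp n A lam u"
proof -
  obtain u lam where u: "\<And>j. j<n \<Longrightarrow> u j \<in> orth_sphere n u j \<and> lam j = quad_form n A (u j)
     \<and> (\<forall>x\<in>orth_sphere n u j. quad_form n A x \<le> lam j)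
     \<and> (\<forall>i<n. (\<Sum>a<n. A i a * u j a) = lam j * u j i)"
    using exists_orthonormal_eigenvectors[where n = n and A = A and k = n, OF sym] by auto
  have on: "(\<Sum>i<n. u l i * u m i) = (if l = m then 1 else 0)" if "l < n" "m < n" for l m
  proof (cases l m rule: linorder_cases)
    case less then show ?thesis using u[OF that(2)] by (auto simp: orth_sphere_def)
  next
    case greater then show ?thesis using u[OF that(1)] by (auto simp: orth_sphere_def mult.commute)
  qed (use u[OF that(1)] in \<open>auto simp: orth_sphere_def\<close>)
  have "A i j = (\<Sum>k<n. lam k * u k i * u k j)" if "i < n" "j < n" for i j
  proof -
    have "A i a * (\<Sum>k<n. u k a * u k j) = (if a = j then A i a else 0)" if "a < n" for a
      using orthonormal_complete[OF on that \<open>j < n\<close>] by simp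
    then have "A i j = (\<Sum>a<n. A i a * (\<Sum>k<n. u k a * u k j))"
      using that by simp
    also have "\<dots> = (\<Sum>k<n. (\<Sum>a<n. A i a * u k a) * u k j)"
      unfolding sum_distrib_left sum_distrib_right by (subst sum.swap) (simp add: mult_ac)
    also have "\<dots> = (\<Sum>k<n. lam k * u k i * u k j)" using u that by (intro sum.cong) auto
    finally show ?thesis .
  qed
  moreover have "lam l \<le> lam k" if "k \<le> l" "l < n" for k l
  proof -
    have "u l \<in> orth_sphere n u k" using u[OF that(2)] that(1) by (auto simp: orth_sphere_def)
    then show ?thesis using u[of k] u[OF that(2)] that by auto
  qed
  ultimately show ?thesis using on unfolding spectral_decomp_def by blast
qed

section \<open>The resolvent\<close>

text \<open>This is (A - z)^{-1}, written through the same \<open>some_decomp\<close> that enters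
  \<open>ESD\<close>, so that resolvent and spectral distribution speak of the same eigenvalues.
  Independence of the chosen eigenvectors comes from the equations of the inverse,
  \<open>res_mult_left\<close> and \<open>res_unique\<close>.\<close>

definition res :: "nat \<Rightarrow> (nat \<Rightarrow> nat \<Rightarrow> real) \<Rightarrow> complex \<Rightarrow> nat \<Rightarrow> nat \<Rightarrow> complex" where
  "res n A z i j = (let (lam, u) = some_decomp n A in
     \<Sum>k<n. of_real (u k i * u k j) / (of_real (lam k) - z))"

lemma sym_mat_commute: "sym_mat g i j = sym_mat g j i"
  by (auto simp: sym_mat_def)

lemma some_decomp_sym_mat:
  "spectral_decomp n (sym_mat g) (fst (some_decomp n (sym_mat g))) (snd (some_decomp n (sym_mat g)))"
proof -
  obtain lam u where "spectral_decomp n (sym_mat g) lam u"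
    using exists_spectral_decomp[of n "sym_mat g"] sym_mat_commute by blast
  then show ?thesis
    unfolding some_decomp_def
    by (intro someI[of "\<lambda>p. spectral_decomp n (sym_mat g) (fst p) (snd p)" "(lam, u)"]) simp
qed

text \<open>Matrices with the same entries below \<open>n\<close> have the same set of
  decompositions, hence the same \<open>SOME\<close> choice. This transfers equalities of entries to
  \<open>res\<close>, \<open>eigval\<close> and \<open>eigvec\<close>.\<close>

lemma some_decomp_cong:
  assumes "\<And>i j. i < n \<Longrightarrow> j < n \<Longrightarrow> A i j = B i j"
  shows "some_decomp n A = some_decomp n B"
proof -
  have "spectral_decomp n A = spectral_decomp n B"
    using assms by (auto simp: spectral_decomp_def fun_eq_iff)
  then show ?thesis by (simp add: some_decomp_def)
qed

lemma res_cong: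
  assumes "\<And>i j. i < n \<Longrightarrow> j < n \<Longrightarrow> A i j = B i j"
  shows "res n A = res n B"
  by (simp add: res_def some_decomp_cong[OF assms] fun_eq_iff)

context
  fixes n :: nat and g :: "nat \<times> nat \<Rightarrow> real" and z :: complex and eta :: real
  assumes eta: "Im z = eta" "eta > 0"
begin

private definition "evl = fst (some_decomp n (sym_mat g))"
private definition "evc = snd (some_decomp n (sym_mat g))"
private abbreviation (input) "R \<equiv> res n (sym_mat g) z"

private lemma decomp: "spectral_decomp n (sym_mat g) evl evc"
  unfolding evl_def evc_def by (rule some_decomp_sym_mat)

private lemma on: "k < n \<Longrightarrow> l < n \<Longrightarrow> (\<Sum>i<n. evc k i * evc l i) = (if k = l then 1 else 0)"
  using decomp by (simp add: spectral_decomp_def)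

private lemma on': "i < n \<Longrightarrow> j < n \<Longrightarrow> (\<Sum>k<n. evc k i * evc k j) = (if i = j then 1 else 0)"
  by (rule orthonormal_complete[OF on])

private lemma R_eq: "R i j = (\<Sum>k<n. of_real (evc k i * evc k j) / (of_real (evl k) - z))"
  by (simp add: res_def evl_def evc_def split_beta)

private lemma evl_z: "of_real (evl k) - z \<noteq> 0"
  using eta by (auto simp: complex_eq_iff)

lemma res_commute: "R i j = R j i"
  by (simp add: R_eq mult.commute)

lemma res_mult_left:
  assumes "i < n" "c < n"
  shows "(\<Sum>b<n. R i b * of_real (sym_mat g b c)) - z * R i c = (if i = c then 1 else 0)"
proof -
  have S: "(\<Sum>b<n. evc k b * sym_mat g b c) = evl k * evc k c" if "k < n" for k
  proof -
    have "(\<Sum>b<n. evc k b * sym_mat g b c) = (\<Sum>b<n. \<Sum>l<n. evl l * evc l c * (evc k b * evc l b))"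
      using decomp assms by (auto simp: spectral_decomp_def sum_distrib_left mult_ac intro!: sum.cong)
    also have "\<dots> = (\<Sum>l<n. evl l * evc l c * (\<Sum>b<n. evc k b * evc l b))"
      by (subst sum.swap) (simp add: sum_distrib_left)
    also have "\<dots> = (\<Sum>l<n. if l = k then evl k * evc k c else 0)"
      using that by (intro sum.cong) (auto simp: on)
    finally show ?thesis using that by simp
  qed
  have "(\<Sum>b<n. R i b * of_real (sym_mat g b c))
     = (\<Sum>k<n. of_real (evc k i) / (of_real (evl k) - z) * of_real (\<Sum>b<n. evc k b * sym_mat g b c))"
    unfolding R_eq sum_distrib_right of_real_sum sum_distrib_left
    by (subst sum.swap) (simp add: mult_ac)
  also have "\<dots> = (\<Sum>k<n. of_real (evc k i) / (of_real (evl k) - z) * of_real (evl k * evc k c))"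
    by (intro sum.cong refl) (simp add: S)
  finally have "(\<Sum>b<n. R i b * of_real (sym_mat g b c)) - z * R i c
     = (\<Sum>k<n. of_real (evc k i) / (of_real (evl k) - z) * of_real (evl k * evc k c)
          - z * (of_real (evc k i * evc k c) / (of_real (evl k) - z)))"
    unfolding R_eq by (simp add: sum_subtractf sum_distrib_left)
  also have "\<dots> = (\<Sum>k<n. of_real (evc k i * evc k c))"
  proof (intro sum.cong refl)
    fix k
    have "of_real (evc k i) / (of_real (evl k) - z) * of_real (evl k * evc k c)
          - z * (of_real (evc k i * evc k c) / (of_real (evl k) - z))
        = of_real (evc k i * evc k c) * (of_real (evl k) - z) / (of_real (evl k) - z)"
      by (simp add: algebra_simps diff_divide_distrib)
    then show "of_real (evc k i) / (of_real (evl k) - z) * of_real (evl k * evc k c)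
          - z * (of_real (evc k i * evc k c) / (of_real (evl k) - z)) = complex_of_real (evc k i * evc k c)"
      using evl_z[of k] by simp
  qed
  also have "\<dots> = of_real (if i = c then 1 else 0)"
    unfolding of_real_sum[symmetric] on'[OF assms] ..
  finally show ?thesis by simp
qed

text \<open>The Ward identity: R times its adjoint equals Im R / eta. It bounds a whole row of R in
  l^2 by one diagonal entry, uniformly in the matrix, and is the source of all resolvent bounds
  below.\<close>

lemma ward:
  assumes "i < n"
  shows "(\<Sum>j<n. (cmod (R i j))\<^sup>2) = Im (R i i) / eta"
proof -
  define a where "a k = of_real (evc k i) / (of_real (evl k) - z)" for k
  have Ra: "R i j = (\<Sum>k<n. a k * of_real (evc k j))" for j
    by (simp add: R_eq a_def)
  have "of_real (\<Sum>j<n. (cmod (R i j))\<^sup>2) = (\<Sum>j<n. R i j * cnj (R i j))"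
    by (simp only: of_real_sum complex_norm_square)
  also have "\<dots> = (\<Sum>j<n. \<Sum>k<n. \<Sum>l<n. a k * cnj (a l) * of_real (evc k j * evc l j))"
    unfolding Ra by (simp add: sum_product mult_ac)
  also have "\<dots> = (\<Sum>k<n. \<Sum>l<n. a k * cnj (a l) * of_real (\<Sum>j<n. evc k j * evc l j))"
    by (subst sum.swap, rule sum.cong[OF refl], subst sum.swap, simp add: sum_distrib_left)
  also have "\<dots> = (\<Sum>k<n. \<Sum>l<n. if l = k then a k * cnj (a k) else 0)"
    by (intro sum.cong refl) (auto simp: on)
  also have "\<dots> = of_real (\<Sum>k<n. (cmod (a k))\<^sup>2)"
    by (simp add: complex_norm_square del: of_real_power)
  finally have "(\<Sum>j<n. (cmod (R i j))\<^sup>2) = (\<Sum>k<n. (cmod (a k))\<^sup>2)"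
    by (simp only: of_real_eq_iff)
  moreover have "Im (R i i) = (\<Sum>k<n. eta * (cmod (a k))\<^sup>2)"
  proof -
    have "Im (of_real (evc k i * evc k i) / (of_real (evl k) - z)) = eta * (cmod (a k))\<^sup>2" for k
    proof -
      have "Im (of_real (evc k i * evc k i) / (of_real (evl k) - z)) = (evc k i * evc k i) * Im (1 / (of_real (evl k) - z))"
      proof -
        have "of_real (evc k i * evc k i) / (of_real (evl k) - z) = (evc k i * evc k i) *\<^sub>R (1 / (of_real (evl k) - z))"
          by (simp add: scaleR_conv_of_real)
        then show ?thesis by (simp only: scaleR_complex.sel)
      qed
      also have "Im (1 / (of_real (evl k) - z)) = eta / (cmod (of_real (evl k) - z))\<^sup>2"
        using eta by (simp add: Im_divide cmod_power2)
      finally show ?thesis by (simp add: a_def norm_divide power_divide power2_eq_square)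
    qed
    then show ?thesis unfolding R_eq by (simp add: Im_sum)
  qed
  ultimately show ?thesis using eta by (simp add: sum_distrib_left[symmetric])
qed

text \<open>On the diagonal, Ward's identity gives |R_ii|^2 <= |R_ii| / eta, a self-improving bound;
  the off-diagonal entries follow from the same row sum.\<close>

lemma norm_res_le:
  assumes "i < n" "j < n"
  shows "cmod (R i j) \<le> 1 / eta"
proof -
  have "(cmod (R i i))\<^sup>2 \<le> (\<Sum>j<n. (cmod (R i j))\<^sup>2)"
    using assms by (intro member_le_sum) auto
  also have "\<dots> \<le> cmod (R i i) / eta"
    using ward[OF assms(1)] abs_Im_le_cmod[of "R i i"] eta by (simp add: divide_right_mono)
  finally have d: "cmod (R i i) \<le> 1 / eta"
    using eta by (cases "R i i = 0") (auto simp: power2_eq_square field_simps)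
  have "(cmod (R i j))\<^sup>2 \<le> (\<Sum>j<n. (cmod (R i j))\<^sup>2)"
    using assms by (intro member_le_sum) auto
  also have "\<dots> \<le> cmod (R i i) / eta"
    using ward[OF assms(1)] abs_Im_le_cmod[of "R i i"] eta by (simp add: divide_right_mono)
  also have "\<dots> \<le> (1 / eta)\<^sup>2" using divide_right_mono[OF d, of eta] eta by (simp add: power2_eq_square)
  finally show ?thesis using eta by (auto dest: power2_le_imp_le)
qed

lemma sum_norm_res_le:
  assumes "i < n"
  shows "(\<Sum>j<n. (cmod (R i j))\<^sup>2) \<le> cmod (R i i) / eta"
  using ward[OF assms(1)] abs_Im_le_cmod[of "R i i"] eta by (simp add: divide_right_mono)

lemma sum_norm_res_le':
  assumes "i < n"
  shows "(\<Sum>j<n. (cmod (R i j))\<^sup>2) \<le> 1 / eta\<^sup>2"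
proof -
  have "cmod (R i i) / eta \<le> (1 / eta) / eta"
    using norm_res_le[OF assms assms] eta by (intro divide_right_mono) auto
  then show ?thesis using sum_norm_res_le[OF assms] by (simp add: power2_eq_square)
qed

text \<open>Multiplying r (A - z) = y by R from the right gives r = y R. Resolvents of two different
  matrices are compared by taking for \<open>r\<close> a row of one of them and computing the defect
  \<open>y\<close> in the equation of the other.\<close>

lemma res_unique:
  assumes y: "\<And>c. c < n \<Longrightarrow> (\<Sum>b<n. r b * of_real (sym_mat g b c)) - z * r c = y c"
    and "d < n"
  shows "r d = (\<Sum>c<n. y c * R c d)"
proof -
  have "(\<Sum>c<n. y c * R c d) = (\<Sum>c<n. \<Sum>b<n. r b * of_real (sym_mat g b c) * R c d) - (\<Sum>c<n. z * r c * R c d)"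
    unfolding sum_subtractf[symmetric]
    by (intro sum.cong refl) (simp add: y[symmetric] left_diff_distrib sum_distrib_right)
  also have "(\<Sum>c<n. \<Sum>b<n. r b * of_real (sym_mat g b c) * R c d)
      = (\<Sum>b<n. r b * (\<Sum>c<n. R d c * of_real (sym_mat g c b)))"
    unfolding sum_distrib_left
    by (subst sum.swap, intro sum.cong refl) (simp add: mult_ac sym_mat_commute[of g] res_commute[of d])
  also have "\<dots> - (\<Sum>c<n. z * r c * R c d) = (\<Sum>b<n. r b * ((\<Sum>c<n. R d c * of_real (sym_mat g c b)) - z * R d b))"
    unfolding sum_subtractf[symmetric]
    by (intro sum.cong refl) (simp add: algebra_simps res_commute[of d])
  also have "\<dots> = (\<Sum>b<n. if b = d then r d else 0)"
    by (intro sum.cong refl) (use \<open>d < n\<close> in \<open>auto simp: res_mult_left\<close>)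
  finally show ?thesis using \<open>d < n\<close> by simp
qed

end

section \<open>Continuity and measurability of the resolvent in the matrix entries\<close>

lemma res_diff_le:
  assumes eta: "Im z = eta" "eta > 0" and ij: "i < n" "j < n"
  shows "cmod (res n (sym_mat g) z i j - res n (sym_mat h) z i j)
     \<le> (\<Sum>a<n. \<Sum>b<n. \<bar>sym_mat g a b - sym_mat h a b\<bar>) / eta\<^sup>2"
proof -
  let ?R = "res n (sym_mat g) z" and ?S = "res n (sym_mat h) z"
  define y where "y c = (if i = c then 1 else 0) + (\<Sum>b<n. ?R i b * of_real (sym_mat h b c - sym_mat g b c))" for c
  have "?R i j = (\<Sum>c<n. y c * ?S c j)"
  proof (rule res_unique[OF eta _ ij(2)])
    fix c assume "c < n"
    from res_mult_left[OF eta ij(1) this, of g]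
    show "(\<Sum>b<n. ?R i b * of_real (sym_mat h b c)) - z * ?R i c = y c"
      by (simp add: y_def right_diff_distrib sum_subtractf algebra_simps)
  qed
  also have "\<dots> = (\<Sum>c<n. if c = i then ?S i j else 0)
      + (\<Sum>c<n. (\<Sum>b<n. ?R i b * of_real (sym_mat h b c - sym_mat g b c)) * ?S c j)"
    unfolding y_def distrib_right sum.distrib
    by (intro arg_cong2[of _ _ _ _ "(+)"] sum.cong) auto
  finally have "?R i j - ?S i j = (\<Sum>c<n. \<Sum>b<n. ?R i b * of_real (sym_mat h b c - sym_mat g b c) * ?S c j)"
    using ij by (simp add: sum_distrib_right)
  also have "cmod \<dots> \<le> (\<Sum>c<n. \<Sum>b<n. 1 / eta * \<bar>sym_mat g b c - sym_mat h b c\<bar> * (1 / eta))"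
  proof (intro sum_norm_le order.trans[OF norm_sum] sum_mono)
    fix c b assume cb: "c \<in> {..<n}" "b \<in> {..<n}"
    have "cmod (?R i b * of_real (sym_mat h b c - sym_mat g b c) * ?S c j)
        = cmod (?R i b) * \<bar>sym_mat g b c - sym_mat h b c\<bar> * cmod (?S c j)"
      by (simp add: norm_mult abs_minus_commute del: of_real_diff)
    also have "\<dots> \<le> 1 / eta * \<bar>sym_mat g b c - sym_mat h b c\<bar> * (1 / eta)"
      using cb ij eta by (intro mult_mono norm_res_le[OF eta]) auto
    finally show "cmod (?R i b * of_real (sym_mat h b c - sym_mat g b c) * ?S c j)
      \<le> 1 / eta * \<bar>sym_mat g b c - sym_mat h b c\<bar> * (1 / eta)" .
  qed
  also have "\<dots> = (\<Sum>a<n. \<Sum>b<n. \<bar>sym_mat g a b - sym_mat h a b\<bar>) / eta\<^sup>2"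
    by (subst sum.swap) (simp add: sum_divide_distrib power2_eq_square)
  finally show ?thesis .
qed

text \<open>Eigenvectors picked by \<open>SOME\<close> come with no measurable dependence on the
  matrix. The resolvent is nevertheless continuous in the entries, by the resolvent identity behind
  \<open>res_diff_le\<close>, and all measurability statements rest on this.\<close>

lemma continuous_on_res:
  assumes eta: "Im z > 0" and ij: "i < n" "j < n"
  shows "continuous_on UNIV (\<lambda>g :: nat \<times> nat \<Rightarrow> real. res n (sym_mat g) z i j)"
proof -
  have c: "isCont (\<lambda>g. res n (sym_mat g) z i j) h" for h :: "nat \<times> nat \<Rightarrow> real"
  proof -
    let ?B = "\<lambda>g. (\<Sum>a<n. \<Sum>b<n. \<bar>sym_mat g a b - sym_mat h a b\<bar>) / (Im z)\<^sup>2"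
    have "continuous_on UNIV (\<lambda>g::nat \<times> nat \<Rightarrow> real. sym_mat g a b)" for a b
      by (cases "a \<le> b") (simp_all add: sym_mat_def)
    then have "continuous_on UNIV ?B"
      using eta by (intro continuous_intros) auto
    then have "isCont ?B h" by (simp add: continuous_on_eq_continuous_at)
    then have "(?B \<longlongrightarrow> 0) (at h)"
      by (simp add: isCont_def)
    then have "((\<lambda>g. res n (sym_mat g) z i j - res n (sym_mat h) z i j) \<longlongrightarrow> 0) (at h)"
      by (rule Lim_null_comparison[rotated]) (use res_diff_le[OF refl eta ij] in auto)
    then show ?thesis by (simp add: isCont_def LIM_zero_iff)
  qed
  then show ?thesis by (simp add: continuous_on_eq_continuous_at)
qed

lemma measurable_res:
  assumes eta: "Im z > 0" and ij: "i < n" "j < n"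
    and f: "\<And>a b. a \<le> b \<Longrightarrow> b < n \<Longrightarrow> (\<lambda>x. f x (a, b)) \<in> borel_measurable M"
  shows "(\<lambda>x. res n (sym_mat (f x)) z i j) \<in> borel_measurable M"
proof -
  \<comment> \<open>The coordinates that \<open>res\<close> does not read are set to 0, so that the
    map into the full product space is measurable although \<open>f\<close> is controlled only on
    the upper triangle.\<close>
  let ?f = "\<lambda>x p. if fst p \<le> snd p \<and> snd p < n then f x p else (0::real)"
  have "?f \<in> measurable M borel"
  proof (rule measurable_coordinatewise_then_product)
    fix p show "(\<lambda>x. ?f x p) \<in> borel_measurable M"
      using f[of "fst p" "snd p"] by (cases "fst p \<le> snd p \<and> snd p < n") auto
  qed
  then have "(\<lambda>x. res n (sym_mat (?f x)) z i j) \<in> borel_measurable M"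
    using borel_measurable_continuous_onI[OF continuous_on_res[OF eta ij]]
    by (rule measurable_compose)
  moreover have "res n (sym_mat (?f x)) = res n (sym_mat (f x))" for x
    by (rule res_cong) (auto simp: sym_mat_def)
  ultimately show ?thesis by simp
qed

subsection \<open>Removing a row and the corresponding column\<close>

text \<open>Row and column \<open>i\<close> are zeroed instead of deleted. The size and the indices
  stay the same, coordinate \<open>i\<close> decouples, and on the remaining indices the resolvent
  is that of the minor.\<close>

definition zero_row :: "nat \<Rightarrow> (nat \<times> nat \<Rightarrow> real) \<Rightarrow> nat \<times> nat \<Rightarrow> real" where
  "zero_row i g p = (if fst p = i \<or> snd p = i then 0 else g p)"

lemma sym_mat_zero_row: "sym_mat (zero_row i g) a b = (if a = i \<or> b = i then 0 else sym_mat g a b)"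
  by (auto simp: sym_mat_def zero_row_def)

context
  fixes n :: nat and g :: "nat \<times> nat \<Rightarrow> real" and z :: complex and eta :: real and i :: nat
  assumes eta: "Im z = eta" "eta > 0" and i: "i < n"
begin

private abbreviation (input) "Rg \<equiv> res n (sym_mat g) z"
private abbreviation (input) "Sg \<equiv> res n (sym_mat (zero_row i g)) z"
private abbreviation (input) "h b \<equiv> complex_of_real (sym_mat g i b)"

text \<open>Row \<open>j\<close> of the resolvent with its \<open>i\<close>-th coordinate dropped
  solves the equation of the zeroed matrix, with right-hand side e_j (or 0 if j = i) minus R_ji
  times row \<open>i\<close> of the matrix; \<open>res_unique\<close> solves it.\<close>

private lemma row_eq:
  assumes "j < n" "d < n" "d \<noteq> i"
  shows "Rg j d = (if j = i then 0 else Sg j d) - Rg j i * (\<Sum>c\<in>{..<n}-{i}. h c * Sg c d)"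
proof -
  define r where "r b = (if b = i then 0 else Rg j b)" for b
  define y where "y c = (if c = i then 0 else (if j = c then 1 else 0) - Rg j i * h c)" for c
  have "r d = (\<Sum>c<n. y c * Sg c d)"
  proof (rule res_unique[OF eta _ assms(2)])
    fix c assume c: "c < n"
    have "(\<Sum>b<n. Rg j b * of_real (sym_mat g b c)) = Rg j i * h c + (\<Sum>b\<in>{..<n}-{i}. Rg j b * of_real (sym_mat g b c))"
      using i by (subst sum.remove[of _ i]) auto
    moreover have "(\<Sum>b<n. r b * of_real (sym_mat (zero_row i g) b c)) = (if c = i then 0 else (\<Sum>b\<in>{..<n}-{i}. Rg j b * of_real (sym_mat g b c)))"
      using i by (subst sum.remove[of _ i]) (auto simp: sym_mat_zero_row r_def intro!: sum.cong)
    ultimately show "(\<Sum>b<n. r b * of_real (sym_mat (zero_row i g) b c)) - z * r c = y c"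
      using res_mult_left[OF eta assms(1) c, of g] by (simp add: y_def r_def algebra_simps)
  qed
  also have "\<dots> = (\<Sum>c\<in>{..<n}-{i}. (if c = j then Sg j d else 0) - Rg j i * (h c * Sg c d))"
  proof -
    have "y c * Sg c d = (if c = j then Sg j d else 0) - Rg j i * (h c * Sg c d)" if "c \<noteq> i" for c
      using that by (auto simp: y_def algebra_simps)
    moreover have "y i = 0" by (simp add: y_def)
    ultimately show ?thesis
      using i by (subst sum.remove[of _ i], simp, simp) (auto simp del: diff_right_commute intro: sum.cong)
  qed
  also have "\<dots> = (\<Sum>c\<in>{..<n}-{i}. (if c = j then Sg j d else 0)) - Rg j i * (\<Sum>c\<in>{..<n}-{i}. h c * Sg c d)"
    by (simp add: sum_subtractf sum_distrib_left)
  also have "(\<Sum>c\<in>{..<n}-{i}. (if c = j then Sg j d else 0)) = (if j = i then 0 else Sg j d)"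
    using assms by simp
  finally show ?thesis using assms by (simp add: r_def)
qed

lemma res_row_eq:
  assumes "d < n" "d \<noteq> i"
  shows "Rg i d = - Rg i i * (\<Sum>c\<in>{..<n}-{i}. h c * Sg c d)"
  using row_eq[OF i assms] by simp

text \<open>The Schur complement formula. It is entry (i, i) of R (A - z) = 1 after the off-diagonal
  entries of row \<open>i\<close> of R have been expressed through R_ii and the resolvent of the
  minor.\<close>

lemma res_schur:
  "Rg i i * (h i - z - (\<Sum>b\<in>{..<n}-{i}. \<Sum>c\<in>{..<n}-{i}. h b * h c * Sg b c)) = 1"
proof -
  have "1 = (\<Sum>b<n. Rg i b * of_real (sym_mat g b i)) - z * Rg i i"
    using res_mult_left[OF eta i i, of g] by simp
  also have "(\<Sum>b<n. Rg i b * of_real (sym_mat g b i)) = Rg i i * h i + (\<Sum>b\<in>{..<n}-{i}. Rg i b * h b)"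
  proof -
    have "(\<Sum>b<n. Rg i b * of_real (sym_mat g b i)) = (\<Sum>b<n. Rg i b * h b)"
      by (intro sum.cong refl) (subst sym_mat_commute, rule refl)
    then show ?thesis using i sum.remove[of "{..<n}" i "\<lambda>b. Rg i b * h b"] by simp
  qed
  also have "(\<Sum>b\<in>{..<n}-{i}. Rg i b * h b) = (\<Sum>b\<in>{..<n}-{i}. - Rg i i * (\<Sum>c\<in>{..<n}-{i}. h c * Sg c b) * h b)"
  proof (intro sum.cong refl)
    fix b assume "b \<in> {..<n}-{i}"
    then have b: "b < n" "b \<noteq> i" by auto
    show "Rg i b * h b = - Rg i i * (\<Sum>c\<in>{..<n}-{i}. h c * Sg c b) * h b"
      by (subst res_row_eq[OF b]) (rule refl)
  qed
  also have "\<dots> = - Rg i i * (\<Sum>b\<in>{..<n}-{i}. \<Sum>c\<in>{..<n}-{i}. h b * h c * Sg b c)"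
  proof -
    have "- Rg i i * (\<Sum>c\<in>{..<n}-{i}. h c * Sg c b) * h b = - Rg i i * (\<Sum>c\<in>{..<n}-{i}. h b * h c * Sg b c)" for b
      by (subst res_commute[OF eta, of _ _ b]) (simp add: sum_distrib_left sum_distrib_right mult_ac)
    then show ?thesis by (simp only: sum_distrib_left[of "- Rg i i"])
  qed
  finally show ?thesis by (simp add: algebra_simps)
qed

lemma res_diag_nonzero: "Rg i i \<noteq> 0"
  using res_schur by auto

lemma res_minor:
  assumes "j < n" "j \<noteq> i" "d < n" "d \<noteq> i"
  shows "Rg j d - Sg j d = Rg j i * Rg i d / Rg i i"
  using row_eq[OF assms(1,3,4)] res_row_eq[OF assms(3,4)] res_diag_nonzero assms(2)
  by (simp add: field_simps)

lemma res_minor_diag_le: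
  assumes "j < n" "j \<noteq> i"
  shows "cmod (Rg j j - Sg j j) = (cmod (Rg i j))\<^sup>2 / cmod (Rg i i)"
  using res_minor[OF assms assms]
  by (simp add: norm_mult norm_divide power2_eq_square res_commute[OF eta, of n g j i])

text \<open>Each difference is |R_ij|^2 / |R_ii|, and Ward's identity sums the numerators to at most
  |R_ii| / eta. The matrix entries do not enter the bound.\<close>

lemma sum_res_minor_diag_le: "(\<Sum>j\<in>{..<n}-{i}. cmod (Rg j j - Sg j j)) \<le> 1 / eta"
proof -
  have "(\<Sum>j\<in>{..<n}-{i}. cmod (Rg j j - Sg j j)) = (\<Sum>j\<in>{..<n}-{i}. (cmod (Rg i j))\<^sup>2) / cmod (Rg i i)"
    unfolding sum_divide_distrib by (intro sum.cong) (auto simp: res_minor_diag_le)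
  also have "\<dots> \<le> (\<Sum>j<n. (cmod (Rg i j))\<^sup>2) / cmod (Rg i i)"
    by (intro divide_right_mono sum_mono2) auto
  also have "\<dots> \<le> (cmod (Rg i i) / eta) / cmod (Rg i i)"
    by (intro divide_right_mono sum_norm_res_le[OF eta i]) auto
  finally show ?thesis using res_diag_nonzero by simp
qed

lemma sum_res_zero_row_diag_le: "(\<Sum>j<n. cmod (Rg j j - Sg j j)) \<le> 3 / eta"
proof -
  have "cmod (Rg i i - Sg i i) \<le> 1 / eta + 1 / eta"
    by (intro order.trans[OF norm_triangle_ineq4] add_mono norm_res_le[OF eta i i])
  then show ?thesis
    using sum_res_minor_diag_le i by (subst sum.remove[of _ i]) auto
qed

end

text \<open>Both resolvents are compared with the common one in which row and column
  \<open>i\<close> vanish, at a cost of 3 / eta each. This is the bounded-difference estimate for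
  unbounded entries.\<close>

lemma sum_res_row_change_le:
  assumes eta: "Im z = eta" "eta > 0" and i: "i < n"
    and eq: "\<And>a b. a \<le> b \<Longrightarrow> b < n \<Longrightarrow> a \<noteq> i \<Longrightarrow> b \<noteq> i \<Longrightarrow> g (a, b) = h (a, b)"
  shows "(\<Sum>j<n. cmod (res n (sym_mat g) z j j - res n (sym_mat h) z j j)) \<le> 6 / eta"
proof -
  have S: "res n (sym_mat (zero_row i g)) = res n (sym_mat (zero_row i h))"
    by (rule res_cong) (auto simp: sym_mat_def zero_row_def eq)
  let ?S = "res n (sym_mat (zero_row i g)) z"
  have "(\<Sum>j<n. cmod (res n (sym_mat g) z j j - res n (sym_mat h) z j j))
     \<le> (\<Sum>j<n. cmod (res n (sym_mat g) z j j - ?S j j) + cmod (res n (sym_mat h) z j j - ?S j j))"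
    by (intro sum_mono) (metis norm_triangle_sub norm_minus_commute dist_norm dist_triangle2)
  also have "\<dots> \<le> 3 / eta + 3 / eta"
    unfolding sum.distrib
    by (intro add_mono sum_res_zero_row_diag_le[OF eta i]) (simp only: S sum_res_zero_row_diag_le[OF eta i])
  finally show ?thesis by simp
qed

section \<open>McDiarmid's inequality for block-wise bounded differences\<close>

lemma nn_integral_PiM_Un_le:
  assumes ps: "\<And>i. prob_space (M i)" and fin: "finite I" "finite J" and disj: "I \<inter> J = {}"
    and f: "f \<in> borel_measurable (PiM (I \<union> J) M)"
    and le: "\<And>x. x \<in> space (PiM I M) \<Longrightarrow> (\<integral>\<^sup>+ y. f (merge I J (x, y)) \<partial>PiM J M) \<le> C"
  shows "(\<integral>\<^sup>+ x. f x \<partial>PiM (I \<union> J) M) \<le> C"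
proof -
  interpret product_prob_space M I by (rule product_prob_spaceI) (rule ps)
  have "(\<integral>\<^sup>+ x. f x \<partial>PiM (I \<union> J) M) = (\<integral>\<^sup>+ x. (\<integral>\<^sup>+ y. f (merge I J (x, y)) \<partial>PiM J M) \<partial>PiM I M)"
    by (rule product_nn_integral_fold[OF disj fin f])
  also have "\<dots> \<le> (\<integral>\<^sup>+ x. C \<partial>PiM I M)"
    by (intro nn_integral_mono le)
  also have "\<dots> = C" by (simp add: emeasure_space_1)
  finally show ?thesis .
qed

text \<open>Induction over the blocks. Integrating out block \<open>k\<close> turns F into G, which
  inherits the bounds and the bounded differences. Given the other blocks, F lies in an interval of
  length 2 c around G, so Hoeffding's lemma contributes a factor exp(t^2 (2 c)^2 / 8) = exp(t^2 c^2
  / 2).\<close>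

lemma mcdiarmid_mgf:
  fixes M :: "'i \<Rightarrow> 'a measure" and b :: "'i \<Rightarrow> 'k" and F :: "('i \<Rightarrow> 'a) \<Rightarrow> real"
  assumes ps: "\<And>i. prob_space (M i)" and I: "finite I" and t: "t > 0" and c: "c \<ge> 0"
  shows "finite K \<Longrightarrow> F \<in> borel_measurable (PiM {p\<in>I. b p \<in> K} M) \<Longrightarrow>
     (\<And>x. x \<in> space (PiM {p\<in>I. b p \<in> K} M) \<Longrightarrow> \<bar>F x\<bar> \<le> B) \<Longrightarrow>
     (\<And>k x y. k \<in> K \<Longrightarrow> x \<in> space (PiM {p\<in>I. b p \<in> K} M) \<Longrightarrow> y \<in> space (PiM {p\<in>I. b p \<in> K} M) \<Longrightarrow>
        (\<And>p. p \<in> I \<Longrightarrow> b p \<in> K \<Longrightarrow> b p \<noteq> k \<Longrightarrow> x p = y p) \<Longrightarrow> \<bar>F x - F y\<bar> \<le> c) \<Longrightarrow>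
     (\<integral>\<^sup>+ x. exp (t * (F x - (\<integral>y. F y \<partial>PiM {p\<in>I. b p \<in> K} M))) \<partial>PiM {p\<in>I. b p \<in> K} M)
        \<le> ennreal (exp (t\<^sup>2 * c\<^sup>2 / 2) ^ card K)"
proof (induction K arbitrary: F rule: finite_induct)
  case empty
  interpret product_prob_space M "{}" by (rule product_prob_spaceI) (rule ps)
  show ?case by (simp add: PiM_empty nn_integral_count_space_finite lebesgue_integral_count_space_finite)
next
  case (insert k K)
  let ?J = "{p\<in>I. b p \<in> K}" and ?L = "{p\<in>I. b p = k}"
  have U: "{p\<in>I. b p \<in> insert k K} = ?J \<union> ?L" by auto
  have disj: "?J \<inter> ?L = {}" using insert.hyps by auto
  have fin: "finite ?J" "finite ?L" using I by auto
  interpret J: product_prob_space M ?J by (rule product_prob_spaceI) (rule ps)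
  interpret L: product_prob_space M ?L by (rule product_prob_spaceI) (rule ps)
  interpret P: product_prob_space M "?J \<union> ?L" by (rule product_prob_spaceI) (rule ps)
  note Fm[measurable] = insert.prems(1)[unfolded U]
  note FB = insert.prems(2)[unfolded U]
  have Fc: "\<bar>F x - F y\<bar> \<le> c"
    if "l \<in> insert k K" "x \<in> space (PiM (?J \<union> ?L) M)" "y \<in> space (PiM (?J \<union> ?L) M)"
      "\<And>p. p \<in> I \<Longrightarrow> b p \<in> insert k K \<Longrightarrow> b p \<noteq> l \<Longrightarrow> x p = y p" for l x y
    using insert.prems(3)[of l x y] that unfolding U by auto
  have mg: "merge ?J ?L (x, y) \<in> space (PiM (?J \<union> ?L) M)"
    if "x \<in> space (PiM ?J M)" "y \<in> space (PiM ?L M)" for x y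
    using that measurable_space[OF measurable_merge, of "(x, y)" ?J M ?L] by (simp add: space_pair_measure)
  have intF: "integrable (PiM (?J \<union> ?L) M) F"
    by (rule P.P.integrable_const_bound[where B = B]) (use FB in \<open>auto intro!: AE_I2\<close>)
  define G where "G x = (\<integral>y. F (merge ?J ?L (x, y)) \<partial>PiM ?L M)" for x
  have Gm[measurable]: "G \<in> borel_measurable (PiM ?J M)"
    unfolding G_def by measurable
  have EG: "(\<integral>y. F y \<partial>PiM (?J \<union> ?L) M) = (\<integral>x. G x \<partial>PiM ?J M)"
    unfolding G_def by (rule J.product_integral_fold[OF disj fin intF])
  have meas_y: "(\<lambda>y. F (merge ?J ?L (x, y))) \<in> borel_measurable (PiM ?L M)"
    if "x \<in> space (PiM ?J M)" for x
    using that by measurable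
  have int_y: "integrable (PiM ?L M) (\<lambda>y. F (merge ?J ?L (x, y)))" if "x \<in> space (PiM ?J M)" for x
    by (rule L.P.integrable_const_bound[where B = B]) (use FB mg that meas_y in \<open>auto intro!: AE_I2\<close>)
  have IH: "(\<integral>\<^sup>+ x. exp (t * (G x - (\<integral>y. G y \<partial>PiM ?J M))) \<partial>PiM ?J M) \<le> ennreal (exp (t\<^sup>2 * c\<^sup>2 / 2) ^ card K)"
  proof (rule insert.IH[OF Gm])
    fix x assume x: "x \<in> space (PiM ?J M)"
    have "\<bar>G x\<bar> \<le> (\<integral>y. \<bar>F (merge ?J ?L (x, y))\<bar> \<partial>PiM ?L M)"
      unfolding G_def by (rule integral_abs_bound)
    also have "\<dots> \<le> (\<integral>y. B \<partial>PiM ?L M)"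
      by (intro integral_mono integrable_abs int_y x) (use FB mg x in auto)
    finally show "\<bar>G x\<bar> \<le> B" by (simp add: L.P.prob_space)
  next
    fix l x y assume l: "l \<in> K" and x: "x \<in> space (PiM ?J M)" and y: "y \<in> space (PiM ?J M)"
      and eq: "\<And>p. p \<in> I \<Longrightarrow> b p \<in> K \<Longrightarrow> b p \<noteq> l \<Longrightarrow> x p = y p"
    have "\<bar>G x - G y\<bar> = \<bar>\<integral>w. F (merge ?J ?L (x, w)) - F (merge ?J ?L (y, w)) \<partial>PiM ?L M\<bar>"
      unfolding G_def by (simp add: int_y x y)
    also have "\<dots> \<le> (\<integral>w. \<bar>F (merge ?J ?L (x, w)) - F (merge ?J ?L (y, w))\<bar> \<partial>PiM ?L M)"
      by (rule integral_abs_bound)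
    also have "\<dots> \<le> (\<integral>w. c \<partial>PiM ?L M)"
    proof (intro integral_mono integrable_abs Bochner_Integration.integrable_diff int_y x y)
      fix w assume w: "w \<in> space (PiM ?L M)"
      show "\<bar>F (merge ?J ?L (x, w)) - F (merge ?J ?L (y, w))\<bar> \<le> c"
        by (rule Fc[of l]) (use l mg x y w eq in \<open>auto simp: merge_def\<close>)
    qed auto
    finally show "\<bar>G x - G y\<bar> \<le> c" by (simp add: L.P.prob_space)
  qed
  have inner: "(\<integral>\<^sup>+ y. exp (t * (F (merge ?J ?L (x, y)) - G x)) \<partial>PiM ?L M) \<le> ennreal (exp (t\<^sup>2 * c\<^sup>2 / 2))"
    if x: "x \<in> space (PiM ?J M)" for x
  proof -
    have rng: "\<bar>F (merge ?J ?L (x, y)) - G x\<bar> \<le> c" if y: "y \<in> space (PiM ?L M)" for y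
    proof -
      have "\<bar>F (merge ?J ?L (x, y)) - G x\<bar> = \<bar>\<integral>w. F (merge ?J ?L (x, y)) - F (merge ?J ?L (x, w)) \<partial>PiM ?L M\<bar>"
        unfolding G_def by (simp add: int_y x L.P.prob_space)
      also have "\<dots> \<le> (\<integral>w. \<bar>F (merge ?J ?L (x, y)) - F (merge ?J ?L (x, w))\<bar> \<partial>PiM ?L M)"
        by (rule integral_abs_bound)
      also have "\<dots> \<le> (\<integral>w. c \<partial>PiM ?L M)"
      proof (intro integral_mono integrable_abs Bochner_Integration.integrable_diff int_y x)
        fix w assume w: "w \<in> space (PiM ?L M)"
        show "\<bar>F (merge ?J ?L (x, y)) - F (merge ?J ?L (x, w))\<bar> \<le> c"
          by (rule Fc[of k]) (use mg x y w in \<open>auto simp: merge_def\<close>)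
      qed auto
      finally show ?thesis by (simp add: L.P.prob_space)
    qed
    interpret H: interval_bounded_random_variable "PiM ?L M" "\<lambda>y. F (merge ?J ?L (x, y))" "G x - c" "G x + c"
    proof
      show "AE y in PiM ?L M. F (merge ?J ?L (x, y)) \<in> {G x - c..G x + c}"
        using rng by (intro AE_I2) (fastforce simp: abs_le_iff algebra_simps)
    qed (rule meas_y[OF x])
    have "(G x + c - (G x - c))\<^sup>2 / 8 = c\<^sup>2 / 2" by (simp add: power2_eq_square)
    then have "t\<^sup>2 * (G x + c - (G x - c))\<^sup>2 / 8 = t\<^sup>2 * c\<^sup>2 / 2" by (metis times_divide_eq_right)
    with H.Hoeffdings_lemma_nn_integral[OF t] show ?thesis
      by (simp add: G_def mult.commute)
  qed
  have "(\<integral>\<^sup>+ x. exp (t * (F x - (\<integral>y. F y \<partial>PiM (?J \<union> ?L) M))) \<partial>PiM (?J \<union> ?L) M)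
     = (\<integral>\<^sup>+ x. \<integral>\<^sup>+ y. exp (t * (F (merge ?J ?L (x, y)) - (\<integral>x. G x \<partial>PiM ?J M))) \<partial>PiM ?L M \<partial>PiM ?J M)"
    unfolding EG by (rule J.product_nn_integral_fold[OF disj fin]) measurable
  also have "\<dots> \<le> (\<integral>\<^sup>+ x. ennreal (exp (t\<^sup>2 * c\<^sup>2 / 2)) * exp (t * (G x - (\<integral>x. G x \<partial>PiM ?J M))) \<partial>PiM ?J M)"
  proof (intro nn_integral_mono)
    fix x assume x: "x \<in> space (PiM ?J M)"
    let ?E = "\<integral>x. G x \<partial>PiM ?J M"
    have "(\<integral>\<^sup>+ y. exp (t * (F (merge ?J ?L (x, y)) - ?E)) \<partial>PiM ?L M)
      = (\<integral>\<^sup>+ y. ennreal (exp (t * (F (merge ?J ?L (x, y)) - G x))) * ennreal (exp (t * (G x - ?E))) \<partial>PiM ?L M)"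
      by (intro nn_integral_cong) (simp add: ennreal_mult'[symmetric] exp_add[symmetric] algebra_simps)
    also have "\<dots> = (\<integral>\<^sup>+ y. exp (t * (F (merge ?J ?L (x, y)) - G x)) \<partial>PiM ?L M) * ennreal (exp (t * (G x - ?E)))"
      by (intro nn_integral_multc measurable_compose[OF meas_y[OF x], of "\<lambda>v. ennreal (exp (t * (v - G x)))"]) measurable
    also have "\<dots> \<le> ennreal (exp (t\<^sup>2 * c\<^sup>2 / 2)) * ennreal (exp (t * (G x - ?E)))"
      by (intro mult_right_mono inner x) auto
    finally show "(\<integral>\<^sup>+ y. exp (t * (F (merge ?J ?L (x, y)) - ?E)) \<partial>PiM ?L M)
       \<le> ennreal (exp (t\<^sup>2 * c\<^sup>2 / 2)) * exp (t * (G x - ?E))" .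
  qed
  also have "\<dots> = ennreal (exp (t\<^sup>2 * c\<^sup>2 / 2)) * (\<integral>\<^sup>+ x. exp (t * (G x - (\<integral>x. G x \<partial>PiM ?J M))) \<partial>PiM ?J M)"
    by (intro nn_integral_cmult) measurable
  also have "\<dots> \<le> ennreal (exp (t\<^sup>2 * c\<^sup>2 / 2)) * ennreal (exp (t\<^sup>2 * c\<^sup>2 / 2) ^ card K)"
    by (intro mult_left_mono IH) auto
  also have "\<dots> = ennreal (exp (t\<^sup>2 * c\<^sup>2 / 2) ^ card (insert k K))"
    using insert.hyps by (simp add: ennreal_mult'[symmetric])
  finally show ?case unfolding U .
qed

lemma measure_ge_le_exp:
  assumes "prob_space M" "f \<in> borel_measurable M" "t > 0"
    and "(\<integral>\<^sup>+ x. ennreal (exp (t * f x)) \<partial>M) \<le> ennreal C" "C \<ge> 0"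
  shows "measure M {x\<in>space M. f x \<ge> s} \<le> exp (- t * s) * C"
proof -
  interpret prob_space M by fact
  note [measurable] = assms(2)
  have "emeasure M {x\<in>space M. f x \<ge> s} \<le> emeasure M {x\<in>space M. 1 \<le> ennreal (exp (- t * s)) * ennreal (exp (t * f x))}"
  proof (intro emeasure_mono subsetI)
    fix x assume x: "x \<in> {x\<in>space M. f x \<ge> s}"
    then have "0 \<le> t * (f x - s)" using assms(3) by simp
    then have "1 \<le> exp (- t * s) * exp (t * f x)"
      by (simp add: exp_add[symmetric] algebra_simps)
    then show "x \<in> {x\<in>space M. 1 \<le> ennreal (exp (- t * s)) * ennreal (exp (t * f x))}"
      using x by (simp add: ennreal_mult'[symmetric])
  qed measurable
  also have "\<dots> \<le> ennreal (exp (- t * s)) * (\<integral>\<^sup>+ x. ennreal (exp (t * f x)) * indicator (space M) x \<partial>M)"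
    by (rule nn_integral_Markov_inequality) measurable
  also have "(\<integral>\<^sup>+ x. ennreal (exp (t * f x)) * indicator (space M) x \<partial>M) = (\<integral>\<^sup>+ x. ennreal (exp (t * f x)) \<partial>M)"
    by (intro nn_integral_cong) auto
  also have "ennreal (exp (- t * s)) * \<dots> \<le> ennreal (exp (- t * s)) * ennreal C"
    by (intro mult_left_mono assms) auto
  finally show ?thesis using assms(5) by (simp add: emeasure_eq_measure ennreal_mult'[symmetric])
qed

theorem mcdiarmid:
  fixes M :: "'i \<Rightarrow> 'a measure" and b :: "'i \<Rightarrow> 'k" and F :: "('i \<Rightarrow> 'a) \<Rightarrow> real"
  assumes ps: "\<And>i. prob_space (M i)" and I: "finite I" and K: "finite K" "K \<noteq> {}" "b ` I \<subseteq> K"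
    and c: "c > 0" and e: "e > 0"
    and F: "F \<in> borel_measurable (PiM I M)"
    and B: "\<And>x. x \<in> space (PiM I M) \<Longrightarrow> \<bar>F x\<bar> \<le> B"
    and bd: "\<And>k x y. k \<in> K \<Longrightarrow> x \<in> space (PiM I M) \<Longrightarrow> y \<in> space (PiM I M) \<Longrightarrow>
        (\<And>p. p \<in> I \<Longrightarrow> b p \<noteq> k \<Longrightarrow> x p = y p) \<Longrightarrow> \<bar>F x - F y\<bar> \<le> c"
  shows "measure (PiM I M) {x\<in>space (PiM I M). F x \<ge> (\<integral>y. F y \<partial>PiM I M) + e}
     \<le> exp (- e\<^sup>2 / (2 * real (card K) * c\<^sup>2))"
proof -
  interpret product_prob_space M I by (rule product_prob_spaceI) (rule ps)
  note [measurable] = F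
  define N where "N = real (card K)"
  have N: "N > 0" using K by (simp add: N_def card_gt_0_iff)
  \<comment> \<open>The minimiser of the Chernoff exponent - t e + N t^2 c^2 / 2.\<close>
  define t where "t = e / (N * c\<^sup>2)"
  have t: "t > 0" using e N c by (simp add: t_def)
  have IK: "{p\<in>I. b p \<in> K} = I" using K by auto
  let ?E = "\<integral>y. F y \<partial>PiM I M"
  have mgf: "(\<integral>\<^sup>+ x. exp (t * (F x - ?E)) \<partial>PiM I M) \<le> ennreal (exp (t\<^sup>2 * c\<^sup>2 / 2) ^ card K)"
    using mcdiarmid_mgf[where M = M and I = I and t = t and c = c and K = K and F = F and b = b and B = B,
        OF ps I t less_imp_le[OF c] K(1)] F B bd K(3) unfolding IK by (smt (verit, ccfv_threshold) image_subset_iff)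
  have "measure (PiM I M) {x\<in>space (PiM I M). F x \<ge> ?E + e} = measure (PiM I M) {x\<in>space (PiM I M). F x - ?E \<ge> e}"
    by (simp add: le_diff_eq add.commute)
  also have "\<dots> \<le> exp (- t * e) * exp (t\<^sup>2 * c\<^sup>2 / 2) ^ card K"
    by (rule measure_ge_le_exp[OF prob_space_axioms _ t mgf]) auto
  also have "\<dots> = exp (- t * e + N * (t\<^sup>2 * c\<^sup>2 / 2))"
  proof -
    have "exp (t\<^sup>2 * c\<^sup>2 / 2) ^ card K = exp (N * (t\<^sup>2 * c\<^sup>2 / 2))"
      unfolding N_def by (rule exp_of_nat_mult[symmetric])
    then show ?thesis unfolding exp_add by (simp only:)
  qed
  also have "- t * e + N * (t\<^sup>2 * c\<^sup>2 / 2) = - e\<^sup>2 / (2 * N * c\<^sup>2)"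
    using N c by (simp add: t_def field_simps power2_eq_square)
  finally show ?thesis unfolding N_def .
qed

section \<open>Concentration of the diagonal of the resolvent\<close>

subsection \<open>Second moments of linear and quadratic forms\<close>

text \<open>The moment conditions shared by centred Gaussians and by symmetric two-point laws, so
  that one estimate serves both X and the sign matrix. A law concentrated at 0 is included, which
  accommodates the vanishing diagonal of W.\<close>

definition gauss_like :: "real measure \<Rightarrow> real \<Rightarrow> bool" where
  "gauss_like N v \<longleftrightarrow> prob_space N \<and> sets N = sets borel \<and> (\<forall>k\<le>4. integrable N (\<lambda>x. x ^ k)) \<and>
     (\<integral>x. x \<partial>N) = 0 \<and> (\<integral>x. x^2 \<partial>N) = v \<and> (\<integral>x. x^3 \<partial>N) = 0 \<and> (\<integral>x. x^4 \<partial>N) \<le> 3 * v^2"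

lemma gauss_like_nonneg: "gauss_like N v \<Longrightarrow> v \<ge> 0"
  unfolding gauss_like_def by (auto intro!: integral_nonneg)

lemma gauss_like_square_le:
  assumes "gauss_like N v"
  shows "(\<integral>\<^sup>+ y. ennreal ((e + b * y + a * y\<^sup>2)\<^sup>2) \<partial>N) \<le> ennreal (e\<^sup>2 + (b\<^sup>2 + 2 * e * a) * v + 3 * a\<^sup>2 * v\<^sup>2)"
proof -
  interpret prob_space N using assms by (simp add: gauss_like_def)
  have int: "integrable N (\<lambda>x. x ^ k)" if "k \<le> 4" for k
    using assms that by (simp add: gauss_like_def)
  have int1: "integrable N (\<lambda>x. x)" using int[of 1] by simp
  have eq: "(e + b * y + a * y\<^sup>2)\<^sup>2 = e\<^sup>2 + 2 * e * b * y + (b\<^sup>2 + 2 * e * a) * y ^ 2 + 2 * a * b * y ^ 3 + a\<^sup>2 * y ^ 4" for y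
    by (simp add: power2_eq_square power3_eq_cube power4_eq_xxxx algebra_simps)
  have I: "integrable N (\<lambda>y. (e + b * y + a * y\<^sup>2)\<^sup>2)"
    unfolding eq by (intro Bochner_Integration.integrable_add integrable_mult_right int int1 integrable_const) auto
  have "(\<integral>\<^sup>+ y. ennreal ((e + b * y + a * y\<^sup>2)\<^sup>2) \<partial>N) = ennreal (\<integral>y. (e + b * y + a * y\<^sup>2)\<^sup>2 \<partial>N)"
    by (rule nn_integral_eq_integral[OF I]) simp
  also have "(\<integral>y. (e + b * y + a * y\<^sup>2)\<^sup>2 \<partial>N)
     = e\<^sup>2 + 2 * e * b * (\<integral>y. y \<partial>N) + (b\<^sup>2 + 2 * e * a) * (\<integral>y. y^2 \<partial>N) + 2 * a * b * (\<integral>y. y^3 \<partial>N) + a\<^sup>2 * (\<integral>y. y^4 \<partial>N)"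
    unfolding eq using int[of 2] int[of 3] int[of 4] int1 by (simp add: prob_space)
  also have "\<dots> \<le> e\<^sup>2 + (b\<^sup>2 + 2 * e * a) * v + a\<^sup>2 * (3 * v\<^sup>2)"
    using assms by (auto simp: gauss_like_def intro!: mult_left_mono)
  finally show ?thesis by (simp add: ennreal_leI mult_ac)
qed

lemma borel_measurable_component:
  assumes "\<And>p. sets (M p) = sets borel" "p \<in> J"
  shows "(\<lambda>x. x p) \<in> borel_measurable (PiM J M)"
  by (subst measurable_cong_sets[OF refl assms(1)[of p, symmetric]]) (rule measurable_component_singleton[OF assms(2)])

lemma sum_insert_square:
  fixes f :: "'i \<Rightarrow> 'i \<Rightarrow> real"
  assumes "finite J" "l \<notin> J"
  shows "(\<Sum>p\<in>insert l J. \<Sum>r\<in>insert l J. f p r)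
     = f l l + (\<Sum>r\<in>J. f l r) + (\<Sum>p\<in>J. f p l) + (\<Sum>p\<in>J. \<Sum>r\<in>J. f p r)"
  using assms by (simp add: sum.distrib)

context
  fixes M :: "'i \<Rightarrow> real measure" and v :: "'i \<Rightarrow> real"
  assumes gl: "\<And>p. gauss_like (M p) (v p)"
begin

private lemma sets_M: "sets (M p) = sets borel"
  using gl[of p] by (simp add: gauss_like_def)

private lemma ps_M: "prob_space (M p)"
  using gl[of p] by (simp add: gauss_like_def)

lemmas component_measurable = borel_measurable_component[of M, OF sets_M]

lemma linear_form_second_moment:
  assumes "finite J"
  shows "(\<integral>\<^sup>+ x. ennreal ((\<Sum>p\<in>J. a p * x p)\<^sup>2) \<partial>PiM J M) \<le> ennreal (\<Sum>p\<in>J. (a p)\<^sup>2 * v p)"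
  using assms
proof (induction J rule: finite_induct)
  case empty
  then show ?case by simp
next
  case (insert l J)
  interpret product_prob_space M J by (rule product_prob_spaceI) (rule ps_M)
  note [measurable] = component_measurable
  have v0: "v p \<ge> 0" for p by (rule gauss_like_nonneg[OF gl])
  have "(\<integral>\<^sup>+ x. ennreal ((\<Sum>p\<in>insert l J. a p * x p)\<^sup>2) \<partial>PiM (insert l J) M)
     = (\<integral>\<^sup>+ x. \<integral>\<^sup>+ y. ennreal ((\<Sum>p\<in>insert l J. a p * (x(l := y)) p)\<^sup>2) \<partial>M l \<partial>PiM J M)"
    by (rule product_nn_integral_insert[OF insert.hyps]) measurable
  also have "\<dots> \<le> (\<integral>\<^sup>+ x. ennreal ((\<Sum>p\<in>J. a p * x p)\<^sup>2) + ennreal ((a l)\<^sup>2 * v l) \<partial>PiM J M)"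
  proof (intro nn_integral_mono)
    fix x
    have "(\<Sum>p\<in>insert l J. a p * (x(l := y)) p) = (\<Sum>p\<in>J. a p * x p) + a l * y + 0 * y\<^sup>2" for y
    proof -
      have "(\<Sum>p\<in>J. a p * (if p = l then y else x p)) = (\<Sum>p\<in>J. a p * x p)"
        using insert.hyps by (intro sum.cong) auto
      then show ?thesis using insert.hyps by simp
    qed
    then show "(\<integral>\<^sup>+ y. ennreal ((\<Sum>p\<in>insert l J. a p * (x(l := y)) p)\<^sup>2) \<partial>M l)
        \<le> ennreal ((\<Sum>p\<in>J. a p * x p)\<^sup>2) + ennreal ((a l)\<^sup>2 * v l)"
      using gauss_like_square_le[OF gl[of l], of "\<Sum>p\<in>J. a p * x p" "a l" 0] v0[of l]
      by (simp add: ennreal_plus[symmetric] del: ennreal_plus)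
  qed
  also have "\<dots> = (\<integral>\<^sup>+ x. ennreal ((\<Sum>p\<in>J. a p * x p)\<^sup>2) \<partial>PiM J M) + ennreal ((a l)\<^sup>2 * v l)"
    by (subst nn_integral_add) (auto simp: emeasure_space_1)
  also have "\<dots> \<le> ennreal (\<Sum>p\<in>J. (a p)\<^sup>2 * v p) + ennreal ((a l)\<^sup>2 * v l)"
    by (intro add_mono insert.IH) auto
  also have "\<dots> = ennreal (\<Sum>p\<in>insert l J. (a p)\<^sup>2 * v p)"
    using insert.hyps v0 by (subst ennreal_plus[symmetric]) (auto intro!: sum_nonneg mult_nonneg_nonneg simp: add.commute)
  finally show ?case .
qed

text \<open>Variables are integrated out one at a time. A new variable y turns the centred form Q
  into (Q - a v) + 2 L y + a y^2 with L linear in the old variables. The vanishing odd moments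
  remove the mixed terms, and E y^4 <= 3 v^2 yields the Gaussian value of the variance as an upper
  bound.\<close>

lemma quadratic_form_second_moment:
  fixes A :: "'i \<Rightarrow> 'i \<Rightarrow> real"
  assumes "finite J" and sym: "\<And>p r. A p r = A r p"
  shows "(\<integral>\<^sup>+ x. ennreal (((\<Sum>p\<in>J. \<Sum>r\<in>J. A p r * x p * x r) - (\<Sum>p\<in>J. A p p * v p))\<^sup>2) \<partial>PiM J M)
     \<le> ennreal (2 * (\<Sum>p\<in>J. \<Sum>r\<in>J. v p * v r * (A p r)\<^sup>2))"
  using assms(1)
proof (induction J rule: finite_induct)
  case empty
  then show ?case by simp
next
  case (insert l J)
  interpret product_prob_space M J by (rule product_prob_spaceI) (rule ps_M)
  note [measurable] = component_measurable
  have v0: "v p \<ge> 0" for p by (rule gauss_like_nonneg[OF gl])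
  define Q where "Q x = (\<Sum>p\<in>J. \<Sum>r\<in>J. A p r * x p * x r) - (\<Sum>p\<in>J. A p p * v p)" for x
  define L where "L x = (\<Sum>p\<in>J. A l p * x p)" for x
  let ?Q = "\<lambda>x. (\<Sum>p\<in>insert l J. \<Sum>r\<in>insert l J. A p r * x p * x r) - (\<Sum>p\<in>insert l J. A p p * v p)"
  have [measurable]: "Q \<in> borel_measurable (PiM J M)" "L \<in> borel_measurable (PiM J M)"
    unfolding Q_def L_def by measurable
  have "(\<integral>\<^sup>+ x. ennreal ((?Q x)\<^sup>2) \<partial>PiM (insert l J) M)
     = (\<integral>\<^sup>+ x. \<integral>\<^sup>+ y. ennreal ((?Q (x(l := y)))\<^sup>2) \<partial>M l \<partial>PiM J M)"
    by (rule product_nn_integral_insert[OF insert.hyps]) measurable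
  also have "\<dots> \<le> (\<integral>\<^sup>+ x. ennreal ((Q x)\<^sup>2) + ennreal (4 * v l) * ennreal ((L x)\<^sup>2) + ennreal (2 * (A l l)\<^sup>2 * (v l)\<^sup>2) \<partial>PiM J M)"
  proof (intro nn_integral_mono)
    fix x
    have eq: "?Q (x(l := y)) = (Q x - A l l * v l) + (2 * L x) * y + A l l * y\<^sup>2" for y
    proof -
      have ne: "p \<noteq> l" if "p \<in> J" for p using insert.hyps that by auto
      have "(\<Sum>p\<in>insert l J. \<Sum>r\<in>insert l J. A p r * (x(l := y)) p * (x(l := y)) r)
         = A l l * y * y + (\<Sum>r\<in>J. A l r * y * x r) + (\<Sum>p\<in>J. A p l * x p * y) + (\<Sum>p\<in>J. \<Sum>r\<in>J. A p r * x p * x r)"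
        unfolding sum_insert_square[OF insert.hyps]
        by (intro arg_cong2[of _ _ _ _ "(+)"] sum.cong refl) (auto dest: ne)
      moreover have "(\<Sum>r\<in>J. A l r * y * x r) = L x * y"
        unfolding L_def sum_distrib_right by (intro sum.cong refl) simp
      moreover have "(\<Sum>p\<in>J. A p l * x p * y) = L x * y"
        unfolding L_def sum_distrib_right by (intro sum.cong refl) (subst sym, simp)
      moreover have "(\<Sum>p\<in>insert l J. A p p * v p) = A l l * v l + (\<Sum>p\<in>J. A p p * v p)"
        using insert.hyps by simp
      ultimately show ?thesis unfolding Q_def by (simp add: power2_eq_square)
    qed
    have "(\<integral>\<^sup>+ y. ennreal ((?Q (x(l := y)))\<^sup>2) \<partial>M l)
       \<le> ennreal ((Q x - A l l * v l)\<^sup>2 + ((2 * L x)\<^sup>2 + 2 * (Q x - A l l * v l) * A l l) * v l + 3 * (A l l)\<^sup>2 * (v l)\<^sup>2)"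
      unfolding eq by (rule gauss_like_square_le[OF gl])
    also have "(Q x - A l l * v l)\<^sup>2 + ((2 * L x)\<^sup>2 + 2 * (Q x - A l l * v l) * A l l) * v l + 3 * (A l l)\<^sup>2 * (v l)\<^sup>2
       = (Q x)\<^sup>2 + 4 * v l * (L x)\<^sup>2 + 2 * (A l l)\<^sup>2 * (v l)\<^sup>2"
      by (simp add: power2_eq_square algebra_simps)
    finally show "(\<integral>\<^sup>+ y. ennreal ((?Q (x(l := y)))\<^sup>2) \<partial>M l)
       \<le> ennreal ((Q x)\<^sup>2) + ennreal (4 * v l) * ennreal ((L x)\<^sup>2) + ennreal (2 * (A l l)\<^sup>2 * (v l)\<^sup>2)"
      using v0[of l] by (simp add: ennreal_mult'[symmetric] ennreal_plus[symmetric] del: ennreal_plus)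
  qed
  also have "\<dots> = (\<integral>\<^sup>+ x. ennreal ((Q x)\<^sup>2) \<partial>PiM J M) + ennreal (4 * v l) * (\<integral>\<^sup>+ x. ennreal ((L x)\<^sup>2) \<partial>PiM J M)
       + ennreal (2 * (A l l)\<^sup>2 * (v l)\<^sup>2)"
    by (simp add: nn_integral_add nn_integral_cmult emeasure_space_1)
  also have "\<dots> \<le> ennreal (2 * (\<Sum>p\<in>J. \<Sum>r\<in>J. v p * v r * (A p r)\<^sup>2)) + ennreal (4 * v l) * ennreal (\<Sum>p\<in>J. (A l p)\<^sup>2 * v p)
       + ennreal (2 * (A l l)\<^sup>2 * (v l)\<^sup>2)"
    unfolding L_def Q_def
    by (intro add_mono mult_left_mono insert.IH linear_form_second_moment insert.hyps) auto
  also have "\<dots> = ennreal (2 * (\<Sum>p\<in>J. \<Sum>r\<in>J. v p * v r * (A p r)\<^sup>2) + 4 * v l * (\<Sum>p\<in>J. (A l p)\<^sup>2 * v p) + 2 * (A l l)\<^sup>2 * (v l)\<^sup>2)"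
    using v0 by (simp add: ennreal_mult'[symmetric] ennreal_plus[symmetric] sum_nonneg del: ennreal_plus)
  also have "2 * (\<Sum>p\<in>J. \<Sum>r\<in>J. v p * v r * (A p r)\<^sup>2) + 4 * v l * (\<Sum>p\<in>J. (A l p)\<^sup>2 * v p) + 2 * (A l l)\<^sup>2 * (v l)\<^sup>2
     = 2 * (\<Sum>p\<in>insert l J. \<Sum>r\<in>insert l J. v p * v r * (A p r)\<^sup>2)"
  proof -
    have "(\<Sum>p\<in>J. v p * v l * (A p l)\<^sup>2) = v l * (\<Sum>p\<in>J. (A l p)\<^sup>2 * v p)"
      unfolding sum_distrib_left by (intro sum.cong refl) (subst sym, simp)
    moreover have "(\<Sum>r\<in>J. v l * v r * (A l r)\<^sup>2) = v l * (\<Sum>p\<in>J. (A l p)\<^sup>2 * v p)"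
      unfolding sum_distrib_left by (intro sum.cong refl) simp
    ultimately show ?thesis
      unfolding sum_insert_square[OF insert.hyps] by (simp add: power2_eq_square)
  qed
  finally show ?case .
qed

end

subsection \<open>The self-consistent equation\<close>

text \<open>At z = i q the Stieltjes transform of the semicircle law is i times this number, the
  positive solution of a^2 s^2 + q s = 1 with a the scale.\<close>

definition sc_stieltjes :: "real \<Rightarrow> real \<Rightarrow> real" where
  "sc_stieltjes \<alpha> q = (sqrt (q\<^sup>2 + 4 * \<alpha>\<^sup>2) - q) / (2 * \<alpha>\<^sup>2)"

definition res_dev :: "nat \<Rightarrow> (nat \<times> nat \<Rightarrow> real) \<Rightarrow> real \<Rightarrow> real \<Rightarrow> real" where
  "res_dev n g \<alpha> q =
     (\<Sum>i<n. cmod (res n (sym_mat g) (Complex 0 q) i i - Complex 0 (sc_stieltjes \<alpha> q))) / real n"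

definition row_sum :: "nat \<Rightarrow> (nat \<times> nat \<Rightarrow> real) \<Rightarrow> nat \<Rightarrow> real" where
  "row_sum n s i = (\<Sum>j\<in>{..<n}-{i}. sym_mat s i j)"

text \<open>The quadratic form of the Schur complement minus its conditional mean given the matrix
  with row \<open>i\<close> removed, where \<open>s\<close> is the variance profile of the
  entries.\<close>

definition qf_dev :: "nat \<Rightarrow> (nat \<times> nat \<Rightarrow> real) \<Rightarrow> real \<Rightarrow> (nat \<times> nat \<Rightarrow> real) \<Rightarrow> nat \<Rightarrow> complex" where
  "qf_dev n s q g i =
     (\<Sum>b\<in>{..<n}-{i}. \<Sum>c\<in>{..<n}-{i}. of_real (sym_mat g i b) * of_real (sym_mat g i c)
         * res n (sym_mat (zero_row i g)) (Complex 0 q) b c)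
     - (\<Sum>b\<in>{..<n}-{i}. of_real (sym_mat s i b) * res n (sym_mat (zero_row i g)) (Complex 0 q) b b)"

lemma sc_stieltjes_eq:
  assumes "\<alpha> > 0"
  shows "\<alpha>\<^sup>2 * (sc_stieltjes \<alpha> q)\<^sup>2 + q * sc_stieltjes \<alpha> q = 1"
proof -
  define r where "r = sqrt (q\<^sup>2 + 4 * \<alpha>\<^sup>2)"
  have r: "r\<^sup>2 = q\<^sup>2 + 4 * \<alpha>\<^sup>2" by (simp add: r_def)
  have "\<alpha>\<^sup>2 * ((r - q) / (2 * \<alpha>\<^sup>2))\<^sup>2 + q * ((r - q) / (2 * \<alpha>\<^sup>2)) = (r\<^sup>2 - q\<^sup>2) / (4 * \<alpha>\<^sup>2)"
    using assms by (simp add: field_simps power2_eq_square)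
  also have "\<dots> = 1" using assms by (simp add: r)
  finally show ?thesis by (simp add: sc_stieltjes_def r_def)
qed

lemma sc_stieltjes_bounds:
  assumes "\<alpha> > 0" "q > 0"
  shows "sc_stieltjes \<alpha> q \<ge> 0" "sc_stieltjes \<alpha> q \<le> 1 / q"
proof -
  have "q \<le> sqrt (q\<^sup>2 + 4 * \<alpha>\<^sup>2)" using assms by (intro real_le_rsqrt) simp
  then show "sc_stieltjes \<alpha> q \<ge> 0" by (simp add: sc_stieltjes_def)
  have "q * sc_stieltjes \<alpha> q \<le> 1"
  proof -
    have "0 \<le> \<alpha>\<^sup>2 * (sc_stieltjes \<alpha> q)\<^sup>2" by simp
    then show ?thesis using sc_stieltjes_eq[OF assms(1), of q] by linarith
  qed
  then show "sc_stieltjes \<alpha> q \<le> 1 / q" using assms by (simp add: field_simps)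
qed

text \<open>A deterministic stability estimate. The equation for \<open>m\<close> and the Schur
  formula combine to R_ii - m = R_ii m (Q - a^2 m - g_ii), where |R_ii m| <= 1/4. After averaging
  over \<open>i\<close>, Q - a^2 m reproduces the deviation itself with a factor at most 1, up to
  errors, and the factor 1/4 lets it be absorbed.\<close>

lemma res_dev_le:
  assumes n: "n > 0" and q: "q \<ge> 2" and \<alpha>: "0 < \<alpha>" "\<alpha> \<le> 1"
    and s0: "\<And>i j. i < n \<Longrightarrow> j < n \<Longrightarrow> i \<noteq> j \<Longrightarrow> sym_mat s i j \<ge> 0"
    and sd: "\<And>i j. i < n \<Longrightarrow> j < n \<Longrightarrow> i \<noteq> j \<Longrightarrow> sym_mat s i j \<le> \<delta>" and d0: "\<delta> \<ge> 0"
  shows "res_dev n g \<alpha> q \<le> (\<Sum>i<n. \<bar>g (i, i)\<bar> + cmod (qf_dev n s q g i)) / real n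
     + \<delta> + (\<Sum>i<n. \<bar>row_sum n s i - \<alpha>\<^sup>2\<bar>) / real n"
proof -
  define z where "z = Complex 0 q"
  define m where "m = Complex 0 (sc_stieltjes \<alpha> q)"
  let ?R = "res n (sym_mat g) z"
  have z: "Im z = q" "q > 0" using q by (auto simp: z_def)
  have m1: "cmod m \<le> 1/2"
  proof -
    have "cmod m \<le> 1 / q" using sc_stieltjes_bounds[OF \<alpha>(1) z(2)] by (simp add: m_def cmod_def)
    also have "\<dots> \<le> 1/2" using q by (simp add: field_simps)
    finally show ?thesis .
  qed
  have meq: "m * (- z - of_real (\<alpha>\<^sup>2) * m) = 1"
    using sc_stieltjes_eq[OF \<alpha>(1), of q] by (simp add: m_def z_def complex_eq_iff power2_eq_square algebra_simps)
  have R1: "cmod (?R i j) \<le> 1/2" if "i < n" "j < n" for i j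
  proof -
    have "cmod (?R i j) \<le> 1 / q" by (rule norm_res_le[OF z that])
    also have "\<dots> \<le> 1/2" using q by (simp add: field_simps)
    finally show ?thesis .
  qed
  define e where "e b = cmod (?R b b - m)" for b
  have e1: "e b \<le> 1" if "b < n" for b
    unfolding e_def using norm_triangle_ineq4[of "?R b b" m] R1[OF that that] m1 by simp
  have e0: "e b \<ge> 0" for b by (simp add: e_def)
  let ?\<rho> = "row_sum n s"
  have row: "e i \<le> (\<bar>g (i, i)\<bar> + cmod (qf_dev n s q g i) + \<delta> / 2
      + (\<Sum>b\<in>{..<n}-{i}. sym_mat s i b * e b) + \<bar>?\<rho> i - \<alpha>\<^sup>2\<bar> / 2) / 4" if i: "i < n" for i
  proof -
    let ?S = "res n (sym_mat (zero_row i g)) z"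
    define Q where "Q = (\<Sum>b\<in>{..<n}-{i}. \<Sum>c\<in>{..<n}-{i}. of_real (sym_mat g i b) * of_real (sym_mat g i c) * ?S b c)"
    have h: "sym_mat g i i = g (i, i)" by (simp add: sym_mat_def)
    have sch: "?R i i * (of_real (g (i, i)) - z - Q) = 1"
      using res_schur[OF z i, of g] by (simp add: Q_def h)
    have "?R i i - m = ?R i i * (m * (- z - of_real (\<alpha>\<^sup>2) * m)) - m * (?R i i * (of_real (g (i, i)) - z - Q))"
      by (simp only: sch meq mult_1_right)
    also have "\<dots> = ?R i i * m * ((Q - of_real (\<alpha>\<^sup>2) * m) - of_real (g (i, i)))"
      by (simp add: algebra_simps)
    finally have "e i = cmod (?R i i) * cmod m * cmod ((Q - of_real (\<alpha>\<^sup>2) * m) - of_real (g (i, i)))"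
      by (simp add: e_def norm_mult)
    also have "\<dots> \<le> 1/2 * (1/2) * (cmod (Q - of_real (\<alpha>\<^sup>2) * m) + \<bar>g (i, i)\<bar>)"
      using R1[OF i i] m1 norm_triangle_ineq4[of "Q - of_real (\<alpha>\<^sup>2) * m" "of_real (g (i, i))"]
      by (intro mult_mono) auto
    also have "cmod (Q - of_real (\<alpha>\<^sup>2) * m) \<le> cmod (qf_dev n s q g i) + \<delta> / 2
       + (\<Sum>b\<in>{..<n}-{i}. sym_mat s i b * e b) + \<bar>?\<rho> i - \<alpha>\<^sup>2\<bar> / 2"
    proof -
      let ?U = "{..<n}-{i}"
      \<comment> \<open>Four sources of error: fluctuation of the quadratic form, minor versus full
        resolvent, deviation of the diagonal entries from \<open>m\<close>, and deviation of the row
        sum of the profile.\<close>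
      have "Q - of_real (\<alpha>\<^sup>2) * m = qf_dev n s q g i + (\<Sum>b\<in>?U. of_real (sym_mat s i b) * (?S b b - ?R b b))
          + (\<Sum>b\<in>?U. of_real (sym_mat s i b) * (?R b b - m)) + of_real (?\<rho> i - \<alpha>\<^sup>2) * m"
        by (simp add: qf_dev_def Q_def z_def[symmetric] row_sum_def right_diff_distrib left_diff_distrib
            sum_subtractf sum_distrib_right)
      then have "cmod (Q - of_real (\<alpha>\<^sup>2) * m) \<le> cmod (qf_dev n s q g i)
          + cmod (\<Sum>b\<in>?U. of_real (sym_mat s i b) * (?S b b - ?R b b))
          + cmod (\<Sum>b\<in>?U. of_real (sym_mat s i b) * (?R b b - m)) + cmod (of_real (?\<rho> i - \<alpha>\<^sup>2) * m)"
        by (simp only:) (intro norm_triangle_mono order_refl)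
      moreover have "cmod (\<Sum>b\<in>?U. of_real (sym_mat s i b) * (?S b b - ?R b b)) \<le> \<delta> / 2"
      proof -
        have "cmod (\<Sum>b\<in>?U. of_real (sym_mat s i b) * (?S b b - ?R b b)) \<le> (\<Sum>b\<in>?U. \<delta> * cmod (?R b b - ?S b b))"
          using s0 sd i by (intro sum_norm_le) (auto simp: norm_mult norm_minus_commute intro!: mult_right_mono)
        also have "\<dots> = \<delta> * (\<Sum>b\<in>?U. cmod (?R b b - ?S b b))" by (simp add: sum_distrib_left)
        also have "\<dots> \<le> \<delta> * (1 / q)" by (intro mult_left_mono sum_res_minor_diag_le[OF z i] d0)
        also have "\<dots> \<le> \<delta> * (1 / 2)" using q d0 by (intro mult_left_mono) (auto simp: field_simps)
        finally show ?thesis by simp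
      qed
      moreover have "cmod (\<Sum>b\<in>?U. of_real (sym_mat s i b) * (?R b b - m)) \<le> (\<Sum>b\<in>?U. sym_mat s i b * e b)"
        using s0 i by (intro sum_norm_le) (auto simp: norm_mult e_def)
      moreover have "cmod (of_real (?\<rho> i - \<alpha>\<^sup>2) * m) \<le> \<bar>?\<rho> i - \<alpha>\<^sup>2\<bar> / 2"
        using mult_left_mono[OF m1, of "\<bar>?\<rho> i - \<alpha>\<^sup>2\<bar>"] by (simp add: norm_mult del: of_real_diff)
      ultimately show ?thesis by linarith
    qed
    finally show ?thesis by simp
  qed
  \<comment> \<open>Symmetry of the profile turns its column sums into row sums, so the averaged
    error reproduces itself up to the row-sum defect.\<close>
  have swap: "(\<Sum>i<n. \<Sum>b\<in>{..<n}-{i}. sym_mat s i b * e b) \<le> (\<Sum>b<n. e b) + (\<Sum>b<n. \<bar>?\<rho> b - \<alpha>\<^sup>2\<bar>)"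
  proof -
    have "(\<Sum>i<n. \<Sum>b\<in>{..<n}-{i}. sym_mat s i b * e b) = (\<Sum>b<n. \<Sum>i\<in>{..<n}-{b}. sym_mat s i b * e b)"
    proof -
      have f: "(\<Sum>b\<in>{..<n}-{i}. h b) = (\<Sum>b<n. if b = i then 0 else h b)" for h :: "nat \<Rightarrow> real" and i
        by (intro sum.mono_neutral_cong_left) auto
      show ?thesis unfolding f by (subst sum.swap) (intro sum.cong refl, auto)
    qed
    also have "\<dots> = (\<Sum>b<n. ?\<rho> b * e b)"
      by (intro sum.cong refl) (simp add: row_sum_def sum_distrib_right sym_mat_commute[of s])
    also have "\<dots> \<le> (\<Sum>b<n. e b + \<bar>?\<rho> b - \<alpha>\<^sup>2\<bar>)"
    proof (intro sum_mono)
      fix b assume "b \<in> {..<n}"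
      then have b: "e b \<le> 1" using e1 by simp
      have "\<alpha>\<^sup>2 \<le> 1" using \<alpha> by (simp add: power_le_one)
      have "?\<rho> b * e b = \<alpha>\<^sup>2 * e b + (?\<rho> b - \<alpha>\<^sup>2) * e b" by (simp add: algebra_simps)
      also have "\<dots> \<le> 1 * e b + \<bar>?\<rho> b - \<alpha>\<^sup>2\<bar> * 1"
        using b e0[of b] \<open>\<alpha>\<^sup>2 \<le> 1\<close> by (intro add_mono mult_right_mono order.trans[OF mult_right_mono mult_left_mono]) auto
      finally show "?\<rho> b * e b \<le> e b + \<bar>?\<rho> b - \<alpha>\<^sup>2\<bar>" by simp
    qed
    finally show ?thesis by (simp add: sum.distrib)
  qed
  have "(\<Sum>i<n. e i) \<le> (\<Sum>i<n. (\<bar>g (i, i)\<bar> + cmod (qf_dev n s q g i) + \<delta> / 2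
      + (\<Sum>b\<in>{..<n}-{i}. sym_mat s i b * e b) + \<bar>?\<rho> i - \<alpha>\<^sup>2\<bar> / 2) / 4)"
    by (intro sum_mono row) auto
  also have "\<dots> = ((\<Sum>i<n. \<bar>g (i, i)\<bar> + cmod (qf_dev n s q g i)) + real n * \<delta> / 2
     + (\<Sum>i<n. \<Sum>b\<in>{..<n}-{i}. sym_mat s i b * e b) + (\<Sum>i<n. \<bar>?\<rho> i - \<alpha>\<^sup>2\<bar>) / 2) / 4"
    by (simp add: sum_divide_distrib[symmetric] sum.distrib)
  finally have le: "(\<Sum>i<n. e i) \<le> \<dots>" .
  \<comment> \<open>The deviation D occurs on the right with coefficient 1/4 and is moved to the
    left.\<close>
  have arith: "D \<le> A + N + P" if "0 \<le> A" "0 \<le> N" "0 \<le> P" "D \<le> (A + N / 2 + S + P / 2) / 4" "S \<le> D + P"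
    for A N P D S :: real
    using that by (simp add: field_simps)
  have main: "(\<Sum>i<n. e i) \<le> (\<Sum>i<n. \<bar>g (i, i)\<bar> + cmod (qf_dev n s q g i)) + real n * \<delta> + (\<Sum>i<n. \<bar>?\<rho> i - \<alpha>\<^sup>2\<bar>)"
    by (rule arith[OF _ _ _ le swap]) (use d0 in \<open>auto intro!: sum_nonneg\<close>)
  have "res_dev n g \<alpha> q = (\<Sum>i<n. e i) / real n"
    by (simp add: res_dev_def e_def z_def m_def)
  also have "\<dots> \<le> ((\<Sum>i<n. \<bar>g (i, i)\<bar> + cmod (qf_dev n s q g i)) + real n * \<delta> + (\<Sum>i<n. \<bar>?\<rho> i - \<alpha>\<^sup>2\<bar>)) / real n"
    by (intro divide_right_mono main) auto
  finally show ?thesis using n by (simp add: add_divide_distrib)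
qed

subsection \<open>Expectation\<close>

definition upper_idx :: "nat \<Rightarrow> (nat \<times> nat) set" where
  "upper_idx n = {(i, j). i \<le> j \<and> j < n}"

text \<open>Only the upper triangle carries random variables. \<open>row_idx i b\<close> is the
  coordinate that holds entry (i, b), and \<open>other_idx i\<close> recovers \<open>b\<close> from
  it.\<close>

definition row_idx :: "nat \<Rightarrow> nat \<Rightarrow> nat \<times> nat" where
  "row_idx i b = (min i b, max i b)"

definition other_idx :: "nat \<Rightarrow> nat \<times> nat \<Rightarrow> nat" where
  "other_idx i p = (if fst p = i then snd p else fst p)"

lemma finite_upper_idx [simp]: "finite (upper_idx n)"
  by (rule finite_subset[of _ "{..<n} \<times> {..<n}"]) (auto simp: upper_idx_def)

lemma sym_mat_row_idx: "sym_mat g i b = g (row_idx i b)"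
  by (auto simp: sym_mat_def row_idx_def min_def max_def)

lemma other_row_idx [simp]: "other_idx i (row_idx i b) = b"
  by (auto simp: other_idx_def row_idx_def min_def max_def)

lemma bij_betw_row_idx:
  assumes "i < n"
  shows "bij_betw (row_idx i) {..<n} {p\<in>upper_idx n. fst p = i \<or> snd p = i}"
  by (rule bij_betw_byWitness[of _ "other_idx i"])
     (use assms in \<open>auto simp: row_idx_def upper_idx_def other_idx_def min_def max_def split: if_splits\<close>)

lemma sum_row_idx:
  assumes "i < n"
  shows "(\<Sum>p\<in>{p\<in>upper_idx n. fst p = i \<or> snd p = i}. f p) = (\<Sum>b<n. f (row_idx i b))"
  by (rule sum.reindex_bij_betw[OF bij_betw_row_idx[OF assms], symmetric])

text \<open>Conditioning on everything outside row and column \<open>i\<close>. Under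
  \<open>merge\<close>, the resolvent of the zeroed matrix depends only on the fixed part
  (\<open>res_zero_row_merge\<close>) and row \<open>i\<close> only on the integrated part
  (\<open>row_merge\<close>); this is how independence enters.\<close>

lemma nn_integral_upper_idx_le:
  assumes ps: "\<And>p. prob_space (M p)" and f: "f \<in> borel_measurable (PiM (upper_idx n) M)" and i: "i < n"
    and le: "\<And>x. x \<in> space (PiM {p\<in>upper_idx n. \<not> (fst p = i \<or> snd p = i)} M) \<Longrightarrow>
       (\<integral>\<^sup>+ y. f (merge {p\<in>upper_idx n. \<not> (fst p = i \<or> snd p = i)} {p\<in>upper_idx n. fst p = i \<or> snd p = i} (x, y))
          \<partial>PiM {p\<in>upper_idx n. fst p = i \<or> snd p = i} M) \<le> C"
  shows "(\<integral>\<^sup>+ x. f x \<partial>PiM (upper_idx n) M) \<le> C"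
proof -
  have U: "{p\<in>upper_idx n. \<not> (fst p = i \<or> snd p = i)} \<union> {p\<in>upper_idx n. fst p = i \<or> snd p = i} = upper_idx n"
    by auto
  show ?thesis
    using nn_integral_PiM_Un_le[where M = M and f = f and C = C
        and I = "{p\<in>upper_idx n. \<not> (fst p = i \<or> snd p = i)}" and J = "{p\<in>upper_idx n. fst p = i \<or> snd p = i}"] ps f le
    unfolding U by auto
qed

lemma res_zero_row_merge:
  fixes x y :: "nat \<times> nat \<Rightarrow> real"
  shows "res n (sym_mat (zero_row i (\<lambda>p. merge {p\<in>upper_idx n. \<not> (fst p = i \<or> snd p = i)}
        {p\<in>upper_idx n. fst p = i \<or> snd p = i} (x, y) p / c)))
    = res n (sym_mat (zero_row i (\<lambda>p. x p / c)))"
  by (rule res_cong) (auto simp: sym_mat_def zero_row_def merge_def upper_idx_def)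

lemma row_merge:
  fixes x y :: "nat \<times> nat \<Rightarrow> real"
  assumes "i < n" "b < n"
  shows "merge {p\<in>upper_idx n. \<not> (fst p = i \<or> snd p = i)}
        {p\<in>upper_idx n. fst p = i \<or> snd p = i} (x, y) (row_idx i b) = y (row_idx i b)"
  using assms by (auto simp: merge_def upper_idx_def row_idx_def min_def max_def)

context
  fixes M :: "nat \<times> nat \<Rightarrow> real measure" and v :: "nat \<times> nat \<Rightarrow> real" and n :: nat
  assumes gl: "\<And>p. gauss_like (M p) (v p)" and n: "n > 0"
begin

private lemma ps: "prob_space (M p)"
  using gl[of p] by (simp add: gauss_like_def)

private lemma v0: "v p \<ge> 0"
  by (rule gauss_like_nonneg[OF gl])

lemmas entry_measurable = component_measurable[of M v, OF gl, of _ "upper_idx n"]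

lemma measurable_res_entries:
  assumes "q > 0" "i < n" "j < n"
  shows "(\<lambda>x. res n (sym_mat (\<lambda>p. x p / c)) (Complex 0 q) i j) \<in> borel_measurable (PiM (upper_idx n) M)"
    and "(\<lambda>x. res n (sym_mat (zero_row k (\<lambda>p. x p / c))) (Complex 0 q) i j) \<in> borel_measurable (PiM (upper_idx n) M)"
proof -
  have e: "(\<lambda>x. x (a, b)) \<in> borel_measurable (PiM (upper_idx n) M)" if "a \<le> b" "b < n" for a b
    by (rule entry_measurable) (use that in \<open>auto simp: upper_idx_def\<close>)
  show "(\<lambda>x. res n (sym_mat (\<lambda>p. x p / c)) (Complex 0 q) i j) \<in> borel_measurable (PiM (upper_idx n) M)"
    by (rule measurable_res) (use assms e in auto)
  show "(\<lambda>x. res n (sym_mat (zero_row k (\<lambda>p. x p / c))) (Complex 0 q) i j) \<in> borel_measurable (PiM (upper_idx n) M)"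
  proof (rule measurable_res)
    fix a b assume "a \<le> b" "b < n"
    then show "(\<lambda>x. zero_row k (\<lambda>p. x p / c) (a, b)) \<in> borel_measurable (PiM (upper_idx n) M)"
      using e[of a b] by (cases "a = k \<or> b = k") (auto simp: zero_row_def)
  qed (use assms in auto)
qed

lemma measurable_res_dev:
  assumes "q > 0"
  shows "(\<lambda>x. res_dev n (\<lambda>p. x p / c) \<alpha> q) \<in> borel_measurable (PiM (upper_idx n) M)"
  unfolding res_dev_def using measurable_res_entries(1)[OF assms]
  by (intro borel_measurable_divide borel_measurable_sum borel_measurable_norm borel_measurable_diff) auto

lemma measurable_sym_mat_entry:
  assumes "i < n" "b < n"
  shows "(\<lambda>x. sym_mat (\<lambda>p. x p / c) i b) \<in> borel_measurable (PiM (upper_idx n) M)"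
  unfolding sym_mat_row_idx
  by (intro borel_measurable_divide entry_measurable) (use assms in \<open>auto simp: row_idx_def upper_idx_def\<close>)

lemma measurable_qf_dev:
  assumes "q > 0" "i < n"
  shows "(\<lambda>x. qf_dev n s q (\<lambda>p. x p / c) i) \<in> borel_measurable (PiM (upper_idx n) M)"
  unfolding qf_dev_def
  by (intro borel_measurable_diff borel_measurable_sum borel_measurable_times measurable_res_entries(2)
      measurable_compose[OF _ borel_measurable_of_real] measurable_sym_mat_entry)
     (use assms in auto)

text \<open>Given the other rows, real and imaginary part are centred quadratic forms in row
  \<open>i\<close>. Together their second moments are at most 2 sum v_b v_c |S_bc|^2 / n^2. One
  factor v_c / n is bounded by \<open>\<delta>\<close>, and Ward's identity bounds the remaining sum
  over c by 1 / q^2 <= 1/4.\<close>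

lemma qf_dev_second_moment:
  assumes q: "q \<ge> 2" and i: "i < n" and d: "\<And>p. p \<in> upper_idx n \<Longrightarrow> v p / n \<le> \<delta>"
  shows "(\<integral>\<^sup>+ x. ennreal ((cmod (qf_dev n (\<lambda>p. v p / n) q (\<lambda>p. x p / sqrt n) i))\<^sup>2) \<partial>PiM (upper_idx n) M)
     \<le> ennreal (\<delta> * row_sum n (\<lambda>p. v p / n) i / 2)"
proof (rule nn_integral_upper_idx_le[OF ps _ i])
  show "(\<lambda>x. ennreal ((cmod (qf_dev n (\<lambda>p. v p / n) q (\<lambda>p. x p / sqrt n) i))\<^sup>2)) \<in> borel_measurable (PiM (upper_idx n) M)"
  proof -
    have [measurable]: "(\<lambda>x. qf_dev n (\<lambda>p. v p / n) q (\<lambda>p. x p / sqrt n) i) \<in> borel_measurable (PiM (upper_idx n) M)"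
      by (rule measurable_qf_dev) (use q i in auto)
    show ?thesis by measurable
  qed
next
  fix x
  let ?O = "{p\<in>upper_idx n. \<not> (fst p = i \<or> snd p = i)}" and ?J = "{p\<in>upper_idx n. fst p = i \<or> snd p = i}"
  let ?U = "{..<n}-{i}"
  let ?z = "Complex 0 q"
  define S where "S = res n (sym_mat (zero_row i (\<lambda>p. x p / sqrt n))) ?z"
  have q0: "Im ?z = q" "q > 0" using q by auto
  have Ssym: "S b c = S c b" for b c unfolding S_def by (rule res_commute[OF q0])
  \<comment> \<open>The kernel of the form, re-indexed by the coordinates of row \<open>i\<close>
    and set to 0 at the diagonal coordinate, which the Schur complement excludes.\<close>
  define B where "B f p r = (if other_idx i p = i \<or> other_idx i r = i then 0 else f (S (other_idx i p) (other_idx i r)) / n)"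
    for f :: "complex \<Rightarrow> real" and p r
  have Bsym: "B f p r = B f r p" for f p r by (auto simp: B_def Ssym)
  have fin: "finite ?J" by simp
  have sumU: "(\<Sum>b<n. if b = i then 0 else h b) = (\<Sum>b\<in>?U. h b)" for h :: "nat \<Rightarrow> real"
    by (intro sum.mono_neutral_cong_right) auto
  have sn: "sqrt (real n) * sqrt (real n) = real n" by simp
  define D where "D f y = (\<Sum>p\<in>?J. \<Sum>r\<in>?J. B f p r * y p * y r) - (\<Sum>p\<in>?J. B f p p * v p)" for f and y :: "nat \<times> nat \<Rightarrow> real"
  have D_eq: "D f y = (\<Sum>b\<in>?U. \<Sum>c\<in>?U. y (row_idx i b) * y (row_idx i c) / n * f (S b c)) - (\<Sum>b\<in>?U. v (row_idx i b) / n * f (S b b))"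
    for f and y :: "nat \<times> nat \<Rightarrow> real"
  proof -
    have "D f y = (\<Sum>b<n. if b = i then 0 else (\<Sum>c<n. if c = i then 0 else y (row_idx i b) * y (row_idx i c) / n * f (S b c)))
        - (\<Sum>b<n. if b = i then 0 else v (row_idx i b) / n * f (S b b))"
      unfolding D_def sum_row_idx[OF i]
      by (intro arg_cong2[of _ _ _ _ "(-)"] sum.cong refl) (auto simp: B_def intro!: sum.cong)
    then show ?thesis unfolding sumU by simp
  qed
  have qf: "qf_dev n (\<lambda>p. v p / n) q (\<lambda>p. merge ?O ?J (x, y) p / sqrt n) i = Complex (D Re y) (D Im y)" for y
  proof -
    have m: "sym_mat (\<lambda>p. merge ?O ?J (x, y) p / sqrt n) i b = y (row_idx i b) / sqrt n" if "b < n" for b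
      unfolding sym_mat_row_idx row_merge[OF i that] ..
    have "qf_dev n (\<lambda>p. v p / n) q (\<lambda>p. merge ?O ?J (x, y) p / sqrt n) i
       = (\<Sum>b\<in>?U. \<Sum>c\<in>?U. of_real (y (row_idx i b) * y (row_idx i c) / n) * S b c) - (\<Sum>b\<in>?U. of_real (v (row_idx i b) / n) * S b b)"
      unfolding qf_dev_def res_zero_row_merge S_def[symmetric]
    proof (intro arg_cong2[of _ _ _ _ "(-)"] sum.cong refl)
      fix b c assume "b \<in> ?U" "c \<in> ?U"
      then have bc: "b < n" "c < n" by auto
      have "complex_of_real (sym_mat (\<lambda>p. merge ?O ?J (x, y) p / sqrt n) i b) * complex_of_real (sym_mat (\<lambda>p. merge ?O ?J (x, y) p / sqrt n) i c)
         = of_real (y (row_idx i b) * y (row_idx i c) / (sqrt (real n) * sqrt (real n)))"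
        unfolding m[OF bc(1)] m[OF bc(2)] of_real_mult[symmetric] times_divide_times_eq ..
      then show "complex_of_real (sym_mat (\<lambda>p. merge ?O ?J (x, y) p / sqrt n) i b) * complex_of_real (sym_mat (\<lambda>p. merge ?O ?J (x, y) p / sqrt n) i c) * S b c
         = of_real (y (row_idx i b) * y (row_idx i c) / n) * S b c"
        unfolding sn by simp
    qed (simp add: sym_mat_row_idx)
    then show ?thesis unfolding D_eq
      by (simp add: complex_eq_iff Re_sum Im_sum del: of_real_mult of_real_divide)
  qed
  have [measurable]: "(\<lambda>y. D f y) \<in> borel_measurable (PiM ?J M)" for f
    unfolding D_def using component_measurable[of M v, OF gl, of _ ?J] by measurable
  have "(\<integral>\<^sup>+ y. ennreal ((cmod (qf_dev n (\<lambda>p. v p / n) q (\<lambda>p. merge ?O ?J (x, y) p / sqrt n) i))\<^sup>2) \<partial>PiM ?J M)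
      = (\<integral>\<^sup>+ y. ennreal ((D Re y)\<^sup>2) + ennreal ((D Im y)\<^sup>2) \<partial>PiM ?J M)"
    unfolding qf by (simp add: cmod_power2)
  also have "\<dots> = (\<integral>\<^sup>+ y. ennreal ((D Re y)\<^sup>2) \<partial>PiM ?J M) + (\<integral>\<^sup>+ y. ennreal ((D Im y)\<^sup>2) \<partial>PiM ?J M)"
    by (intro nn_integral_add) measurable
  also have "\<dots> \<le> ennreal (2 * (\<Sum>p\<in>?J. \<Sum>r\<in>?J. v p * v r * (B Re p r)\<^sup>2)) + ennreal (2 * (\<Sum>p\<in>?J. \<Sum>r\<in>?J. v p * v r * (B Im p r)\<^sup>2))"
    unfolding D_def by (intro add_mono quadratic_form_second_moment[OF gl fin] Bsym)
  also have "\<dots> = ennreal (2 * ((\<Sum>p\<in>?J. \<Sum>r\<in>?J. v p * v r * (B Re p r)\<^sup>2) + (\<Sum>p\<in>?J. \<Sum>r\<in>?J. v p * v r * (B Im p r)\<^sup>2)))"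
    using v0 by (subst ennreal_plus[symmetric]) (auto intro!: sum_nonneg)
  also have "(\<Sum>p\<in>?J. \<Sum>r\<in>?J. v p * v r * (B Re p r)\<^sup>2) + (\<Sum>p\<in>?J. \<Sum>r\<in>?J. v p * v r * (B Im p r)\<^sup>2)
      = (\<Sum>b\<in>?U. \<Sum>c\<in>?U. v (row_idx i b) / n * (v (row_idx i c) / n) * (cmod (S b c))\<^sup>2)"
  proof -
    have "(\<Sum>p\<in>?J. \<Sum>r\<in>?J. v p * v r * (B Re p r)\<^sup>2) + (\<Sum>p\<in>?J. \<Sum>r\<in>?J. v p * v r * (B Im p r)\<^sup>2)
       = (\<Sum>b<n. \<Sum>c<n. v (row_idx i b) * v (row_idx i c) * ((B Re (row_idx i b) (row_idx i c))\<^sup>2 + (B Im (row_idx i b) (row_idx i c))\<^sup>2))"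
      unfolding sum_row_idx[OF i] by (simp add: sum.distrib distrib_left)
    also have "\<dots> = (\<Sum>b<n. if b = i then 0 else (\<Sum>c<n. if c = i then 0 else v (row_idx i b) / n * (v (row_idx i c) / n) * (cmod (S b c))\<^sup>2))"
      by (intro sum.cong refl)
         (auto simp: B_def cmod_power2 power_divide power2_eq_square[of "real n"] add_divide_distrib[symmetric] intro!: sum.cong)
    finally show ?thesis unfolding sumU .
  qed
  also have "2 * (\<Sum>b\<in>?U. \<Sum>c\<in>?U. v (row_idx i b) / n * (v (row_idx i c) / n) * (cmod (S b c))\<^sup>2) \<le> \<delta> * row_sum n (\<lambda>p. v p / n) i / 2"
  proof -
    have "row_idx i c \<in> upper_idx n" if "c < n" for c
      using that i by (auto simp: row_idx_def upper_idx_def)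
    then have dc: "v (row_idx i c) / n \<le> \<delta>" if "c < n" for c using d that by auto
    have d0: "\<delta> \<ge> 0" using dc[OF i] v0[of "row_idx i i"] n by (smt (verit) divide_nonneg_nonneg of_nat_0_le_iff)
    have "(\<Sum>b\<in>?U. \<Sum>c\<in>?U. v (row_idx i b) / n * (v (row_idx i c) / n) * (cmod (S b c))\<^sup>2)
       \<le> (\<Sum>b\<in>?U. \<Sum>c\<in>?U. v (row_idx i b) / n * \<delta> * (cmod (S b c))\<^sup>2)"
      using v0 dc by (intro sum_mono mult_right_mono mult_left_mono) auto
    also have "\<dots> = (\<Sum>b\<in>?U. v (row_idx i b) / n * \<delta> * (\<Sum>c\<in>?U. (cmod (S b c))\<^sup>2))"
      by (simp add: sum_distrib_left)
    also have "\<dots> \<le> (\<Sum>b\<in>?U. v (row_idx i b) / n * \<delta> * (1/4))"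
    proof (intro sum_mono mult_left_mono)
      fix b assume b: "b \<in> ?U"
      have "(\<Sum>c\<in>?U. (cmod (S b c))\<^sup>2) \<le> (\<Sum>c<n. (cmod (S b c))\<^sup>2)" by (intro sum_mono2) auto
      also have "\<dots> \<le> 1 / q\<^sup>2" unfolding S_def by (rule sum_norm_res_le'[OF q0]) (use b in auto)
      also have "\<dots> \<le> 1 / 2\<^sup>2" using q by (intro divide_left_mono power_mono) auto
      finally show "(\<Sum>c\<in>?U. (cmod (S b c))\<^sup>2) \<le> 1/4" by simp
      show "0 \<le> v (row_idx i b) / n * \<delta>" using v0 d0 by simp
    qed
    also have "\<dots> = \<delta> * row_sum n (\<lambda>p. v p / n) i / 4"
      by (simp add: row_sum_def sym_mat_row_idx sum_distrib_left mult_ac sum_divide_distrib)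
    finally show ?thesis by simp
  qed
  finally show "(\<integral>\<^sup>+ y. ennreal ((cmod (qf_dev n (\<lambda>p. v p / n) q (\<lambda>p. merge ?O ?J (x, y) p / sqrt n) i))\<^sup>2) \<partial>PiM ?J M)
     \<le> ennreal (\<delta> * row_sum n (\<lambda>p. v p / n) i / 2)"
    by (simp add: ennreal_leI)
qed

text \<open>The pointwise estimate \<open>res_dev_le\<close> is integrated. The diagonal entries and
  the quadratic forms have second moments of order \<open>\<delta>\<close>, so the bound vanishes
  together with the largest profile entry and the mean row-sum defect.\<close>

theorem expected_res_dev_le:
  assumes q: "q \<ge> 2" and \<alpha>: "0 < \<alpha>" "\<alpha> \<le> 1" and d: "\<And>p. p \<in> upper_idx n \<Longrightarrow> v p / n \<le> \<delta>" and d0: "\<delta> > 0"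
    and e: "e = (\<Sum>i<n. \<bar>row_sum n (\<lambda>p. v p / n) i - \<alpha>\<^sup>2\<bar>) / n"
  shows "(\<integral>\<^sup>+ x. ennreal (res_dev n (\<lambda>p. x p / sqrt n) \<alpha> q) \<partial>PiM (upper_idx n) M)
     \<le> ennreal (2 * sqrt \<delta> + sqrt \<delta> * e + \<delta> + e)"
proof -
  interpret product_prob_space M "upper_idx n" by (rule product_prob_spaceI) (rule ps)
  define s where "s p = v p / n" for p
  define r where "r = sqrt \<delta>"
  have r: "r > 0" "r * r = \<delta>" using d0 by (auto simp: r_def)
  have e0: "e \<ge> 0" unfolding e by (intro divide_nonneg_nonneg sum_nonneg) auto
  define T where "T i x = cmod (qf_dev n s q (\<lambda>p. x p / sqrt n) i)" for i x
  define H where "H i x = \<bar>x (i, i) / sqrt n\<bar>" for i and x :: "nat \<times> nat \<Rightarrow> real"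
  have idx: "(i, i) \<in> upper_idx n" if "i < n" for i using that by (simp add: upper_idx_def)
  have sd: "sym_mat s i j \<le> \<delta>" "sym_mat s i j \<ge> 0" if "i < n" "j < n" for i j
    using that d[of "(i, j)"] d[of "(j, i)"] v0 by (auto simp: sym_mat_def s_def upper_idx_def)
  have [measurable]: "T i \<in> borel_measurable (PiM (upper_idx n) M)" if "i < n" for i
  proof -
    have [measurable]: "(\<lambda>x. qf_dev n s q (\<lambda>p. x p / sqrt n) i) \<in> borel_measurable (PiM (upper_idx n) M)"
      by (rule measurable_qf_dev) (use q that in auto)
    show ?thesis unfolding T_def[abs_def] by measurable
  qed
  have [measurable]: "H i \<in> borel_measurable (PiM (upper_idx n) M)" if "i < n" for i
    unfolding H_def[abs_def] by (intro borel_measurable_abs borel_measurable_divide entry_measurable idx that) simp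
  \<comment> \<open>Replaces first moments by second moments; the weight r = sqrt
    \<open>\<delta>\<close> balances the two terms, since the second moments are of order
    r^2.\<close>
  have amgm: "t \<le> (r + t\<^sup>2 / r) / 2" for t
  proof -
    have "0 \<le> (t - r)\<^sup>2 / r" using r by simp
    also have "\<dots> = t\<^sup>2 / r - 2 * t + r" using r(1) by (simp add: power2_eq_square field_simps)
    finally show ?thesis by simp
  qed
  have pw: "res_dev n (\<lambda>p. x p / sqrt n) \<alpha> q \<le> (\<Sum>i<n. r + (H i x)\<^sup>2 / (2 * r) + (T i x)\<^sup>2 / (2 * r)) / n + (\<delta> + e)" for x
  proof -
    have "res_dev n (\<lambda>p. x p / sqrt n) \<alpha> q \<le> (\<Sum>i<n. H i x + T i x) / n + \<delta> + e"
      unfolding H_def T_def e s_def[symmetric]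
      by (rule res_dev_le[OF n q \<alpha>]) (use sd d0 in auto)
    also have "\<dots> \<le> (\<Sum>i<n. r + (H i x)\<^sup>2 / (2 * r) + (T i x)\<^sup>2 / (2 * r)) / n + \<delta> + e"
    proof -
      have "H i x + T i x \<le> r + (H i x)\<^sup>2 / (2 * r) + (T i x)\<^sup>2 / (2 * r)" for i
        using amgm[of "H i x"] amgm[of "T i x"] by (simp add: field_simps)
      then show ?thesis by (intro add_right_mono divide_right_mono sum_mono) auto
    qed
    finally show ?thesis by simp
  qed
  have ET: "(\<integral>\<^sup>+ x. ennreal ((T i x)\<^sup>2) \<partial>PiM (upper_idx n) M) \<le> ennreal (\<delta> * row_sum n s i / 2)" if "i < n" for i
    unfolding T_def s_def by (rule qf_dev_second_moment[OF q that d])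
  have EH: "(\<integral>\<^sup>+ x. ennreal ((H i x)\<^sup>2) \<partial>PiM (upper_idx n) M) \<le> ennreal \<delta>" if "i < n" for i
  proof -
    have "(\<integral>\<^sup>+ x. ennreal ((H i x)\<^sup>2) \<partial>PiM (upper_idx n) M)
      = (\<integral>\<^sup>+ x. ennreal ((\<Sum>p\<in>upper_idx n. (if p = (i, i) then 1 / sqrt n else 0) * x p)\<^sup>2) \<partial>PiM (upper_idx n) M)"
      using idx[OF that] by (simp add: H_def power_divide if_distrib[of "\<lambda>a. a * _"] cong: if_cong)
    also have "\<dots> \<le> ennreal (\<Sum>p\<in>upper_idx n. (if p = (i, i) then 1 / sqrt n else 0)\<^sup>2 * v p)"
      by (rule linear_form_second_moment[OF gl finite_upper_idx])
    also have "(\<Sum>p\<in>upper_idx n. (if p = (i, i) then 1 / sqrt n else 0)\<^sup>2 * v p) = v (i, i) / n"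
      using idx[OF that] n by (simp add: if_distrib[of "\<lambda>a. a\<^sup>2"] if_distrib[of "\<lambda>a. a * _"] power_divide cong: if_cong)
    finally show ?thesis using d[OF idx[OF that]] by (meson ennreal_leI order_trans)
  qed
  have "(\<integral>\<^sup>+ x. ennreal (res_dev n (\<lambda>p. x p / sqrt n) \<alpha> q) \<partial>PiM (upper_idx n) M)
     \<le> (\<integral>\<^sup>+ x. (\<Sum>i<n. ennreal (r / n) + ennreal (1 / (2 * r * n)) * ennreal ((H i x)\<^sup>2) + ennreal (1 / (2 * r * n)) * ennreal ((T i x)\<^sup>2)) + ennreal (\<delta> + e) \<partial>PiM (upper_idx n) M)"
  proof (intro nn_integral_mono)
    fix x
    have "(\<Sum>i<n. ennreal (r / n) + ennreal (1 / (2 * r * n)) * ennreal ((H i x)\<^sup>2) + ennreal (1 / (2 * r * n)) * ennreal ((T i x)\<^sup>2))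
       = (\<Sum>i<n. ennreal ((r + (H i x)\<^sup>2 / (2 * r) + (T i x)\<^sup>2 / (2 * r)) / n))"
      using r n by (intro sum.cong refl)
        (simp add: ennreal_mult'[symmetric] ennreal_plus[symmetric] add_divide_distrib del: ennreal_plus)
    also have "\<dots> = ennreal ((\<Sum>i<n. r + (H i x)\<^sup>2 / (2 * r) + (T i x)\<^sup>2 / (2 * r)) / n)"
      using r by (subst sum_ennreal) (auto simp: sum_divide_distrib)
    finally have eq: "(\<Sum>i<n. ennreal (r / n) + ennreal (1 / (2 * r * n)) * ennreal ((H i x)\<^sup>2) + ennreal (1 / (2 * r * n)) * ennreal ((T i x)\<^sup>2)) + ennreal (\<delta> + e)
       = ennreal ((\<Sum>i<n. r + (H i x)\<^sup>2 / (2 * r) + (T i x)\<^sup>2 / (2 * r)) / n + (\<delta> + e))"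
      using r d0 e0 by (subst ennreal_plus) (auto intro!: divide_nonneg_nonneg sum_nonneg)
    show "ennreal (res_dev n (\<lambda>p. x p / sqrt n) \<alpha> q) \<le> (\<Sum>i<n. ennreal (r / n) + ennreal (1 / (2 * r * n)) * ennreal ((H i x)\<^sup>2) + ennreal (1 / (2 * r * n)) * ennreal ((T i x)\<^sup>2)) + ennreal (\<delta> + e)"
      unfolding eq by (intro ennreal_leI pw)
  qed
  also have "\<dots> = (\<Sum>i<n. ennreal (r / n) + ennreal (1 / (2 * r * n)) * (\<integral>\<^sup>+ x. ennreal ((H i x)\<^sup>2) \<partial>PiM (upper_idx n) M)
      + ennreal (1 / (2 * r * n)) * (\<integral>\<^sup>+ x. ennreal ((T i x)\<^sup>2) \<partial>PiM (upper_idx n) M)) + ennreal (\<delta> + e)"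
    by (subst nn_integral_add, simp, simp, subst nn_integral_sum, simp)
       (simp add: nn_integral_add nn_integral_cmult emeasure_space_1)
  also have "\<dots> \<le> (\<Sum>i<n. ennreal (r / n) + ennreal (1 / (2 * r * n)) * ennreal \<delta>
      + ennreal (1 / (2 * r * n)) * ennreal (\<delta> * row_sum n s i / 2)) + ennreal (\<delta> + e)"
    by (intro add_mono sum_mono mult_left_mono EH ET order_refl) auto
  also have "\<dots> = ennreal ((\<Sum>i<n. r / n + 1 / (2 * r * n) * \<delta> + 1 / (2 * r * n) * (\<delta> * row_sum n s i / 2)) + (\<delta> + e))"
  proof -
    have rs0: "row_sum n s i \<ge> 0" if "i < n" for i
      unfolding row_sum_def using sd that by (intro sum_nonneg) auto
    have "(\<Sum>i<n. ennreal (r / n) + ennreal (1 / (2 * r * n)) * ennreal \<delta> + ennreal (1 / (2 * r * n)) * ennreal (\<delta> * row_sum n s i / 2))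
      = (\<Sum>i<n. ennreal (r / n + 1 / (2 * r * n) * \<delta> + 1 / (2 * r * n) * (\<delta> * row_sum n s i / 2)))"
      using r n d0 rs0 by (intro sum.cong refl)
        (simp add: ennreal_mult'[symmetric] ennreal_plus[symmetric] del: ennreal_plus)
    also have "\<dots> = ennreal (\<Sum>i<n. r / n + 1 / (2 * r * n) * \<delta> + 1 / (2 * r * n) * (\<delta> * row_sum n s i / 2))"
      using r n d0 rs0 by (subst sum_ennreal) auto
    finally show ?thesis
      using r n d0 rs0 e0 by (subst ennreal_plus) (auto intro!: sum_nonneg add_nonneg_nonneg)
  qed
  also have "\<dots> \<le> ennreal (2 * r + r * e + \<delta> + e)"
  proof (rule ennreal_leI)
    have "(\<Sum>i<n. row_sum n s i) \<le> (\<Sum>i<n. 1 + \<bar>row_sum n s i - \<alpha>\<^sup>2\<bar>)"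
      using \<alpha> power_le_one[of \<alpha> 2] by (intro sum_mono) auto
    also have "\<dots> = n + n * e" using n by (simp add: sum.distrib e s_def[symmetric])
    finally have rsum: "(\<Sum>i<n. row_sum n s i) / n \<le> 1 + e" using n by (simp add: field_simps)
    have "(\<Sum>i<n. r / n + 1 / (2 * r * n) * \<delta> + 1 / (2 * r * n) * (\<delta> * row_sum n s i / 2))
       = (\<Sum>i<n. 3 / 2 * r / n + r / 4 * (row_sum n s i / n))"
      using r(1) n unfolding r(2)[symmetric] by (intro sum.cong refl) (simp add: field_simps)
    also have "\<dots> = 3 / 2 * r + r / 4 * ((\<Sum>i<n. row_sum n s i) / n)"
      using n by (simp add: sum.distrib sum_distrib_left sum_divide_distrib)
    also have "\<dots> \<le> 3 / 2 * r + r / 4 * (1 + e)"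
      using r by (intro add_left_mono mult_left_mono rsum) auto
    also have "\<dots> \<le> 2 * r + r * e" using r e0 by (simp add: field_simps)
    finally show "(\<Sum>i<n. r / n + 1 / (2 * r * n) * \<delta> + 1 / (2 * r * n) * (\<delta> * row_sum n s i / 2)) + (\<delta> + e) \<le> 2 * r + r * e + \<delta> + e"
      by simp
  qed
  finally show ?thesis by (simp add: r_def)
qed

text \<open>Half of \<open>\<epsilon>\<close> absorbs the expectation and McDiarmid's inequality
  handles the other half. Block \<open>k\<close> holds the coordinates with first index
  \<open>k\<close>, all in row \<open>k\<close>; changing it moves the function by at most 6 / (q n)
  <= 3 / n. With n blocks the exponent is (\<epsilon> / 2)^2 / (2 n (3 / n)^2) = \<epsilon>^2 n /
  72.\<close>

theorem prob_res_dev_le: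
  assumes q: "q \<ge> 2" and \<alpha>: "0 < \<alpha>" "\<alpha> \<le> 1" and d: "\<And>p. p \<in> upper_idx n \<Longrightarrow> v p / n \<le> \<delta>" and d0: "\<delta> > 0"
    and e: "e = (\<Sum>i<n. \<bar>row_sum n (\<lambda>p. v p / n) i - \<alpha>\<^sup>2\<bar>) / n"
    and small: "2 * sqrt \<delta> + sqrt \<delta> * e + \<delta> + e \<le> \<epsilon> / 2" and \<epsilon>: "\<epsilon> > 0"
  shows "measure (PiM (upper_idx n) M) {x\<in>space (PiM (upper_idx n) M). res_dev n (\<lambda>p. x p / sqrt n) \<alpha> q \<ge> \<epsilon>}
     \<le> exp (- \<epsilon>\<^sup>2 / 72 * n)"
proof -
  interpret product_prob_space M "upper_idx n" by (rule product_prob_spaceI) (rule ps)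
  let ?P = "PiM (upper_idx n) M"
  let ?F = "\<lambda>x. res_dev n (\<lambda>p. x p / sqrt n) \<alpha> q"
  have q0: "q > 0" using q by simp
  have z: "Im (Complex 0 q) = q" "q > 0" using q by auto
  note m[measurable] = measurable_res_dev[OF q0, of "sqrt n" \<alpha>]
  have F0: "?F x \<ge> 0" for x unfolding res_dev_def by (intro divide_nonneg_nonneg sum_nonneg) auto
  have F1: "?F x \<le> 1" for x
  proof -
    have "?F x \<le> (\<Sum>i<n. 1) / n"
      unfolding res_dev_def
    proof (intro divide_right_mono sum_mono)
      fix i assume "i \<in> {..<n}"
      then have i: "i < n" by simp
      have "1 / q \<le> 1/2" using q by (simp add: field_simps)
      moreover have "cmod (res n (sym_mat (\<lambda>p. x p / sqrt n)) (Complex 0 q) i i) \<le> 1 / q"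
        by (rule norm_res_le[OF z i i])
      moreover have "cmod (Complex 0 (sc_stieltjes \<alpha> q)) \<le> 1 / q"
        using sc_stieltjes_bounds[OF \<alpha>(1) q0] by (simp add: cmod_def)
      ultimately show "cmod (res n (sym_mat (\<lambda>p. x p / sqrt n)) (Complex 0 q) i i - Complex 0 (sc_stieltjes \<alpha> q)) \<le> 1"
        by (intro order.trans[OF norm_triangle_ineq4]) linarith
    qed auto
    then show ?thesis using n by simp
  qed
  have int: "integrable ?P ?F"
    by (rule P.integrable_const_bound[where B = 1]) (use F0 F1 in \<open>auto intro!: AE_I2\<close>)
  have "ennreal (\<integral>x. ?F x \<partial>?P) = (\<integral>\<^sup>+ x. ennreal (?F x) \<partial>?P)"
    by (rule nn_integral_eq_integral[OF int, symmetric]) (use F0 in auto)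
  also have "\<dots> \<le> ennreal (2 * sqrt \<delta> + sqrt \<delta> * e + \<delta> + e)"
    by (rule expected_res_dev_le[OF q \<alpha> d d0 e])
  also have "\<dots> \<le> ennreal (\<epsilon> / 2)" by (intro ennreal_leI small)
  finally have E: "(\<integral>x. ?F x \<partial>?P) \<le> \<epsilon> / 2" using \<epsilon> by (simp add: ennreal_le_iff)
  have bd: "\<bar>?F x - ?F y\<bar> \<le> 3 / n"
    if "k < n" "\<And>p. p \<in> upper_idx n \<Longrightarrow> fst p \<noteq> k \<Longrightarrow> x p = y p" for k x y
  proof -
    let ?R = "\<lambda>x. res n (sym_mat (\<lambda>p. x p / sqrt n)) (Complex 0 q)" and ?m = "Complex 0 (sc_stieltjes \<alpha> q)"
    have "?F x - ?F y = (\<Sum>i<n. cmod (?R x i i - ?m) - cmod (?R y i i - ?m)) / n"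
      by (simp add: res_dev_def sum_subtractf diff_divide_distrib)
    then have "\<bar>?F x - ?F y\<bar> = \<bar>\<Sum>i<n. cmod (?R x i i - ?m) - cmod (?R y i i - ?m)\<bar> / n" by simp
    also have "\<dots> \<le> (\<Sum>i<n. cmod (?R x i i - ?R y i i)) / n"
    proof (intro divide_right_mono order.trans[OF sum_abs] sum_mono)
      fix i
      show "\<bar>cmod (?R x i i - ?m) - cmod (?R y i i - ?m)\<bar> \<le> cmod (?R x i i - ?R y i i)"
        using norm_triangle_ineq3[of "?R x i i - ?m" "?R y i i - ?m"] by simp
    qed auto
    also have "\<dots> \<le> (6 / q) / n"
      by (intro divide_right_mono sum_res_row_change_le[OF z that(1)]) (use that(2) in \<open>auto simp: upper_idx_def\<close>)
    also have "\<dots> \<le> 3 / n" using q n by (simp add: field_simps)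
    finally show ?thesis .
  qed
  have "measure ?P {x\<in>space ?P. ?F x \<ge> \<epsilon>} \<le> measure ?P {x\<in>space ?P. ?F x \<ge> (\<integral>y. ?F y \<partial>?P) + \<epsilon> / 2}"
    using E by (intro P.finite_measure_mono) auto
  also have "\<dots> \<le> exp (- (\<epsilon> / 2)\<^sup>2 / (2 * real (card {..<n}) * (3 / n)\<^sup>2))"
  proof (rule mcdiarmid[where b = fst and B = 1])
    show "fst ` upper_idx n \<subseteq> {..<n}" by (auto simp: upper_idx_def)
    show "\<bar>?F x\<bar> \<le> 1" for x using F0 F1 by simp
  qed (use n \<epsilon> bd ps m in auto)
  also have "- (\<epsilon> / 2)\<^sup>2 / (2 * real (card {..<n}) * (3 / n)\<^sup>2) = - \<epsilon>\<^sup>2 / 72 * n"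
    using n by (simp add: field_simps power2_eq_square)
  finally show ?thesis .
qed

end

section \<open>Approximation by combinations of Cauchy kernels\<close>

text \<open>The generators are the real part and, up to the factor q, the imaginary part of 1 / (x -
  i q). Rational q keep the family of conditions countable; constants make the uniform closure a
  unital algebra.\<close>

inductive_set cauchy_span :: "(real \<Rightarrow> real) set" where
  const: "(\<lambda>_. c) \<in> cauchy_span"
| re: "q \<in> \<rat> \<Longrightarrow> q \<ge> 2 \<Longrightarrow> (\<lambda>x. x / (x\<^sup>2 + q\<^sup>2)) \<in> cauchy_span"
| im: "q \<in> \<rat> \<Longrightarrow> q \<ge> 2 \<Longrightarrow> (\<lambda>x. 1 / (x\<^sup>2 + q\<^sup>2)) \<in> cauchy_span"
| add: "f \<in> cauchy_span \<Longrightarrow> g \<in> cauchy_span \<Longrightarrow> (\<lambda>x. f x + g x) \<in> cauchy_span"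
| scale: "f \<in> cauchy_span \<Longrightarrow> (\<lambda>x. c * f x) \<in> cauchy_span"

definition cauchy_approx :: "(real \<Rightarrow> real) \<Rightarrow> bool" where
  "cauchy_approx f \<longleftrightarrow> (\<forall>e>0. \<exists>h\<in>cauchy_span. \<forall>x. \<bar>f x - h x\<bar> \<le> e)"

lemma cauchy_kernel_bounds:
  fixes q x :: real
  assumes "q \<ge> 2"
  shows "\<bar>x / (x\<^sup>2 + q\<^sup>2)\<bar> \<le> 1" "\<bar>1 / (x\<^sup>2 + q\<^sup>2)\<bar> \<le> 1" "x\<^sup>2 + q\<^sup>2 > 0"
proof -
  have "2\<^sup>2 \<le> q\<^sup>2" using assms by (intro power_mono) auto
  then have q: "q\<^sup>2 \<ge> 4" by simp
  show p: "x\<^sup>2 + q\<^sup>2 > 0" using q zero_le_power2[of x] by linarith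
  have "0 \<le> (\<bar>x\<bar> - 1)\<^sup>2" by simp
  then have "2 * \<bar>x\<bar> \<le> x\<^sup>2 + 1" by (simp add: power2_diff)
  then have "\<bar>x\<bar> \<le> x\<^sup>2 + q\<^sup>2" using q zero_le_power2[of x] by linarith
  then show "\<bar>x / (x\<^sup>2 + q\<^sup>2)\<bar> \<le> 1" using p by (simp add: abs_divide)
  have "1 \<le> x\<^sup>2 + q\<^sup>2" using q zero_le_power2[of x] by linarith
  then show "\<bar>1 / (x\<^sup>2 + q\<^sup>2)\<bar> \<le> 1" using p by (simp add: abs_divide)
qed

lemma cauchy_span_bounded:
  assumes "f \<in> cauchy_span"
  shows "\<exists>B>0. \<forall>x. \<bar>f x\<bar> \<le> B"
  using assms
proof induction
  case (const c)
  show ?case by (intro exI[of _ "\<bar>c\<bar> + 1"]) auto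
next
  case (re q)
  then show ?case using cauchy_kernel_bounds by (intro exI[of _ 1]) auto
next
  case (im q)
  then show ?case using cauchy_kernel_bounds by (intro exI[of _ 1]) auto
next
  case (add f g)
  then obtain B C where "B > 0" "\<forall>x. \<bar>f x\<bar> \<le> B" "C > 0" "\<forall>x. \<bar>g x\<bar> \<le> C" by blast
  then show ?case by (intro exI[of _ "B + C"]) (auto intro!: order.trans[OF abs_triangle_ineq] add_mono)
next
  case (scale f c)
  then obtain B where B: "B > 0" "\<forall>x. \<bar>f x\<bar> \<le> B" by blast
  have "\<bar>c * f x\<bar> \<le> \<bar>c\<bar> * B + 1" for x
    using mult_left_mono[OF B(2)[rule_format, of x], of "\<bar>c\<bar>"] by (simp add: abs_mult)
  then show ?case using B(1) by (intro exI[of _ "\<bar>c\<bar> * B + 1"]) (auto intro: add_nonneg_pos)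
qed

lemma cauchy_approx_span: "f \<in> cauchy_span \<Longrightarrow> cauchy_approx f"
  unfolding cauchy_approx_def by (intro allI impI bexI[of _ f]) auto

lemma cauchy_approx_limit:
  assumes "\<And>e. e > 0 \<Longrightarrow> \<exists>g. cauchy_approx g \<and> (\<forall>x. \<bar>f x - g x\<bar> \<le> e)"
  shows "cauchy_approx f"
  unfolding cauchy_approx_def
proof (intro allI impI)
  fix e :: real assume e: "e > 0"
  obtain g where g: "cauchy_approx g" "\<forall>x. \<bar>f x - g x\<bar> \<le> e/2"
    using assms[of "e/2"] e by auto
  obtain h where h: "h \<in> cauchy_span" "\<forall>x. \<bar>g x - h x\<bar> \<le> e/2"
    using g(1) e unfolding cauchy_approx_def by (meson half_gt_zero)
  have "\<bar>f x - h x\<bar> \<le> e" for x using g(2)[rule_format, of x] h(2)[rule_format, of x] by linarith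
  then show "\<exists>h\<in>cauchy_span. \<forall>x. \<bar>f x - h x\<bar> \<le> e" using h(1) by auto
qed

lemma cauchy_approx_add:
  assumes "cauchy_approx f" "cauchy_approx g"
  shows "cauchy_approx (\<lambda>x. f x + g x)"
  unfolding cauchy_approx_def
proof (intro allI impI)
  fix e :: real assume e: "e > 0"
  obtain h where h: "h \<in> cauchy_span" "\<forall>x. \<bar>f x - h x\<bar> \<le> e/2"
    using assms(1) e unfolding cauchy_approx_def by (meson half_gt_zero)
  obtain k where k: "k \<in> cauchy_span" "\<forall>x. \<bar>g x - k x\<bar> \<le> e/2"
    using assms(2) e unfolding cauchy_approx_def by (meson half_gt_zero)
  have "\<bar>f x + g x - (h x + k x)\<bar> \<le> e" for x
    using h(2)[rule_format, of x] k(2)[rule_format, of x] by linarith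
  then show "\<exists>h\<in>cauchy_span. \<forall>x. \<bar>f x + g x - h x\<bar> \<le> e"
    by (intro bexI[OF _ cauchy_span.add[OF h(1) k(1)]]) auto
qed

lemma cauchy_approx_scale:
  assumes "cauchy_approx f"
  shows "cauchy_approx (\<lambda>x. c * f x)"
  unfolding cauchy_approx_def
proof (intro allI impI)
  fix e :: real assume e: "e > 0"
  have c: "\<bar>c\<bar> + 1 > 0" by simp
  obtain h where h: "h \<in> cauchy_span" "\<forall>x. \<bar>f x - h x\<bar> \<le> e / (\<bar>c\<bar> + 1)"
    using assms(1) divide_pos_pos[OF e c] unfolding cauchy_approx_def by blast
  have "\<bar>c * f x - c * h x\<bar> \<le> e" for x
  proof -
    have "\<bar>c * f x - c * h x\<bar> = \<bar>c\<bar> * \<bar>f x - h x\<bar>" by (simp add: abs_mult[symmetric] right_diff_distrib)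
    also have "\<dots> \<le> (\<bar>c\<bar> + 1) * (e / (\<bar>c\<bar> + 1))" using h(2) by (intro mult_mono) auto
    finally show ?thesis by simp
  qed
  then show "\<exists>h\<in>cauchy_span. \<forall>x. \<bar>c * f x - h x\<bar> \<le> e"
    by (intro bexI[OF _ cauchy_span.scale[OF h(1)]]) auto
qed

lemma rational_above:
  fixes q d :: real
  assumes "d > 0"
  obtains q' where "q' \<in> \<rat>" "q < q'" "q' < q + d"
  using Rats_dense_in_real[of q "q + d"] assms by auto

text \<open>For different poles the product is a combination of two kernels by partial fractions. A
  double pole is a uniform limit of such products as one parameter tends to the other through the
  rationals, so it lies in the closure of the span.\<close>

lemma cauchy_approx_kernel_mult:
  fixes f :: "real \<Rightarrow> real" and q q' :: real
  assumes q: "q \<in> \<rat>" "q \<ge> 2" and q': "q' \<in> \<rat>" "q' \<ge> 2"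
    and f: "\<And>r. r \<in> \<rat> \<Longrightarrow> r \<ge> 2 \<Longrightarrow> (\<lambda>x. f x / (x\<^sup>2 + r\<^sup>2)) \<in> cauchy_span"
    and f1: "\<And>r x. r \<ge> 2 \<Longrightarrow> \<bar>f x / (x\<^sup>2 + r\<^sup>2)\<bar> \<le> 1"
  shows "cauchy_approx (\<lambda>x. f x / (x\<^sup>2 + q\<^sup>2) * (1 / (x\<^sup>2 + q'\<^sup>2)))"
proof -
  have ne: "cauchy_approx (\<lambda>x. f x / (x\<^sup>2 + q\<^sup>2) * (1 / (x\<^sup>2 + r\<^sup>2)))" if r: "r \<in> \<rat>" "r \<ge> 2" "r \<noteq> q" for r
  proof -
    have d: "r\<^sup>2 - q\<^sup>2 \<noteq> 0" using r q by (auto simp: power2_eq_iff)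
    have "(\<lambda>x. 1 / (r\<^sup>2 - q\<^sup>2) * (f x / (x\<^sup>2 + q\<^sup>2) + (-1) * (f x / (x\<^sup>2 + r\<^sup>2)))) \<in> cauchy_span"
      by (intro cauchy_span.scale cauchy_span.add f r q)
    also have "(\<lambda>x. 1 / (r\<^sup>2 - q\<^sup>2) * (f x / (x\<^sup>2 + q\<^sup>2) + (-1) * (f x / (x\<^sup>2 + r\<^sup>2)))) = (\<lambda>x. f x / (x\<^sup>2 + q\<^sup>2) * (1 / (x\<^sup>2 + r\<^sup>2)))"
    proof
      fix x :: real
      define A where "A = x\<^sup>2 + q\<^sup>2"
      define B where "B = x\<^sup>2 + r\<^sup>2"
      have AB: "A > 0" "B > 0" using cauchy_kernel_bounds(3) q r by (auto simp: A_def B_def)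
      have "f x / A + (-1) * (f x / B) = (B - A) * (f x / A * (1 / B))"
        using AB by (simp add: field_simps)
      moreover have "B - A = r\<^sup>2 - q\<^sup>2" by (simp add: A_def B_def)
      ultimately show "1 / (r\<^sup>2 - q\<^sup>2) * (f x / (x\<^sup>2 + q\<^sup>2) + (-1) * (f x / (x\<^sup>2 + r\<^sup>2))) = f x / (x\<^sup>2 + q\<^sup>2) * (1 / (x\<^sup>2 + r\<^sup>2))"
        using d unfolding A_def[symmetric] B_def[symmetric] by simp
    qed
    finally show ?thesis by (rule cauchy_approx_span)
  qed
  show ?thesis
  proof (cases "q' = q")
    case False then show ?thesis using ne q' by blast
  next
    case True
    show ?thesis unfolding True
    proof (rule cauchy_approx_limit)
      fix e :: real assume e: "e > 0"
      \<comment> \<open>For q < r < q + d with d <= 1 one has r^2 - q^2 <= d (2 q + 1), which is at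
        most \<open>e\<close>.\<close>
      define d where "d = min 1 (e / (2 * q + 1))"
      have "d \<le> e / (2 * q + 1)" by (simp add: d_def)
      then have "d * (2 * q + 1) \<le> e" using q by (simp add: pos_le_divide_eq)
      then have d: "d > 0" "d \<le> 1" "d * (2 * q + 1) \<le> e"
        using e q by (auto simp: d_def)
      obtain r where r: "r \<in> \<rat>" "q < r" "r < q + d" using rational_above[OF d(1)] by blast
      have r2: "r \<ge> 2" using q r by simp
      have "\<bar>f x / (x\<^sup>2 + q\<^sup>2) * (1 / (x\<^sup>2 + q\<^sup>2)) - f x / (x\<^sup>2 + q\<^sup>2) * (1 / (x\<^sup>2 + r\<^sup>2))\<bar> \<le> e" for x
      proof -
        define A where "A = x\<^sup>2 + q\<^sup>2"
        define B where "B = x\<^sup>2 + r\<^sup>2"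
        have AB: "A > 0" "B > 0" using cauchy_kernel_bounds(3) q r2 by (auto simp: A_def B_def)
        have "f x / A * (1 / A) - f x / A * (1 / B) = (B - A) * (f x / A) * (1 / A) * (1 / B)"
          using AB by (simp add: field_simps)
        then have "\<bar>f x / A * (1 / A) - f x / A * (1 / B)\<bar> = \<bar>B - A\<bar> * \<bar>f x / A\<bar> * \<bar>1 / A\<bar> * \<bar>1 / B\<bar>"
          by (simp add: abs_mult)
        also have "\<dots> \<le> \<bar>B - A\<bar> * 1 * 1 * 1"
          using f1[OF q(2), of x] cauchy_kernel_bounds(2)[OF q(2), of x] cauchy_kernel_bounds(2)[OF r2, of x]
          unfolding A_def[symmetric] B_def[symmetric] by (intro mult_mono) auto
        also have "\<bar>B - A\<bar> = (r - q) * (r + q)"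
          using r q by (simp add: A_def B_def square_diff_square_factored power2_eq_square)
        also have "\<dots> * 1 * 1 * 1 \<le> d * (2 * q + 1)" using r d q by (simp add: mult_mono)
        finally show ?thesis using d unfolding A_def B_def by linarith
      qed
      then show "\<exists>g. cauchy_approx g \<and> (\<forall>x. \<bar>f x / (x\<^sup>2 + q\<^sup>2) * (1 / (x\<^sup>2 + q\<^sup>2)) - g x\<bar> \<le> e)"
        using ne[OF r(1) r2] r(2) by (intro exI[of _ "\<lambda>x. f x / (x\<^sup>2 + q\<^sup>2) * (1 / (x\<^sup>2 + r\<^sup>2))"]) auto
    qed
  qed
qed

lemma cauchy_approx_mult_gen:
  assumes f: "f \<in> cauchy_span"
    and g: "cauchy_approx g" "\<And>q. q \<in> \<rat> \<Longrightarrow> q \<ge> 2 \<Longrightarrow> cauchy_approx (\<lambda>x. x / (x\<^sup>2 + q\<^sup>2) * g x)"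
       "\<And>q. q \<in> \<rat> \<Longrightarrow> q \<ge> 2 \<Longrightarrow> cauchy_approx (\<lambda>x. 1 / (x\<^sup>2 + q\<^sup>2) * g x)"
  shows "cauchy_approx (\<lambda>x. f x * g x)"
  using f
proof induction
  case (const c)
  show ?case by (rule cauchy_approx_scale[OF g(1)])
next
  case (add f h)
  then show ?case using cauchy_approx_add by (simp add: distrib_right)
next
  case (scale f c)
  then show ?case using cauchy_approx_scale[of "\<lambda>x. f x * g x" c] by (simp add: mult.assoc)
qed (use g in auto)

lemma cauchy_approx_span_mult:
  assumes f: "f \<in> cauchy_span" and g: "g \<in> cauchy_span"
  shows "cauchy_approx (\<lambda>x. f x * g x)"
proof -
  have im_im: "cauchy_approx (\<lambda>x. 1 / (x\<^sup>2 + q\<^sup>2) * (1 / (x\<^sup>2 + r\<^sup>2)))"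
    if "q \<in> \<rat>" "q \<ge> 2" "r \<in> \<rat>" "r \<ge> 2" for q r :: real
    by (rule cauchy_approx_kernel_mult[where f = "\<lambda>_. 1"]) (use that cauchy_kernel_bounds in \<open>auto intro: cauchy_span.im\<close>)
  have re_im: "cauchy_approx (\<lambda>x. x / (x\<^sup>2 + q\<^sup>2) * (1 / (x\<^sup>2 + r\<^sup>2)))"
    if "q \<in> \<rat>" "q \<ge> 2" "r \<in> \<rat>" "r \<ge> 2" for q r :: real
    by (rule cauchy_approx_kernel_mult[where f = "\<lambda>x. x"]) (use that cauchy_kernel_bounds in \<open>auto intro: cauchy_span.re\<close>)
  have re_re: "cauchy_approx (\<lambda>x. x / (x\<^sup>2 + q\<^sup>2) * (x / (x\<^sup>2 + r\<^sup>2)))"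
    if qr: "q \<in> \<rat>" "q \<ge> 2" "r \<in> \<rat>" "r \<ge> 2" for q r :: real
  proof -
    \<comment> \<open>Uses x^2 / (x^2 + q^2) = 1 - q^2 / (x^2 + q^2) to remove the numerator
      x^2.\<close>
    have "cauchy_approx (\<lambda>x. 1 / (x\<^sup>2 + r\<^sup>2) + (- q\<^sup>2) * (1 / (x\<^sup>2 + q\<^sup>2) * (1 / (x\<^sup>2 + r\<^sup>2))))"
      by (intro cauchy_approx_add cauchy_approx_scale im_im qr cauchy_approx_span cauchy_span.im)
    also have "(\<lambda>x. 1 / (x\<^sup>2 + r\<^sup>2) + (- q\<^sup>2) * (1 / (x\<^sup>2 + q\<^sup>2) * (1 / (x\<^sup>2 + r\<^sup>2)))) = (\<lambda>x. x / (x\<^sup>2 + q\<^sup>2) * (x / (x\<^sup>2 + r\<^sup>2)))"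
    proof
      fix x :: real
      define A where "A = x\<^sup>2 + q\<^sup>2"
      have A: "A > 0" using cauchy_kernel_bounds(3)[OF qr(2)] by (simp add: A_def)
      have "1 / (x\<^sup>2 + r\<^sup>2) + (- q\<^sup>2) * (1 / A * (1 / (x\<^sup>2 + r\<^sup>2))) = (A - q\<^sup>2) / A * (1 / (x\<^sup>2 + r\<^sup>2))"
        using A by (simp add: diff_divide_distrib algebra_simps)
      then show "1 / (x\<^sup>2 + r\<^sup>2) + (- q\<^sup>2) * (1 / (x\<^sup>2 + q\<^sup>2) * (1 / (x\<^sup>2 + r\<^sup>2))) = x / (x\<^sup>2 + q\<^sup>2) * (x / (x\<^sup>2 + r\<^sup>2))"
        by (simp add: A_def power2_eq_square)
    qed
    finally show ?thesis .
  qed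
  show ?thesis
  proof (rule cauchy_approx_mult_gen[OF f cauchy_approx_span[OF g]])
    fix q :: real assume q: "q \<in> \<rat>" "q \<ge> 2"
    have "cauchy_approx (\<lambda>x. g x * (x / (x\<^sup>2 + q\<^sup>2)))"
      by (rule cauchy_approx_mult_gen[OF g cauchy_approx_span[OF cauchy_span.re[OF q]]])
         (use re_re re_im q in \<open>auto simp: mult.commute\<close>)
    then show "cauchy_approx (\<lambda>x. x / (x\<^sup>2 + q\<^sup>2) * g x)" by (simp add: mult.commute)
    have "cauchy_approx (\<lambda>x. g x * (1 / (x\<^sup>2 + q\<^sup>2)))"
      by (rule cauchy_approx_mult_gen[OF g cauchy_approx_span[OF cauchy_span.im[OF q]]])
         (use re_im im_im q in auto)
    then show "cauchy_approx (\<lambda>x. 1 / (x\<^sup>2 + q\<^sup>2) * g x)" by (simp add: mult.commute)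
  qed
qed

lemma cauchy_approx_mult:
  assumes "cauchy_approx f" "cauchy_approx g"
  shows "cauchy_approx (\<lambda>x. f x * g x)"
proof (rule cauchy_approx_limit)
  fix e :: real assume e: "e > 0"
  obtain h0 where h0: "h0 \<in> cauchy_span" "\<forall>x. \<bar>f x - h0 x\<bar> \<le> 1"
    using assms(1) unfolding cauchy_approx_def by (meson zero_less_one)
  obtain B where B: "B > 0" "\<forall>x. \<bar>h0 x\<bar> \<le> B" using cauchy_span_bounded[OF h0(1)] by blast
  have fB: "\<bar>f x\<bar> \<le> B + 1" for x using h0(2)[rule_format, of x] B(2)[rule_format, of x] by linarith
  obtain k where k: "k \<in> cauchy_span" "\<forall>x. \<bar>g x - k x\<bar> \<le> e / (2 * (B + 1))"
    using assms(2) e B unfolding cauchy_approx_def by (metis add_pos_pos divide_pos_pos mult_pos_pos zero_less_numeral zero_less_one)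
  obtain C where C: "C > 0" "\<forall>x. \<bar>k x\<bar> \<le> C" using cauchy_span_bounded[OF k(1)] by blast
  obtain h where h: "h \<in> cauchy_span" "\<forall>x. \<bar>f x - h x\<bar> \<le> e / (2 * C)"
    using assms(1) e C unfolding cauchy_approx_def by (metis divide_pos_pos mult_pos_pos zero_less_numeral)
  have "\<bar>f x * g x - h x * k x\<bar> \<le> e" for x
  proof -
    have "f x * g x - h x * k x = f x * (g x - k x) + (f x - h x) * k x" by (simp add: algebra_simps)
    then have "\<bar>f x * g x - h x * k x\<bar> \<le> \<bar>f x\<bar> * \<bar>g x - k x\<bar> + \<bar>f x - h x\<bar> * \<bar>k x\<bar>"
      by (metis abs_mult abs_triangle_ineq)
    also have "\<dots> \<le> (B + 1) * (e / (2 * (B + 1))) + (e / (2 * C)) * C"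
      using fB k h C B e by (intro add_mono mult_mono) auto
    also have "\<dots> = e" using B C by (simp add: field_simps)
    finally show ?thesis .
  qed
  then show "\<exists>g'. cauchy_approx g' \<and> (\<forall>x. \<bar>f x * g x - g' x\<bar> \<le> e)"
    using cauchy_approx_span_mult[OF h(1) k(1)] by blast
qed

text \<open>The map \<open>x \<mapsto> circle_pt x\<close> is (the inverse of) a stereographic projection, so that a function
  vanishing at infinity becomes a continuous function on the circle.\<close>

definition circle_pt :: "real \<Rightarrow> complex" where
  "circle_pt x = Complex (4 * x / (x\<^sup>2 + 4)) ((x\<^sup>2 - 4) / (x\<^sup>2 + 4))"

text \<open>The two coordinates of \<open>circle_pt x\<close> are 4 x / (x^2 + 4) and 1 - 8 / (x^2 +
  4), combinations of constants and kernels with q = 2. Closure under sums and products does the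
  rest.\<close>

lemma cauchy_approx_circle_polynomial:
  assumes "real_polynomial_function p"
  shows "cauchy_approx (\<lambda>x. p (circle_pt x))"
  using assms
proof induction
  case (linear f)
  then interpret bounded_linear f .
  have f: "f w = Re w * f 1 + Im w * f \<i>" for w
  proof -
    have "w = Re w *\<^sub>R 1 + Im w *\<^sub>R \<i>" by (simp add: complex_eq_iff)
    then have "f w = f (Re w *\<^sub>R 1 + Im w *\<^sub>R \<i>)" by simp
    then show ?thesis by (simp only: local.add scale) simp
  qed
  have "cauchy_approx (\<lambda>x. 4 * f 1 * (x / (x\<^sup>2 + 2\<^sup>2)) + (f \<i> + (- 8 * f \<i>) * (1 / (x\<^sup>2 + 2\<^sup>2))))"
    by (intro cauchy_approx_span cauchy_span.intros) auto
  also have "(\<lambda>x. 4 * f 1 * (x / (x\<^sup>2 + 2\<^sup>2)) + (f \<i> + (- 8 * f \<i>) * (1 / (x\<^sup>2 + 2\<^sup>2)))) = (\<lambda>x. f (circle_pt x))"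
  proof
    fix x :: real
    have p: "x\<^sup>2 + 4 \<noteq> 0" using zero_le_power2[of x] by linarith
    have E: "(x\<^sup>2 - 4) / (x\<^sup>2 + 4) = 1 - 8 / (x\<^sup>2 + 4)" using p by (simp add: field_simps)
    show "4 * f 1 * (x / (x\<^sup>2 + 2\<^sup>2)) + (f \<i> + (- 8 * f \<i>) * (1 / (x\<^sup>2 + 2\<^sup>2))) = f (circle_pt x)"
      unfolding f[of "circle_pt x"] unfolding circle_pt_def complex.sel E by (simp add: algebra_simps)
  qed
  finally show ?case .
next
  case (const c)
  show ?case by (rule cauchy_approx_span[OF cauchy_span.const])
qed (auto intro: cauchy_approx_add cauchy_approx_mult)

text \<open>Stereographic projection turns \<open>f\<close> into a function on the unit circle that
  is continuous also at the pole i, where it takes the value 0. Stone-Weierstrass gives a polynomial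
  on the circle, and pulling it back gives an element of the closure.\<close>

theorem cauchy_approx_C0:
  fixes f :: "real \<Rightarrow> real"
  assumes cont: "continuous_on UNIV f" and lim: "(f \<longlongrightarrow> 0) at_infinity"
  shows "cauchy_approx f"
proof (rule cauchy_approx_limit)
  fix e :: real assume e: "e > 0"
  let ?S = "sphere (0::complex) 1"
  define X where "X w = 2 * Re w / (1 - Im w)" for w
  define \<phi> where "\<phi> w = (if w = \<i> then 0 else f (X w))" for w
  have S: "(Re w)\<^sup>2 + (Im w)\<^sup>2 = 1" if "w \<in> ?S" for w
    using that by (simp add: cmod_def)
  have Im1: "Im w < 1" if "w \<in> ?S" "w \<noteq> \<i>" for w
  proof -
    have "(Im w)\<^sup>2 \<le> 1\<^sup>2" using S[OF that(1)] by (metis add.commute le_add_same_cancel1 one_power2 zero_le_power2)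
    then have "Im w \<le> 1" by (rule power2_le_imp_le) simp
    moreover have "Im w \<noteq> 1" using S[OF that(1)] that(2) by (auto simp: complex_eq_iff)
    ultimately show ?thesis by simp
  qed
  \<comment> \<open>Quantifies that |X w| tends to infinity as w approaches the pole; this gives
    continuity there.\<close>
  have X2: "(X w)\<^sup>2 + 4 = 8 / (1 - Im w)" if "w \<in> ?S" "w \<noteq> \<i>" for w
  proof -
    define c where "c = 1 - Im w"
    have c: "c \<noteq> 0" using Im1[OF that] by (simp add: c_def)
    have "(2 * Re w)\<^sup>2 + 4 * c\<^sup>2 = 8 * c"
      using S[OF that(1)] by (simp add: c_def power2_eq_square algebra_simps)
    moreover have "(X w)\<^sup>2 + 4 = ((2 * Re w)\<^sup>2 + 4 * c\<^sup>2) / c\<^sup>2"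
      using c by (simp add: X_def c_def[symmetric] power_divide add_divide_distrib)
    ultimately show ?thesis using c by (simp add: c_def[symmetric] power2_eq_square)
  qed
  have "continuous_on ?S \<phi>"
  proof (unfold continuous_on_def, intro ballI)
    fix w assume w: "w \<in> ?S"
    show "(\<phi> \<longlongrightarrow> \<phi> w) (at w within ?S)"
    proof (cases "w = \<i>")
      case False
      have "isCont f (X w)" using cont by (simp add: continuous_on_eq_continuous_at)
      moreover have "(X \<longlongrightarrow> X w) (at w within ?S)"
        unfolding X_def using Im1[OF w False] by (intro tendsto_intros) auto
      ultimately have "((\<lambda>v. f (X v)) \<longlongrightarrow> f (X w)) (at w within ?S)"
        by (rule isCont_tendsto_compose)
      moreover have "eventually (\<lambda>v. f (X v) = \<phi> v) (at w within ?S)"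
        using eventually_neq_at_within[of \<i> w ?S] by eventually_elim (simp add: \<phi>_def)
      ultimately show ?thesis using False by (auto simp: \<phi>_def intro: Lim_transform_eventually)
    next
      case True
      show ?thesis unfolding True
      proof (rule tendstoI)
        fix d :: real assume d: "d > 0"
        from lim d have "eventually (\<lambda>x. dist (f x) 0 < d) at_infinity" by (rule tendstoD)
        then obtain b where b: "\<And>x. b \<le> norm x \<Longrightarrow> \<bar>f x\<bar> < d" by (auto simp: eventually_at_infinity)
        define K where "K = b\<^sup>2 + 4"
        have K: "K > 0" unfolding K_def using zero_le_power2[of b] by linarith
        have "eventually (\<lambda>v. v \<in> ?S \<and> v \<noteq> \<i> \<and> dist v \<i> < 8 / K) (at \<i> within ?S)"
          using K unfolding eventually_at by (intro exI[of _ "8 / K"]) auto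
        then show "eventually (\<lambda>v. dist (\<phi> v) (\<phi> \<i>) < d) (at \<i> within ?S)"
        proof eventually_elim
          case (elim v)
          have i1: "1 - Im v > 0" using Im1 elim by simp
          have "1 - Im v \<le> \<bar>Im (v - \<i>)\<bar>" by simp
          also have "\<dots> \<le> cmod (v - \<i>)" by (rule abs_Im_le_cmod)
          also have "\<dots> < 8 / K" using elim by (simp add: dist_norm)
          finally have "K \<le> 8 / (1 - Im v)" using i1 K by (simp add: field_simps)
          then have "b\<^sup>2 \<le> (X v)\<^sup>2" using X2[of v] elim unfolding K_def by (metis add_le_cancel_right)
          then have "\<bar>b\<bar> \<le> \<bar>X v\<bar>" by (simp add: abs_le_square_iff)
          then have "b \<le> norm (X v)" by simp
          then show ?case using b elim by (simp add: \<phi>_def)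
        qed
      qed
    qed
  qed
  then obtain p where p: "real_polynomial_function p" "\<And>w. w \<in> ?S \<Longrightarrow> \<bar>\<phi> w - p w\<bar> < e"
    using Stone_Weierstrass_real_polynomial_function[of ?S \<phi> e] e by auto
  have "\<bar>f x - p (circle_pt x)\<bar> \<le> e" for x
  proof -
    have pos: "x\<^sup>2 + 4 > 0" using zero_le_power2[of x] by linarith
    have "(4 * x)\<^sup>2 + (x\<^sup>2 - 4)\<^sup>2 = (x\<^sup>2 + 4)\<^sup>2" by (simp add: power2_eq_square algebra_simps)
    then have inS: "circle_pt x \<in> ?S"
      using pos by (simp add: circle_pt_def cmod_def power_divide add_divide_distrib[symmetric])
    have im: "1 - Im (circle_pt x) = 8 / (x\<^sup>2 + 4)" using pos by (simp add: circle_pt_def field_simps)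
    have "circle_pt x \<noteq> \<i>" using im pos by auto
    moreover have "X (circle_pt x) = x" unfolding X_def im using pos by (simp add: circle_pt_def)
    ultimately have "\<phi> (circle_pt x) = f x" by (simp add: \<phi>_def)
    then show ?thesis using p(2)[OF inS] by simp
  qed
  then show "\<exists>g. cauchy_approx g \<and> (\<forall>x. \<bar>f x - g x\<bar> \<le> e)"
    using cauchy_approx_circle_polynomial[OF p(1)] by blast
qed

section \<open>The semicircle law\<close>

context
  fixes \<alpha> :: real
  assumes \<alpha>: "\<alpha> > 0"
begin

private abbreviation (input) "I \<equiv> {-2*\<alpha>..2*\<alpha>}"
private abbreviation (input) "s x \<equiv> sqrt (4 * \<alpha>\<^sup>2 - x\<^sup>2)"

lemma semicircle_density_nonneg: "semicircle_density \<alpha> x \<ge> 0"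
proof -
  have "x\<^sup>2 \<le> (2 * \<alpha>)\<^sup>2" if "x \<in> I" using that \<alpha> by (intro power2_le_iff_abs_le[THEN iffD2]) auto
  then show ?thesis using \<alpha> by (auto simp: semicircle_density_def power_mult_distrib intro!: divide_nonneg_nonneg)
qed

lemma semicircle_density_le: "semicircle_density \<alpha> x \<le> 1 / (pi * \<alpha>)"
proof -
  have "s x \<le> sqrt ((2 * \<alpha>)\<^sup>2)" by (intro real_sqrt_le_mono) (simp add: power_mult_distrib)
  also have "\<dots> = 2 * \<alpha>" using \<alpha> by (simp add: real_sqrt_mult power_mult_distrib)
  finally have "s x / (2 * pi * \<alpha>\<^sup>2) \<le> 2 * \<alpha> / (2 * pi * \<alpha>\<^sup>2)"
    by (intro divide_right_mono) auto
  also have "\<dots> = 1 / (pi * \<alpha>)" using \<alpha> by (simp add: power2_eq_square)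
  finally show ?thesis using \<alpha> by (auto simp: semicircle_density_def)
qed

lemma semicircle_density_measurable [measurable]: "semicircle_density \<alpha> \<in> borel_measurable borel"
  unfolding semicircle_density_def[abs_def] by measurable

lemma integral_semicircle:
  assumes "h \<in> borel_measurable borel"
  shows "(\<integral>x. h x \<partial>semicircle \<alpha>) = (\<integral>x. semicircle_density \<alpha> x * h x \<partial>lborel)"
  unfolding semicircle_def using assms semicircle_density_nonneg
  by (subst integral_density) auto

lemma integral_semicircle_FTC:
  fixes h :: "real \<Rightarrow> real"
  assumes cont: "continuous_on I (\<lambda>x. s x * h x)" and F: "((\<lambda>x. s x * h x) has_integral v) I"
    and h: "h \<in> borel_measurable borel"
  shows "(\<integral>x. h x \<partial>semicircle \<alpha>) = v / (2 * pi * \<alpha>\<^sup>2)"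
proof -
  have "set_integrable lborel I (\<lambda>x. s x * h x)"
    unfolding set_integrable_def by (rule borel_integrable_compact[OF compact_Icc cont])
  then have "(LINT x:I|lborel. s x * h x) = integral I (\<lambda>x. s x * h x)"
    by (rule set_borel_integral_eq_integral(2))
  also have "\<dots> = v" by (rule integral_unique[OF F])
  finally have v: "(LINT x:I|lborel. s x * h x) = v" .
  have "(\<integral>x. h x \<partial>semicircle \<alpha>) = (\<integral>x. (indicator I x *\<^sub>R (s x * h x)) / (2 * pi * \<alpha>\<^sup>2) \<partial>lborel)"
    unfolding integral_semicircle[OF h]
    by (intro Bochner_Integration.integral_cong refl) (auto simp: semicircle_density_def indicator_def)
  also have "\<dots> = (LINT x:I|lborel. s x * h x) / (2 * pi * \<alpha>\<^sup>2)"
    by (simp add: set_lebesgue_integral_def)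
  finally show ?thesis using v by simp
qed

lemma sqrt_semicircle_pos:
  assumes "-2*\<alpha> < x" "x < 2*\<alpha>"
  shows "4 * \<alpha>\<^sup>2 - x\<^sup>2 > 0"
proof -
  have "\<bar>x\<bar> < 2 * \<alpha>" using assms by auto
  then have "\<bar>x\<bar>\<^sup>2 < (2 * \<alpha>)\<^sup>2" by (intro power_strict_mono) auto
  then show ?thesis by (simp add: power_mult_distrib)
qed

section \<open>Masses of intervals under the semicircle law and its median\<close>

definition sc_primitive :: "real \<Rightarrow> real" where
  "sc_primitive x = x * s x / 2 + 2 * \<alpha>\<^sup>2 * arcsin (x / (2 * \<alpha>))"

lemma sc_primitive_ends: "sc_primitive (2*\<alpha>) = pi * \<alpha>\<^sup>2" "sc_primitive (-2*\<alpha>) = - pi * \<alpha>\<^sup>2" "sc_primitive 0 = 0"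
  using \<alpha> by (simp_all add: sc_primitive_def power_mult_distrib)

lemma sqrt_has_integral:
  assumes "-2*\<alpha> \<le> a" "a \<le> b" "b \<le> 2*\<alpha>"
  shows "(s has_integral (sc_primitive b - sc_primitive a)) {a..b}"
proof (rule fundamental_theorem_of_calculus_interior[OF assms(2)])
  have "\<forall>x\<in>{a..b}. - 1 \<le> x / (2*\<alpha>) \<and> x / (2*\<alpha>) \<le> 1"
    using assms \<alpha> by (auto simp: field_simps)
  then show "continuous_on {a..b} sc_primitive"
    unfolding sc_primitive_def by (intro continuous_intros) (use \<alpha> in auto)
  fix x assume x: "x \<in> {a<..<b}"
  then have x': "-2*\<alpha> < x" "x < 2*\<alpha>" using assms by auto
  have pos: "4 * \<alpha>\<^sup>2 - x\<^sup>2 > 0" by (rule sqrt_semicircle_pos[OF x'])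
  have b: "-1 < x / (2*\<alpha>)" "x / (2*\<alpha>) < 1" using x' \<alpha> by (auto simp: field_simps)
  have r: "sqrt (1 - (x / (2*\<alpha>))\<^sup>2) = s x / (2 * \<alpha>)"
  proof -
    have "1 - (x / (2*\<alpha>))\<^sup>2 = (4 * \<alpha>\<^sup>2 - x\<^sup>2) / (2 * \<alpha>)\<^sup>2"
      using \<alpha> by (simp add: power_divide power_mult_distrib field_simps)
    then show ?thesis using \<alpha> by (simp add: real_sqrt_divide real_sqrt_mult power_mult_distrib)
  qed
  have ss: "s x * s x = 4 * \<alpha>\<^sup>2 - x\<^sup>2" using pos by simp
  have sp: "s x > 0" using pos by simp
  have "(sc_primitive has_real_derivative
      (1 * s x + x * ((- (2 * x)) * (inverse (s x) / 2))) / 2 + 2 * \<alpha>\<^sup>2 * (inverse (sqrt (1 - (x / (2*\<alpha>))\<^sup>2)) * (1 / (2*\<alpha>)))) (at x)"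
    unfolding sc_primitive_def
    by (rule derivative_eq_intros refl | use pos b \<alpha> in \<open>force simp: field_simps\<close>)+
  also have "(1 * s x + x * ((- (2 * x)) * (inverse (s x) / 2))) / 2 + 2 * \<alpha>\<^sup>2 * (inverse (sqrt (1 - (x / (2*\<alpha>))\<^sup>2)) * (1 / (2*\<alpha>))) = (s x * s x - x\<^sup>2 + 4 * \<alpha>\<^sup>2) / (2 * s x)"
    unfolding r using sp \<alpha> by (simp add: field_simps power2_eq_square)
  also have "s x * s x - x\<^sup>2 + 4 * \<alpha>\<^sup>2 = 2 * (s x * s x)" unfolding ss by simp
  also have "2 * (s x * s x) / (2 * s x) = s x"
  proof -
    have "2 * (t * t) / (2 * t) = t" if "t > 0" for t :: real using that by simp
    then show ?thesis using sp by blast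
  qed
  finally show "(sc_primitive has_vector_derivative s x) (at x)"
    by (simp add: has_real_derivative_iff_has_vector_derivative)
qed

lemma integral_semicircle_1: "(\<integral>x. 1 \<partial>semicircle \<alpha>) = (1::real)"
proof -
  have "(\<integral>x. (1::real) \<partial>semicircle \<alpha>) = (sc_primitive (2*\<alpha>) - sc_primitive (-2*\<alpha>)) / (2 * pi * \<alpha>\<^sup>2)"
    by (rule integral_semicircle_FTC) (use sqrt_has_integral[of "-2*\<alpha>" "2*\<alpha>"] \<alpha> in \<open>auto intro!: continuous_intros\<close>)
  then show ?thesis using \<alpha> unfolding sc_primitive_ends by simp
qed

lemma integral_semicircle_density: "(\<integral>x. semicircle_density \<alpha> x \<partial>lborel) = 1"
proof -
  have "(\<integral>x. (1::real) \<partial>semicircle \<alpha>) = (\<integral>x. semicircle_density \<alpha> x * 1 \<partial>lborel)"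
    by (rule integral_semicircle) simp
  then show ?thesis using integral_semicircle_1 by (simp only: mult_1_right)
qed

lemma prob_space_semicircle: "prob_space (semicircle \<alpha>)"
proof
  have "integrable lborel (semicircle_density \<alpha>)"
    using integral_semicircle_density not_integrable_integral_eq by fastforce
  then have "(\<integral>\<^sup>+ x. ennreal (semicircle_density \<alpha> x) \<partial>lborel) = ennreal (\<integral>x. semicircle_density \<alpha> x \<partial>lborel)"
    by (intro nn_integral_eq_integral) (auto simp: semicircle_density_nonneg)
  also have "\<dots> = 1" by (simp add: integral_semicircle_density)
  finally show "emeasure (semicircle \<alpha>) (space (semicircle \<alpha>)) = 1"
    unfolding semicircle_def by (subst emeasure_density) (auto simp: semicircle_def)
qed

lemma sets_semicircle [simp, measurable_cong]: "sets (semicircle \<alpha>) = sets borel"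
  by (simp add: semicircle_def)

lemma measure_semicircle_Icc:
  assumes "-2*\<alpha> \<le> a" "a \<le> b" "b \<le> 2*\<alpha>"
  shows "measure (semicircle \<alpha>) {a..b} = (sc_primitive b - sc_primitive a) / (2 * pi * \<alpha>\<^sup>2)"
proof -
  interpret prob_space "semicircle \<alpha>" by (rule prob_space_semicircle)
  have si: "set_integrable lborel {a..b} s"
    unfolding set_integrable_def by (rule borel_integrable_compact) (auto intro!: continuous_intros)
  have "measure (semicircle \<alpha>) {a..b} = (\<integral>x. indicator {a..b} x \<partial>semicircle \<alpha>)"
    by simp
  also have "\<dots> = (\<integral>x. (indicator {a..b} x *\<^sub>R s x) / (2 * pi * \<alpha>\<^sup>2) \<partial>lborel)"
    by (subst integral_semicircle, simp, intro Bochner_Integration.integral_cong refl)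
       (use assms in \<open>auto simp: semicircle_density_def indicator_def\<close>)
  also have "\<dots> = (LINT x:{a..b}|lborel. s x) / (2 * pi * \<alpha>\<^sup>2)"
    by (simp add: set_lebesgue_integral_def)
  also have "(LINT x:{a..b}|lborel. s x) = integral {a..b} s"
    by (rule set_borel_integral_eq_integral(2)[OF si])
  also have "\<dots> = sc_primitive b - sc_primitive a"
    by (rule integral_unique[OF sqrt_has_integral[OF assms]])
  finally show ?thesis .
qed

lemma measure_semicircle_le:
  assumes "a \<le> b"
  shows "measure (semicircle \<alpha>) {a..b} \<le> (b - a) / (pi * \<alpha>)"
proof -
  interpret prob_space "semicircle \<alpha>" by (rule prob_space_semicircle)
  have "emeasure (semicircle \<alpha>) {a..b} = (\<integral>\<^sup>+ x. ennreal (semicircle_density \<alpha> x) * indicator {a..b} x \<partial>lborel)"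
    unfolding semicircle_def by (rule emeasure_density) auto
  also have "\<dots> \<le> (\<integral>\<^sup>+ x. ennreal (1 / (pi * \<alpha>)) * indicator {a..b} x \<partial>lborel)"
    by (intro nn_integral_mono mult_right_mono ennreal_leI semicircle_density_le) auto
  also have "\<dots> = ennreal ((b - a) / (pi * \<alpha>))"
    using assms \<alpha> by (simp add: nn_integral_cmult ennreal_mult'[symmetric])
  finally show ?thesis using assms \<alpha> by (simp add: emeasure_eq_measure ennreal_le_iff)
qed

lemma measure_semicircle_singleton: "measure (semicircle \<alpha>) {a} = 0"
  using measure_semicircle_le[of a a] measure_nonneg[of "semicircle \<alpha>" "{a}"] by simp

lemma measure_semicircle_outside:
  assumes "A \<in> sets borel" "A \<inter> I = {}"
  shows "measure (semicircle \<alpha>) A = 0"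
proof -
  have "emeasure (semicircle \<alpha>) A = (\<integral>\<^sup>+ x. ennreal (semicircle_density \<alpha> x) * indicator A x \<partial>lborel)"
    unfolding semicircle_def using assms by (intro emeasure_density) auto
  also have "\<dots> = (\<integral>\<^sup>+ (x::real). 0 \<partial>lborel)"
    using assms by (intro nn_integral_cong) (auto simp: semicircle_density_def indicator_def)
  finally show ?thesis by (simp add: measure_def)
qed

text \<open>The primitive is odd and positive to the right of 0, so any interval reaching past 0
  carries more than half of the mass. The strict inequality leaves room for the error when
  eigenvalues are counted.\<close>

lemma semicircle_median:
  assumes "0 < t"
  shows "measure (semicircle \<alpha>) {..<t} > 1/2" "measure (semicircle \<alpha>) {-t<..} > 1/2"
proof -
  interpret prob_space "semicircle \<alpha>" by (rule prob_space_semicircle)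
  \<comment> \<open>A point strictly between 0 and \<open>t\<close> that also lies inside the
    support, where the primitive is valid.\<close>
  define r where "r = min (t / 2) \<alpha>"
  have r: "0 < r" "r < t" "r < 2 * \<alpha>" using assms \<alpha> by (auto simp: r_def)
  have "s r > 0" using sqrt_semicircle_pos[of r] r \<alpha> by simp
  then have sr: "r * s r / 2 > 0" using r by simp
  have "0 < arcsin (r / (2*\<alpha>))"
    using arcsin_less_mono[of 0 "r / (2*\<alpha>)"] r \<alpha> by simp
  then have pr: "sc_primitive r > 0" using sr \<alpha> by (simp add: sc_primitive_def add_pos_pos)
  have npr: "sc_primitive (- r) = - sc_primitive r"
  proof -
    have "-1 \<le> r / (2*\<alpha>)" "r / (2*\<alpha>) \<le> 1"
      using r \<alpha> order.trans[OF _ divide_nonneg_pos[of r "2 * \<alpha>"], of "-1"] by (auto simp: divide_le_eq)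
    from arcsin_minus[OF this] show ?thesis by (simp add: sc_primitive_def)
  qed
  have "1/2 < (sc_primitive r - sc_primitive (-2*\<alpha>)) / (2 * pi * \<alpha>\<^sup>2)"
    using pr \<alpha> unfolding sc_primitive_ends by (simp add: field_simps)
  also have "\<dots> = measure (semicircle \<alpha>) {-2*\<alpha>..r}"
    by (rule measure_semicircle_Icc[symmetric]) (use r in auto)
  also have "\<dots> \<le> measure (semicircle \<alpha>) {..<t}" using r by (intro finite_measure_mono) auto
  finally show "measure (semicircle \<alpha>) {..<t} > 1/2" .
  have "1/2 < (sc_primitive (2*\<alpha>) - sc_primitive (-r)) / (2 * pi * \<alpha>\<^sup>2)"
    using pr \<alpha> unfolding sc_primitive_ends npr by (simp add: field_simps)
  also have "\<dots> = measure (semicircle \<alpha>) {-r..2*\<alpha>}"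
    by (rule measure_semicircle_Icc[symmetric]) (use r in auto)
  also have "\<dots> \<le> measure (semicircle \<alpha>) {-t<..}" using r by (intro finite_measure_mono) auto
  finally show "measure (semicircle \<alpha>) {-t<..} > 1/2" .
qed

text \<open>The product of x and the square root has primitive - s^3 / 3, applied on each side of 0.
  At scale 1 the value is the constant whose square, 64 / (9 pi^2), is subtracted in the final
  variance.\<close>

lemma integral_semicircle_abs: "(\<integral>x. \<bar>x\<bar> \<partial>semicircle \<alpha>) = 8 * \<alpha> / (3 * pi)"
proof -
  have d: "((\<lambda>x. (s x)^3 / 3) has_vector_derivative - (s x * x)) (at x)" if "-2*\<alpha> < x" "x < 2*\<alpha>" for x
  proof -
    have pos: "4 * \<alpha>\<^sup>2 - x\<^sup>2 > 0" by (rule sqrt_semicircle_pos[OF that])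
    have "((\<lambda>x. (s x)^3 / 3) has_real_derivative (3 * (s x)^2 * ((- (2 * x)) * (inverse (s x) / 2))) / 3) (at x)"
      by (rule derivative_eq_intros refl | use pos in \<open>force simp: field_simps\<close>)+
    also have "(3 * (s x)^2 * ((- (2 * x)) * (inverse (s x) / 2))) / 3 = - (s x * x)"
    proof -
      have "(3 * t^2 * ((- (2 * x)) * (inverse t / 2))) / 3 = - (t * x)" if "t > 0" for t :: real
        using that by (simp add: field_simps power2_eq_square)
      then show ?thesis using pos by (simp only: real_sqrt_gt_0_iff)
    qed
    finally show ?thesis by (simp add: has_real_derivative_iff_has_vector_derivative)
  qed
  have s3: "(s 0)^3 = 8 * \<alpha>^3" "s (2*\<alpha>) = 0" "s (-2*\<alpha>) = 0"
    using \<alpha> by (simp_all add: real_sqrt_mult power_mult_distrib)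
  have "((\<lambda>x. - (s x * x)) has_integral (s 0)^3 / 3 - (s (-2*\<alpha>))^3 / 3) {-2*\<alpha>..0}"
    by (rule fundamental_theorem_of_calculus_interior) (use d \<alpha> in \<open>auto intro!: continuous_intros\<close>)
  moreover have "(s 0)^3 / 3 - (s (-2*\<alpha>))^3 / 3 = 8 * \<alpha>^3 / 3" unfolding s3 by simp
  ultimately have "((\<lambda>x. - (s x * x)) has_integral 8 * \<alpha>^3 / 3) {-2*\<alpha>..0}" by (simp only:)
  then have 1: "((\<lambda>x. s x * \<bar>x\<bar>) has_integral 8 * \<alpha>^3 / 3) {-2*\<alpha>..0}"
    by (rule has_integral_eq[rotated]) auto
  have "((\<lambda>x. - (s x * x)) has_integral (s (2*\<alpha>))^3 / 3 - (s 0)^3 / 3) {0..2*\<alpha>}"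
    by (rule fundamental_theorem_of_calculus_interior) (use d \<alpha> in \<open>auto intro!: continuous_intros\<close>)
  from has_integral_neg[OF this]
  have "((\<lambda>x. - (- (s x * x))) has_integral - ((s (2*\<alpha>))^3 / 3 - (s 0)^3 / 3)) {0..2*\<alpha>}" .
  moreover have "- ((s (2*\<alpha>))^3 / 3 - (s 0)^3 / 3) = 8 * \<alpha>^3 / 3" unfolding s3 by simp
  ultimately have "((\<lambda>x. - (- (s x * x))) has_integral 8 * \<alpha>^3 / 3) {0..2*\<alpha>}" by (simp only:)
  then have 2: "((\<lambda>x. s x * \<bar>x\<bar>) has_integral 8 * \<alpha>^3 / 3) {0..2*\<alpha>}"
    by (rule has_integral_eq[rotated]) auto
  have "((\<lambda>x. s x * \<bar>x\<bar>) has_integral (8 * \<alpha>^3 / 3 + 8 * \<alpha>^3 / 3)) I"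
    by (rule has_integral_combine[OF _ _ 1 2]) (use \<alpha> in auto)
  then have "(\<integral>x. \<bar>x\<bar> \<partial>semicircle \<alpha>) = (8 * \<alpha>^3 / 3 + 8 * \<alpha>^3 / 3) / (2 * pi * \<alpha>\<^sup>2)"
    by (intro integral_semicircle_FTC) (auto intro!: continuous_intros)
  then show ?thesis using \<alpha> by (simp add: power2_eq_square power3_eq_cube field_simps)
qed

section \<open>Integrals of the Cauchy kernels against the semicircle law\<close>

lemma integral_semicircle_odd:
  assumes h: "h \<in> borel_measurable borel" and odd: "\<And>x. h (- x) = - h x"
  shows "(\<integral>x. h x \<partial>semicircle \<alpha>) = (0::real)"
proof -
  have "(\<integral>x. semicircle_density \<alpha> x * h x \<partial>lborel) = (\<integral>x. semicircle_density \<alpha> (0 + (-1) * x) * h (0 + (-1) * x) \<partial>lborel)"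
    by (subst lborel_integral_real_affine[where c = "-1" and t = 0]) auto
  also have "\<dots> = - (\<integral>x. semicircle_density \<alpha> x * h x \<partial>lborel)"
    by (subst Bochner_Integration.integral_minus[symmetric], intro Bochner_Integration.integral_cong refl) 
       (auto simp: odd semicircle_density_def)
  finally show ?thesis using integral_semicircle[OF h] by simp
qed

lemma integral_semicircle_re: "(\<integral>x. x / (x\<^sup>2 + q\<^sup>2) \<partial>semicircle \<alpha>) = (0::real)"
  by (rule integral_semicircle_odd) auto

text \<open>The substitution \<open>arctan t = arcsin (t / sqrt (1 + t\<^sup>2))\<close> makes the primitive continuous at the
  end points of the support.\<close>

lemma integral_semicircle_im:
  assumes q: "q > 0"
  shows "(\<integral>x. 1 / (x\<^sup>2 + q\<^sup>2) \<partial>semicircle \<alpha>) = sc_stieltjes \<alpha> q / q"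
proof -
  define c where "c = sqrt (q\<^sup>2 + 4 * \<alpha>\<^sup>2)"
  define w where "w x = sqrt (x\<^sup>2 + q\<^sup>2)" for x
  define u where "u x = c * x / (2 * \<alpha> * w x)" for x
  define F where "F x = c / q * arcsin (u x) - arcsin (x / (2 * \<alpha>))" for x
  have c: "c > 0" "c\<^sup>2 = q\<^sup>2 + 4 * \<alpha>\<^sup>2" using q by (auto simp: c_def add_pos_nonneg)
  have w: "w x > 0" "(w x)\<^sup>2 = x\<^sup>2 + q\<^sup>2" for x using q by (auto simp: w_def add_nonneg_pos)
  have u2: "1 - (u x)\<^sup>2 = q\<^sup>2 * (4 * \<alpha>\<^sup>2 - x\<^sup>2) / (2 * \<alpha> * w x)\<^sup>2" for x
  proof -
    have "1 - (u x)\<^sup>2 = ((2 * \<alpha>)\<^sup>2 * (w x)\<^sup>2 - c\<^sup>2 * x\<^sup>2) / (2 * \<alpha> * w x)\<^sup>2"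
      using \<alpha> w(1)[of x] by (simp add: u_def power_divide power_mult_distrib field_simps)
    also have "(2 * \<alpha>)\<^sup>2 * (w x)\<^sup>2 - c\<^sup>2 * x\<^sup>2 = q\<^sup>2 * (4 * \<alpha>\<^sup>2 - x\<^sup>2)"
      unfolding w(2) c(2) by (simp add: algebra_simps power_mult_distrib)
    finally show ?thesis .
  qed
  have u_le: "\<bar>u x\<bar> \<le> 1" if "x \<in> I" for x
  proof -
    have "x\<^sup>2 \<le> (2 * \<alpha>)\<^sup>2" using that \<alpha> by (intro power2_le_iff_abs_le[THEN iffD2]) auto
    then have "0 \<le> 1 - (u x)\<^sup>2" unfolding u2 by (intro divide_nonneg_nonneg mult_nonneg_nonneg) (auto simp: power_mult_distrib)
    then show ?thesis by (simp add: abs_square_le_1[symmetric])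
  qed
  have F: "((\<lambda>x. s x * (1 / (x\<^sup>2 + q\<^sup>2))) has_integral (F (2*\<alpha>) - F (-2*\<alpha>))) I"
  proof (rule fundamental_theorem_of_calculus_interior)
    have "continuous_on I w" unfolding w_def by (intro continuous_intros)
    then have "continuous_on I u" unfolding u_def using w(1) \<alpha> by (intro continuous_intros) (auto simp: less_imp_neq[symmetric])
    then show "continuous_on I F" unfolding F_def using u_le \<alpha>
      by (intro continuous_intros) (auto simp: abs_le_iff field_simps)
  next
    fix x assume "x \<in> {-2*\<alpha><..<2*\<alpha>}"
    then have x: "-2*\<alpha> < x" "x < 2*\<alpha>" by auto
    have pos: "4 * \<alpha>\<^sup>2 - x\<^sup>2 > 0" by (rule sqrt_semicircle_pos[OF x])
    have sp: "s x > 0" "s x * s x = 4 * \<alpha>\<^sup>2 - x\<^sup>2" using pos by auto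
    have b: "-1 < x / (2*\<alpha>)" "x / (2*\<alpha>) < 1" using x \<alpha> by (auto simp: field_simps)
    have "0 < 1 - (u x)\<^sup>2" unfolding u2 using pos q \<alpha> w(1)[of x] by simp
    then have "\<bar>u x\<bar> < 1" by (simp add: abs_square_less_1[symmetric])
    then have ub: "-1 < u x" "u x < 1" by auto
    have r: "sqrt (1 - (x / (2*\<alpha>))\<^sup>2) = s x / (2 * \<alpha>)"
    proof -
      have "1 - (x / (2*\<alpha>))\<^sup>2 = (4 * \<alpha>\<^sup>2 - x\<^sup>2) / (2 * \<alpha>)\<^sup>2"
        using \<alpha> by (simp add: power_divide power_mult_distrib field_simps)
      then show ?thesis using \<alpha> by (simp add: real_sqrt_divide real_sqrt_mult power_mult_distrib)
    qed
    have ru: "sqrt (1 - (u x)\<^sup>2) = q * s x / (2 * \<alpha> * w x)"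
      unfolding u2 using q \<alpha> w(1)[of x] by (simp add: real_sqrt_divide real_sqrt_mult)
    have dw: "(w has_real_derivative x / w x) (at x)"
    proof -
      have "x\<^sup>2 + q\<^sup>2 > 0" using q by (simp add: add_nonneg_pos)
      then have "(w has_real_derivative (2 * x) * (inverse (w x) / 2)) (at x)"
        unfolding w_def by (auto intro!: derivative_eq_intros)
      moreover have "(2 * x) * (inverse (w x) / 2) = x / w x" by (simp add: inverse_eq_divide)
      ultimately show ?thesis by (simp only:)
    qed
    have du: "(u has_real_derivative c * q\<^sup>2 / (2 * \<alpha> * (w x)^3)) (at x)"
    proof -
      have "(u has_real_derivative (c * (2 * \<alpha> * w x) - c * x * (2 * \<alpha> * (x / w x))) / ((2 * \<alpha> * w x) * (2 * \<alpha> * w x))) (at x)"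
        unfolding u_def using \<alpha> w(1)[of x] by (auto intro!: derivative_eq_intros dw)
      also have "(c * (2 * \<alpha> * w x) - c * x * (2 * \<alpha> * (x / w x))) / ((2 * \<alpha> * w x) * (2 * \<alpha> * w x)) = c * ((w x)\<^sup>2 - x\<^sup>2) / (2 * \<alpha> * (w x)^3)"
        using \<alpha> w(1)[of x] by (simp add: field_simps power2_eq_square power3_eq_cube)
      finally show ?thesis by (simp add: w(2))
    qed
    have "(F has_real_derivative c / q * (inverse (sqrt (1 - (u x)\<^sup>2)) * (c * q\<^sup>2 / (2 * \<alpha> * (w x)^3))) - inverse (sqrt (1 - (x / (2*\<alpha>))\<^sup>2)) * (1 / (2*\<alpha>))) (at x)"
    proof -
      have "((\<lambda>x. x / (2*\<alpha>)) has_real_derivative 1 / (2*\<alpha>)) (at x)"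
        using \<alpha> by (auto intro!: derivative_eq_intros)
      from DERIV_diff[OF DERIV_cmult[OF DERIV_chain2[OF DERIV_arcsin[OF ub] du], of "c / q"] DERIV_chain2[OF DERIV_arcsin[OF b] this]]
      show ?thesis unfolding F_def .
    qed
    also have "c / q * (inverse (sqrt (1 - (u x)\<^sup>2)) * (c * q\<^sup>2 / (2 * \<alpha> * (w x)^3))) - inverse (sqrt (1 - (x / (2*\<alpha>))\<^sup>2)) * (1 / (2*\<alpha>))
       = c\<^sup>2 / (s x * (w x)\<^sup>2) - 1 / s x"
      unfolding r ru using q \<alpha> w(1)[of x] sp(1) by (simp add: field_simps power2_eq_square power3_eq_cube)
    also have "\<dots> = (c\<^sup>2 - (w x)\<^sup>2) / (s x * (w x)\<^sup>2)"
      using w(1)[of x] sp(1) by (simp add: diff_divide_distrib)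
    also have "c\<^sup>2 - (w x)\<^sup>2 = s x * s x" unfolding sp(2) c(2) w(2) by simp
    also have "s x * s x / (s x * (w x)\<^sup>2) = s x * (1 / (x\<^sup>2 + q\<^sup>2))"
    proof -
      have "t * t / (t * v) = t * (1 / v)" if "t > 0" for t v :: real using that by simp
      then show ?thesis unfolding w(2) using sp(1) by blast
    qed
    finally show "(F has_vector_derivative s x * (1 / (x\<^sup>2 + q\<^sup>2))) (at x)"
      by (simp add: has_real_derivative_iff_has_vector_derivative)
  qed (use \<alpha> in auto)
  have w2: "w (2*\<alpha>) = c" "w (-2*\<alpha>) = c" by (simp_all add: w_def c_def power_mult_distrib add.commute)
  have "u (2*\<alpha>) = 1" "u (-2*\<alpha>) = -1" using \<alpha> c(1) unfolding u_def w2 by simp_all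
  then have "F (2*\<alpha>) - F (-2*\<alpha>) = pi * (c / q - 1)"
    using \<alpha> by (simp add: F_def right_diff_distrib)
  moreover have "x\<^sup>2 + q\<^sup>2 \<noteq> 0" for x using q zero_le_power2[of x] by (metis add_nonneg_eq_0_iff less_irrefl zero_le_power2 power_eq_0_iff)
  ultimately have "(\<integral>x. 1 / (x\<^sup>2 + q\<^sup>2) \<partial>semicircle \<alpha>) = pi * (c / q - 1) / (2 * pi * \<alpha>\<^sup>2)"
    using F by (intro integral_semicircle_FTC) (auto intro!: continuous_intros)
  also have "\<dots> = (c / q - 1) / (2 * \<alpha>\<^sup>2)" by simp
  also have "\<dots> = sc_stieltjes \<alpha> q / q"
    using q \<alpha> by (simp add: sc_stieltjes_def c_def[symmetric] field_simps)
  finally show ?thesis .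
qed

end

section \<open>Spectral functions along a sequence of matrices\<close>

definition spec_fun :: "nat \<Rightarrow> (nat \<Rightarrow> nat \<Rightarrow> real) \<Rightarrow> (real \<Rightarrow> real) \<Rightarrow> nat \<Rightarrow> nat \<Rightarrow> real" where
  "spec_fun n A h i j = (let (lam, u) = some_decomp n A in \<Sum>k<n. u k i * u k j * h (lam k))"

abbreviation eigval :: "nat \<Rightarrow> (nat \<Rightarrow> nat \<Rightarrow> real) \<Rightarrow> nat \<Rightarrow> real" where
  "eigval n A \<equiv> fst (some_decomp n A)"

abbreviation eigvec :: "nat \<Rightarrow> (nat \<Rightarrow> nat \<Rightarrow> real) \<Rightarrow> nat \<Rightarrow> nat \<Rightarrow> real" where
  "eigvec n A \<equiv> snd (some_decomp n A)"

lemma spec_fun_eq: "spec_fun n A h i j = (\<Sum>k<n. eigvec n A k i * eigvec n A k j * h (eigval n A k))"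
  by (simp add: spec_fun_def split_beta)

lemma spec_fun_add: "spec_fun n A (\<lambda>x. f x + h x) i j = spec_fun n A f i j + spec_fun n A h i j"
  by (simp add: spec_fun_eq distrib_left sum.distrib)

lemma spec_fun_diff: "spec_fun n A (\<lambda>x. f x - h x) i j = spec_fun n A f i j - spec_fun n A h i j"
  by (simp add: spec_fun_eq right_diff_distrib sum_subtractf)

lemma spec_fun_scale: "spec_fun n A (\<lambda>x. c * f x) i j = c * spec_fun n A f i j"
  by (simp add: spec_fun_eq sum_distrib_left mult_ac)

context
  fixes n :: nat and g :: "nat \<times> nat \<Rightarrow> real"
begin

private abbreviation (input) "A \<equiv> sym_mat g"
private abbreviation (input) "lam \<equiv> eigval n A"
private abbreviation (input) "u \<equiv> eigvec n A"

lemma eigvec_orthonormal: "k < n \<Longrightarrow> l < n \<Longrightarrow> (\<Sum>i<n. u k i * u l i) = (if k = l then 1 else 0)"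
  using some_decomp_sym_mat[of n g] by (simp add: spectral_decomp_def)

lemma eigvec_complete: "i < n \<Longrightarrow> j < n \<Longrightarrow> (\<Sum>k<n. u k i * u k j) = (if i = j then 1 else 0)"
  by (rule orthonormal_complete[OF eigvec_orthonormal])

lemma eigval_mono: "k \<le> l \<Longrightarrow> l < n \<Longrightarrow> lam l \<le> lam k"
  using some_decomp_sym_mat[of n g] by (simp add: spectral_decomp_def)

lemma spec_fun_const: "i < n \<Longrightarrow> j < n \<Longrightarrow> spec_fun n A (\<lambda>_. c) i j = (if i = j then c else 0)"
  using eigvec_complete[of i j] by (simp add: spec_fun_eq sum_distrib_right[symmetric])

text \<open>The inequality 2 |a b| <= a^2 + b^2 reduces off-diagonal sums to diagonal ones. The
  weights are arbitrary and not of the form h (eigenvalue), because \<open>half_sign\<close> depends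
  on the position of an eigenvalue and not just on its value.\<close>

lemma eigvec_sum_abs_le:
  "\<bar>\<Sum>k<n. u k i * u k j * c k\<bar> \<le> ((\<Sum>k<n. u k i * u k i * \<bar>c k\<bar>) + (\<Sum>k<n. u k j * u k j * \<bar>c k\<bar>)) / 2"
proof -
  have "\<bar>\<Sum>k<n. u k i * u k j * c k\<bar> \<le> (\<Sum>k<n. \<bar>u k i * u k j * c k\<bar>)"
    by (rule sum_abs)
  also have "\<dots> \<le> (\<Sum>k<n. (u k i * u k i * \<bar>c k\<bar> + u k j * u k j * \<bar>c k\<bar>) / 2)"
  proof (rule sum_mono)
    fix k
    have "0 \<le> (\<bar>u k i\<bar> - \<bar>u k j\<bar>)\<^sup>2" by simp
    then have "\<bar>u k i\<bar> * \<bar>u k j\<bar> \<le> (u k i * u k i + u k j * u k j) / 2"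
      by (simp add: power2_diff) (simp add: power2_eq_square)
    from mult_right_mono[OF this, of "\<bar>c k\<bar>"]
    show "\<bar>u k i * u k j * c k\<bar> \<le> (u k i * u k i * \<bar>c k\<bar> + u k j * u k j * \<bar>c k\<bar>) / 2"
      by (simp add: abs_mult distrib_right)
  qed
  finally show ?thesis by (simp add: sum.distrib sum_divide_distrib[symmetric])
qed

lemma spec_fun_abs_le:
  "\<bar>spec_fun n A h i j\<bar> \<le> (spec_fun n A (\<lambda>x. \<bar>h x\<bar>) i i + spec_fun n A (\<lambda>x. \<bar>h x\<bar>) j j) / 2"
  unfolding spec_fun_eq by (rule eigvec_sum_abs_le)

lemma spec_fun_diag_mono:
  assumes "\<And>k. k < n \<Longrightarrow> f (lam k) \<le> h (lam k)"
  shows "spec_fun n A f i i \<le> spec_fun n A h i i"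
  unfolding spec_fun_eq by (intro sum_mono mult_left_mono assms) auto

lemma spec_fun_bounded:
  assumes "i < n" "j < n" "\<And>k. k < n \<Longrightarrow> \<bar>h (lam k)\<bar> \<le> B"
  shows "\<bar>spec_fun n A h i j\<bar> \<le> B"
proof -
  have "spec_fun n A (\<lambda>x. \<bar>h x\<bar>) l l \<le> B" if "l < n" for l
    using spec_fun_diag_mono[of "\<lambda>x. \<bar>h x\<bar>" "\<lambda>_. B" l] assms(3) spec_fun_const[OF that that, of B] by simp
  from this[OF assms(1)] this[OF assms(2)] show ?thesis
    using spec_fun_abs_le[of h i j] by simp
qed

text \<open>The squared norm of row \<open>i\<close> of a matrix with these eigenvectors is the
  diagonal entry of its square. Weights with equal squares, such as \<open>eigval\<close> and
  \<open>half_sign\<close>, therefore give equal row norms.\<close>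

lemma eigvec_sum_square:
  "(\<Sum>j<n. (\<Sum>k<n. u k i * u k j * c k)\<^sup>2) = (\<Sum>k<n. u k i * u k i * (c k)\<^sup>2)"
proof -
  have "(\<Sum>j<n. (\<Sum>k<n. u k i * u k j * c k)\<^sup>2) = (\<Sum>j<n. \<Sum>k<n. \<Sum>l<n. (u k i * c k) * (u l i * c l) * (u k j * u l j))"
    by (simp add: power2_eq_square sum_product mult_ac)
  also have "\<dots> = (\<Sum>k<n. \<Sum>l<n. (u k i * c k) * (u l i * c l) * (\<Sum>j<n. u k j * u l j))"
    by (subst sum.swap, rule sum.cong[OF refl], subst sum.swap, simp add: sum_distrib_left)
  also have "\<dots> = (\<Sum>k<n. \<Sum>l<n. if l = k then (u k i * c k) * (u k i * c k) else 0)"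
    by (intro sum.cong refl) (auto simp: eigvec_orthonormal)
  finally show ?thesis by (simp add: power2_eq_square mult_ac)
qed

lemma spec_fun_id: "i < n \<Longrightarrow> j < n \<Longrightarrow> spec_fun n A (\<lambda>x. x) i j = A i j"
  using some_decomp_sym_mat[of n g] by (simp add: spectral_decomp_def spec_fun_eq mult_ac)

lemma sum_spec_fun_diag: "(\<Sum>i<n. spec_fun n A h i i) = (\<Sum>k<n. h (lam k))"
proof -
  have "(\<Sum>i<n. spec_fun n A h i i) = (\<Sum>k<n. (\<Sum>i<n. u k i * u k i) * h (lam k))"
    unfolding spec_fun_eq sum_distrib_right by (rule sum.swap)
  then show ?thesis by (simp add: eigvec_orthonormal)
qed

lemma res_eq_spec_fun:
  assumes "q > 0"
  shows "res n A (Complex 0 q) i j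
    = Complex (spec_fun n A (\<lambda>x. x / (x\<^sup>2 + q\<^sup>2)) i j) (q * spec_fun n A (\<lambda>x. 1 / (x\<^sup>2 + q\<^sup>2)) i j)"
proof -
  have "of_real r / (of_real x - Complex 0 q) = Complex (r * (x / (x\<^sup>2 + q\<^sup>2))) (q * (r * (1 / (x\<^sup>2 + q\<^sup>2))))" for r x
    by (simp add: complex_eq_iff Re_divide Im_divide)
  then show ?thesis
    unfolding res_def spec_fun_eq split_beta Let_def
    by (simp add: complex_eq_iff Re_sum Im_sum sum_distrib_left del: of_real_mult)
qed

end

lemma cauchy_span_measurable: "h \<in> cauchy_span \<Longrightarrow> h \<in> borel_measurable borel"
proof (induction rule: cauchy_span.induct)
  case (add f h)
  show ?case by (rule borel_measurable_add[OF add.IH])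
next
  case (scale f c)
  show ?case by (rule borel_measurable_times[OF borel_measurable_const scale.IH])
qed measurable

lemma integrable_semicircle_bounded:
  fixes h :: "real \<Rightarrow> real"
  assumes "\<alpha> > 0" "h \<in> borel_measurable borel" "\<And>x. \<bar>h x\<bar> \<le> B"
  shows "integrable (semicircle \<alpha>) h"
proof -
  interpret prob_space "semicircle \<alpha>" by (rule prob_space_semicircle[OF assms(1)])
  have "h \<in> borel_measurable (semicircle \<alpha>)" using assms(2) by (simp add: semicircle_def)
  then show ?thesis by (rule integrable_const_bound[where B = B, rotated]) (use assms(3) in auto)
qed

text \<open>A deterministic sequence of matrices: randomness has been removed by fixing a
  realisation. It is used with scale 1 for X and with the final scale for a fixed choice of
  signs.\<close>

locale mat_seq =
  fixes N :: "nat \<Rightarrow> nat" and g :: "nat \<Rightarrow> nat \<times> nat \<Rightarrow> real" and \<alpha> :: real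
  assumes N: "\<forall>\<^sub>F m in sequentially. N m > 0" and \<alpha>: "\<alpha> > 0"
begin

abbreviation (input) "A m \<equiv> sym_mat (g m)"

definition diag_dev :: "(real \<Rightarrow> real) \<Rightarrow> nat \<Rightarrow> real" where
  "diag_dev h m = (\<Sum>i<N m. \<bar>spec_fun (N m) (A m) h i i - (\<integral>x. h x \<partial>semicircle \<alpha>)\<bar>) / N m"

text \<open>Uniform over all pairs, in contrast to the averaged \<open>diag_dev\<close>, since the
  estimate for the sign matrix requires a bound on the largest entry of its variance
  profile.\<close>

definition offdiag_small :: "(real \<Rightarrow> real) \<Rightarrow> bool" where
  "offdiag_small h \<longleftrightarrow> (\<forall>e>0. \<forall>\<^sub>F m in sequentially. \<forall>i<N m. \<forall>j<N m. i \<noteq> j \<longrightarrow> \<bar>spec_fun (N m) (A m) h i j\<bar> \<le> e)"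

lemma diag_dev_nonneg: "diag_dev h m \<ge> 0"
  unfolding diag_dev_def by (intro divide_nonneg_nonneg sum_nonneg) auto

lemma diag_dev_tendsto_0I:
  assumes "F \<longlonglongrightarrow> 0" "\<forall>\<^sub>F m in sequentially. diag_dev h m \<le> F m"
  shows "diag_dev h \<longlonglongrightarrow> 0"
  by (rule tendsto_sandwich[OF _ assms(2) tendsto_const assms(1)]) (use diag_dev_nonneg in auto)

lemma diag_dev_cauchy_span:
  assumes conv: "\<And>q. q \<in> \<rat> \<Longrightarrow> q \<ge> 2 \<Longrightarrow> (\<lambda>m. res_dev (N m) (g m) \<alpha> q) \<longlonglongrightarrow> 0"
    and h: "h \<in> cauchy_span"
  shows "diag_dev h \<longlonglongrightarrow> 0"
  using h
proof induction
  case (const c)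
  interpret prob_space "semicircle \<alpha>" by (rule prob_space_semicircle[OF \<alpha>])
  have "diag_dev (\<lambda>_. c) m = 0" for m
    by (simp add: diag_dev_def spec_fun_const prob_space)
  then show ?case by simp
next
  case (re q)
  then have q: "q > 0" "q \<ge> 2" by auto
  show ?case
  proof (rule diag_dev_tendsto_0I[OF conv[OF re]], rule always_eventually, rule allI)
    fix m
    show "diag_dev (\<lambda>x. x / (x\<^sup>2 + q\<^sup>2)) m \<le> res_dev (N m) (g m) \<alpha> q"
      unfolding diag_dev_def res_dev_def integral_semicircle_re[OF \<alpha>]
    proof (intro divide_right_mono sum_mono)
      fix i
      show "\<bar>spec_fun (N m) (A m) (\<lambda>x. x / (x\<^sup>2 + q\<^sup>2)) i i - 0\<bar>
         \<le> cmod (res (N m) (A m) (Complex 0 q) i i - Complex 0 (sc_stieltjes \<alpha> q))"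
        using abs_Re_le_cmod[of "res (N m) (A m) (Complex 0 q) i i - Complex 0 (sc_stieltjes \<alpha> q)"]
        by (simp add: res_eq_spec_fun[OF q(1)])
    qed auto
  qed
next
  case (im q)
  then have q: "q > 0" "q \<ge> 2" by auto
  show ?case
  proof (rule diag_dev_tendsto_0I[OF conv[OF im]], rule always_eventually, rule allI)
    fix m
    show "diag_dev (\<lambda>x. 1 / (x\<^sup>2 + q\<^sup>2)) m \<le> res_dev (N m) (g m) \<alpha> q"
      unfolding diag_dev_def res_dev_def integral_semicircle_im[OF \<alpha> q(1)]
    proof (intro divide_right_mono sum_mono)
      fix i
      let ?s = "spec_fun (N m) (A m) (\<lambda>x. 1 / (x\<^sup>2 + q\<^sup>2)) i i"
      have "\<bar>?s - sc_stieltjes \<alpha> q / q\<bar> \<le> \<bar>?s - sc_stieltjes \<alpha> q / q\<bar> * q"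
        using mult_left_mono[of 1 q "\<bar>?s - sc_stieltjes \<alpha> q / q\<bar>"] q by simp
      also have "\<dots> = \<bar>q * ?s - sc_stieltjes \<alpha> q\<bar>"
      proof -
        have "q * ?s - sc_stieltjes \<alpha> q = (?s - sc_stieltjes \<alpha> q / q) * q" using q by (simp add: field_simps)
        then show ?thesis using q by (simp only: abs_mult)
      qed
      also have "\<dots> \<le> cmod (res (N m) (A m) (Complex 0 q) i i - Complex 0 (sc_stieltjes \<alpha> q))"
        using abs_Im_le_cmod[of "res (N m) (A m) (Complex 0 q) i i - Complex 0 (sc_stieltjes \<alpha> q)"]
        by (simp add: res_eq_spec_fun[OF q(1)])
      finally show "\<bar>?s - sc_stieltjes \<alpha> q / q\<bar> \<le> cmod (res (N m) (A m) (Complex 0 q) i i - Complex 0 (sc_stieltjes \<alpha> q))" .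
    qed auto
  qed
next
  case (add f h)
  have int: "integrable (semicircle \<alpha>) k" if "k \<in> cauchy_span" for k
    using cauchy_span_bounded[OF that] cauchy_span_measurable[OF that] integrable_semicircle_bounded[OF \<alpha>] by blast
  show ?case
  proof (rule diag_dev_tendsto_0I[where F = "\<lambda>m. diag_dev f m + diag_dev h m"])
    show "(\<lambda>m. diag_dev f m + diag_dev h m) \<longlonglongrightarrow> 0" using tendsto_add[OF add.IH] by simp
    have "diag_dev (\<lambda>x. f x + h x) m \<le> diag_dev f m + diag_dev h m" for m
      unfolding diag_dev_def add_divide_distrib[symmetric] sum.distrib[symmetric]
      by (intro divide_right_mono sum_mono) (simp_all add: spec_fun_add int add.hyps)
    then show "\<forall>\<^sub>F m in sequentially. diag_dev (\<lambda>x. f x + h x) m \<le> diag_dev f m + diag_dev h m" by simp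
  qed
next
  case (scale f c)
  have "diag_dev (\<lambda>x. c * f x) m = \<bar>c\<bar> * diag_dev f m" for m
    unfolding diag_dev_def by (simp add: spec_fun_scale right_diff_distrib[symmetric] abs_mult sum_distrib_left)
  then show ?case using tendsto_mult_left[OF scale.IH, of "\<bar>c\<bar>"] by simp
qed

theorem diag_dev_C0:
  assumes conv: "\<And>q. q \<in> \<rat> \<Longrightarrow> q \<ge> 2 \<Longrightarrow> (\<lambda>m. res_dev (N m) (g m) \<alpha> q) \<longlonglongrightarrow> 0"
    and f: "continuous_on UNIV f" "(f \<longlongrightarrow> 0) at_infinity"
    and B: "\<And>x. \<bar>f x\<bar> \<le> B"
  shows "diag_dev f \<longlonglongrightarrow> 0"
proof (rule tendstoI)
  fix e :: real assume e: "e > 0"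
  interpret prob_space "semicircle \<alpha>" by (rule prob_space_semicircle[OF \<alpha>])
  obtain h where h: "h \<in> cauchy_span" "\<And>x. \<bar>f x - h x\<bar> \<le> e/4"
    using cauchy_approx_C0[OF f] e unfolding cauchy_approx_def by (meson divide_pos_pos zero_less_numeral)
  have fm: "f \<in> borel_measurable borel" by (rule borel_measurable_continuous_onI[OF f(1)])
  have fi: "integrable (semicircle \<alpha>) f" by (rule integrable_semicircle_bounded[OF \<alpha> fm B])
  have hi: "integrable (semicircle \<alpha>) h"
    using cauchy_span_bounded[OF h(1)] cauchy_span_measurable[OF h(1)] integrable_semicircle_bounded[OF \<alpha>] by blast
  have I: "\<bar>(\<integral>x. f x \<partial>semicircle \<alpha>) - (\<integral>x. h x \<partial>semicircle \<alpha>)\<bar> \<le> e/4"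
  proof -
    have "\<bar>(\<integral>x. f x \<partial>semicircle \<alpha>) - (\<integral>x. h x \<partial>semicircle \<alpha>)\<bar> = \<bar>\<integral>x. f x - h x \<partial>semicircle \<alpha>\<bar>"
      using fi hi by simp
    also have "\<dots> \<le> (\<integral>x. \<bar>f x - h x\<bar> \<partial>semicircle \<alpha>)" by (rule integral_abs_bound)
    also have "\<dots> \<le> (\<integral>x. e/4 \<partial>semicircle \<alpha>)" using fi hi h(2) by (intro integral_mono) auto
    finally show ?thesis by (simp add: prob_space)
  qed
  have le: "diag_dev f m \<le> diag_dev h m + e/2" if "N m > 0" for m
  proof -
    have "diag_dev f m \<le> (\<Sum>i<N m. \<bar>spec_fun (N m) (A m) h i i - (\<integral>x. h x \<partial>semicircle \<alpha>)\<bar> + e/2) / N m"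
      unfolding diag_dev_def
    proof (intro divide_right_mono sum_mono)
      fix i assume "i \<in> {..<N m}"
      then have "\<bar>spec_fun (N m) (A m) (\<lambda>x. f x - h x) i i\<bar> \<le> e/4"
        by (intro spec_fun_bounded h(2)) auto
      then show "\<bar>spec_fun (N m) (A m) f i i - (\<integral>x. f x \<partial>semicircle \<alpha>)\<bar>
         \<le> \<bar>spec_fun (N m) (A m) h i i - (\<integral>x. h x \<partial>semicircle \<alpha>)\<bar> + e/2"
        using I unfolding spec_fun_diff by linarith
    qed auto
    then show ?thesis using that by (simp add: diag_dev_def sum.distrib add_divide_distrib)
  qed
  have "\<forall>\<^sub>F m in sequentially. dist (diag_dev h m) 0 < e/2"
    by (rule tendstoD[OF diag_dev_cauchy_span[OF conv h(1)]]) (use e in auto)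
  with N show "\<forall>\<^sub>F m in sequentially. dist (diag_dev f m) 0 < e"
  proof eventually_elim
    case (elim m)
    then show ?case using le[of m] diag_dev_nonneg[of f m] by (simp add: dist_real_def)
  qed
qed

lemma offdiag_small_cauchy_span:
  assumes conv: "\<And>q e. q \<in> \<rat> \<Longrightarrow> q \<ge> 2 \<Longrightarrow> e > 0 \<Longrightarrow> \<forall>\<^sub>F m in sequentially. \<forall>i<N m. \<forall>j<N m. i \<noteq> j \<longrightarrow>
       cmod (res (N m) (A m) (Complex 0 q) i j) \<le> e"
    and h: "h \<in> cauchy_span"
  shows "offdiag_small h"
  using h
proof induction
  case (const c)
  show ?case by (simp add: offdiag_small_def spec_fun_const)
next
  case (re q)
  show ?case unfolding offdiag_small_def
  proof (intro allI impI)
    fix e :: real assume "e > 0"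
    from conv[OF re this]
    show "\<forall>\<^sub>F m in sequentially. \<forall>i<N m. \<forall>j<N m. i \<noteq> j \<longrightarrow> \<bar>spec_fun (N m) (A m) (\<lambda>x. x / (x\<^sup>2 + q\<^sup>2)) i j\<bar> \<le> e"
    proof (rule eventually_mono, intro allI impI)
      fix m i j assume *: "\<forall>i<N m. \<forall>j<N m. i \<noteq> j \<longrightarrow> cmod (res (N m) (A m) (Complex 0 q) i j) \<le> e" "i < N m" "j < N m" "i \<noteq> j"
      have "\<bar>Re (res (N m) (A m) (Complex 0 q) i j)\<bar> \<le> e"
        using * abs_Re_le_cmod order_trans by blast
      then show "\<bar>spec_fun (N m) (A m) (\<lambda>x. x / (x\<^sup>2 + q\<^sup>2)) i j\<bar> \<le> e"
        using re(2) by (simp add: res_eq_spec_fun)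
    qed
  qed
next
  case (im q)
  show ?case unfolding offdiag_small_def
  proof (intro allI impI)
    fix e :: real assume "e > 0"
    from conv[OF im this]
    show "\<forall>\<^sub>F m in sequentially. \<forall>i<N m. \<forall>j<N m. i \<noteq> j \<longrightarrow> \<bar>spec_fun (N m) (A m) (\<lambda>x. 1 / (x\<^sup>2 + q\<^sup>2)) i j\<bar> \<le> e"
    proof (rule eventually_mono, intro allI impI)
      fix m i j assume *: "\<forall>i<N m. \<forall>j<N m. i \<noteq> j \<longrightarrow> cmod (res (N m) (A m) (Complex 0 q) i j) \<le> e" "i < N m" "j < N m" "i \<noteq> j"
      let ?s = "spec_fun (N m) (A m) (\<lambda>x. 1 / (x\<^sup>2 + q\<^sup>2)) i j"
      have "\<bar>Im (res (N m) (A m) (Complex 0 q) i j)\<bar> \<le> e"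
        using * abs_Im_le_cmod order_trans by blast
      then have "q * \<bar>?s\<bar> \<le> e"
        using im(2) by (simp add: res_eq_spec_fun abs_mult)
      moreover have "1 * \<bar>?s\<bar> \<le> q * \<bar>?s\<bar>" using im(2) by (intro mult_right_mono) auto
      ultimately show "\<bar>?s\<bar> \<le> e" by simp
    qed
  qed
next
  case (add f h)
  show ?case unfolding offdiag_small_def
  proof (intro allI impI)
    fix e :: real assume "e > 0"
    then have e: "e/2 > 0" by simp
    show "\<forall>\<^sub>F m in sequentially. \<forall>i<N m. \<forall>j<N m. i \<noteq> j \<longrightarrow> \<bar>spec_fun (N m) (A m) (\<lambda>x. f x + h x) i j\<bar> \<le> e"
      using add.IH(1)[unfolded offdiag_small_def, rule_format, OF e] add.IH(2)[unfolded offdiag_small_def, rule_format, OF e]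
    proof eventually_elim
      case (elim m)
      show ?case
      proof (intro allI impI)
        fix i j assume ij: "i < N m" "j < N m" "i \<noteq> j"
        have "\<bar>spec_fun (N m) (A m) f i j\<bar> \<le> e/2" "\<bar>spec_fun (N m) (A m) h i j\<bar> \<le> e/2" using elim ij by auto
        then show "\<bar>spec_fun (N m) (A m) (\<lambda>x. f x + h x) i j\<bar> \<le> e" unfolding spec_fun_add by linarith
      qed
    qed
  qed
next
  case (scale f c)
  show ?case unfolding offdiag_small_def
  proof (intro allI impI)
    fix e :: real assume "e > 0"
    then have e: "e / (\<bar>c\<bar> + 1) > 0" by (simp add: add_nonneg_pos)
    show "\<forall>\<^sub>F m in sequentially. \<forall>i<N m. \<forall>j<N m. i \<noteq> j \<longrightarrow> \<bar>spec_fun (N m) (A m) (\<lambda>x. c * f x) i j\<bar> \<le> e"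
      using scale.IH(1)[unfolded offdiag_small_def, rule_format, OF e]
    proof eventually_elim
      case (elim m)
      show ?case
      proof (intro allI impI)
        fix i j assume ij: "i < N m" "j < N m" "i \<noteq> j"
        have "\<bar>spec_fun (N m) (A m) f i j\<bar> \<le> e / (\<bar>c\<bar> + 1)" using elim ij by auto
        then have "\<bar>c\<bar> * \<bar>spec_fun (N m) (A m) f i j\<bar> \<le> (\<bar>c\<bar> + 1) * (e / (\<bar>c\<bar> + 1))" by (intro mult_mono) auto
        then show "\<bar>spec_fun (N m) (A m) (\<lambda>x. c * f x) i j\<bar> \<le> e"
          unfolding spec_fun_scale by (simp add: abs_mult)
      qed
    qed
  qed
qed

theorem offdiag_small_C0:
  assumes conv: "\<And>q e. q \<in> \<rat> \<Longrightarrow> q \<ge> 2 \<Longrightarrow> e > 0 \<Longrightarrow> \<forall>\<^sub>F m in sequentially. \<forall>i<N m. \<forall>j<N m. i \<noteq> j \<longrightarrow>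
       cmod (res (N m) (A m) (Complex 0 q) i j) \<le> e"
    and f: "continuous_on UNIV f" "(f \<longlongrightarrow> 0) at_infinity"
  shows "offdiag_small f"
  unfolding offdiag_small_def
proof (intro allI impI)
  fix e :: real assume e: "e > 0"
  then have e2: "e/2 > 0" by simp
  obtain h where h: "h \<in> cauchy_span" "\<And>x. \<bar>f x - h x\<bar> \<le> e/2"
    using cauchy_approx_C0[OF f] e2 unfolding cauchy_approx_def by meson
  have "offdiag_small h" by (rule offdiag_small_cauchy_span[OF conv h(1)])
  then have "\<forall>\<^sub>F m in sequentially. \<forall>i<N m. \<forall>j<N m. i \<noteq> j \<longrightarrow> \<bar>spec_fun (N m) (A m) h i j\<bar> \<le> e/2"
    unfolding offdiag_small_def using e2 by blast
  then show "\<forall>\<^sub>F m in sequentially. \<forall>i<N m. \<forall>j<N m. i \<noteq> j \<longrightarrow> \<bar>spec_fun (N m) (A m) f i j\<bar> \<le> e"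
  proof (rule eventually_mono, intro allI impI)
    fix m i j assume *: "\<forall>i<N m. \<forall>j<N m. i \<noteq> j \<longrightarrow> \<bar>spec_fun (N m) (A m) h i j\<bar> \<le> e/2" "i < N m" "j < N m" "i \<noteq> j"
    have "\<bar>spec_fun (N m) (A m) (\<lambda>x. f x - h x) i j\<bar> \<le> e/2"
      using * by (intro spec_fun_bounded h(2)) auto
    moreover have "\<bar>spec_fun (N m) (A m) h i j\<bar> \<le> e/2" using * by auto
    ultimately show "\<bar>spec_fun (N m) (A m) f i j\<bar> \<le> e" unfolding spec_fun_diff by linarith
  qed
qed

subsection \<open>Counting eigenvalues\<close>

text \<open>A continuous minorant of the indicator of the open interval from a to b, equal to 1 at
  distance at least 1 / K inside it.\<close>

definition trapezoid :: "real \<Rightarrow> real \<Rightarrow> real \<Rightarrow> real \<Rightarrow> real" where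
  "trapezoid a b K x = max 0 (min 1 (min (K * (x - a)) (K * (b - x))))"

text \<open>A lower bound on bounded open intervals suffices for the sequel: upper bounds follow by
  applying it to a complementary interval. The test function is the trapezoid, whose average over
  the eigenvalues is the mean of a diagonal of a matrix function.\<close>

theorem eigenvalue_fraction_ge:
  assumes conv: "\<And>q. q \<in> \<rat> \<Longrightarrow> q \<ge> 2 \<Longrightarrow> (\<lambda>m. res_dev (N m) (g m) \<alpha> q) \<longlonglongrightarrow> 0" and e: "e > 0"
  shows "\<forall>\<^sub>F m in sequentially. real (card {k. k < N m \<and> a < eigval (N m) (A m) k \<and> eigval (N m) (A m) k < b}) / N m
     \<ge> measure (semicircle \<alpha>) {a<..<b} - e"
proof -
  interpret prob_space "semicircle \<alpha>" by (rule prob_space_semicircle[OF \<alpha>])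
  \<comment> \<open>The density is at most 1 / (pi \<alpha>), so each of the two boundary strips of
    width 1 / K carries mass at most e / 4.\<close>
  define K where "K = 4 / (e * pi * \<alpha>)"
  have K: "K > 0" using e \<alpha> by (simp add: K_def)
  have K2: "1 / K / (pi * \<alpha>) = e / 4" using e \<alpha> by (simp add: K_def)
  let ?f = "trapezoid a b K"
  have f01: "0 \<le> ?f x" "?f x \<le> 1" for x by (auto simp: trapezoid_def)
  have f0: "?f x = 0" if "x \<le> a \<or> b \<le> x" for x
  proof -
    have "K * (x - a) \<le> 0 \<or> K * (b - x) \<le> 0" using that K by (auto simp: mult_le_0_iff)
    then show ?thesis by (auto simp: trapezoid_def)
  qed
  have f1: "?f x = 1" if "a + 1/K \<le> x" "x \<le> b - 1/K" for x
  proof -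
    have "1 \<le> K * (x - a)" "1 \<le> K * (b - x)" using that K by (auto simp: field_simps)
    then show ?thesis by (auto simp: trapezoid_def)
  qed
  have cont: "continuous_on UNIV ?f" unfolding trapezoid_def by (intro continuous_intros)
  have lim: "(?f \<longlongrightarrow> 0) at_infinity"
  proof (rule tendsto_eventually)
    show "\<forall>\<^sub>F x in at_infinity. ?f x = 0"
      unfolding eventually_at_infinity
      by (intro exI[of _ "\<bar>a\<bar> + \<bar>b\<bar>"] allI impI f0) auto
  qed
  have fi: "integrable (semicircle \<alpha>) ?f"
    by (rule integrable_semicircle_bounded[OF \<alpha> borel_measurable_continuous_onI[OF cont], of 1]) (use f01 in auto)
  have "measure (semicircle \<alpha>) {a<..<b} \<le> measure (semicircle \<alpha>) ({a..a + 1/K} \<union> ({a + 1/K..b - 1/K} \<union> {b - 1/K..b}))"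
    by (intro finite_measure_mono) (auto simp: \<alpha>)
  also have "\<dots> \<le> measure (semicircle \<alpha>) {a..a + 1/K} + (measure (semicircle \<alpha>) {a + 1/K..b - 1/K} + measure (semicircle \<alpha>) {b - 1/K..b})"
    by (intro order.trans[OF measure_Un_le] add_left_mono measure_Un_le) (auto simp: \<alpha>)
  also have "\<dots> \<le> e/4 + (measure (semicircle \<alpha>) {a + 1/K..b - 1/K} + e/4)"
    using measure_semicircle_le[OF \<alpha>, of a "a + 1/K"] measure_semicircle_le[OF \<alpha>, of "b - 1/K" b] K K2 by simp
  also have "measure (semicircle \<alpha>) {a + 1/K..b - 1/K} = (\<integral>x. indicator {a + 1/K..b - 1/K} x \<partial>semicircle \<alpha>)" by (simp add: \<alpha>)
  also have "\<dots> \<le> (\<integral>x. ?f x \<partial>semicircle \<alpha>)"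
  proof (rule integral_mono[OF _ fi])
    show "integrable (semicircle \<alpha>) (indicator {a + 1/K..b - 1/K} :: real \<Rightarrow> real)"
      by (rule integrable_real_indicator) (auto simp: \<alpha> less_top[symmetric])
  qed (auto simp: indicator_def f1 f01)
  finally have M: "measure (semicircle \<alpha>) {a<..<b} - e/2 \<le> (\<integral>x. ?f x \<partial>semicircle \<alpha>)" by simp
  have "diag_dev ?f \<longlonglongrightarrow> 0"
    by (rule diag_dev_C0[OF conv cont lim, of 1]) (use f01 in auto)
  then have "\<forall>\<^sub>F m in sequentially. dist (diag_dev ?f m) 0 < e/2" by (rule tendstoD) (use e in auto)
  with N show ?thesis
  proof eventually_elim
    case (elim m)
    let ?n = "N m" and ?l = "eigval (N m) (A m)" and ?I = "\<integral>x. ?f x \<partial>semicircle \<alpha>"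
    have "?I - (\<Sum>k<?n. ?f (?l k)) / ?n = (\<Sum>i<?n. ?I - spec_fun ?n (A m) ?f i i) / ?n"
      using elim by (simp add: sum_subtractf sum_spec_fun_diag diff_divide_distrib)
    also have "\<dots> \<le> diag_dev ?f m"
      unfolding diag_dev_def by (intro divide_right_mono sum_mono) auto
    also have "\<dots> \<le> e/2" using elim by (auto simp: dist_real_def)
    finally have 1: "?I - e/2 \<le> (\<Sum>k<?n. ?f (?l k)) / ?n" by simp
    have "(\<Sum>k<?n. ?f (?l k)) \<le> (\<Sum>k<?n. if a < ?l k \<and> ?l k < b then 1 else 0)"
      using f01 f0 by (intro sum_mono) (auto simp: not_less)
    also have "\<dots> = card {k. k < ?n \<and> a < ?l k \<and> ?l k < b}"
      by (simp add: sum.If_cases Int_def)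
    finally have "(\<Sum>k<?n. ?f (?l k)) / ?n \<le> card {k. k < ?n \<and> a < ?l k \<and> ?l k < b} / ?n"
      by (intro divide_right_mono) auto
    then show ?case using 1 M by linarith
  qed
qed

end

subsection \<open>The signed half of the spectrum\<close>

text \<open>The eigenvalue of the normalised X^+ - X^- on the \<open>k\<close>-th eigenvector. Its
  sign is decided by the position \<open>k\<close>, so it differs from the absolute value when the
  median eigenvalue is not exactly 0.\<close>

definition half_sign :: "nat \<Rightarrow> (nat \<Rightarrow> nat \<Rightarrow> real) \<Rightarrow> nat \<Rightarrow> real" where
  "half_sign n A k = (if k < n div 2 then eigval n A k else - eigval n A k)"

definition abs_half :: "nat \<Rightarrow> (nat \<Rightarrow> nat \<Rightarrow> real) \<Rightarrow> nat \<Rightarrow> nat \<Rightarrow> real" where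
  "abs_half n A i j = (\<Sum>k<n. eigvec n A k i * eigvec n A k j * half_sign n A k)"

lemma abs_half_commute: "abs_half n A i j = abs_half n A j i"
  by (simp add: abs_half_def mult_ac)

lemma Xplus_minus_Xminus:
  "Xplus n X i j - Xminus n X i j = sqrt n * abs_half n (\<lambda>a b. X a b / sqrt n) i j"
proof -
  let ?l = "eigval n (\<lambda>a b. X a b / sqrt n)" and ?u = "eigvec n (\<lambda>a b. X a b / sqrt n)"
  let ?t = "\<lambda>k. ?l k * ?u k i * ?u k j"
  let ?f = "\<lambda>k. ?u k i * ?u k j * half_sign n (\<lambda>a b. X a b / sqrt n) k"
  have U: "{..<n} = {..<n div 2} \<union> {n div 2..<n}" by auto
  have "abs_half n (\<lambda>a b. X a b / sqrt n) i j = sum ?f ({..<n div 2} \<union> {n div 2..<n})"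
    unfolding abs_half_def by (rule arg_cong[OF U])
  also have "\<dots> = sum ?f {..<n div 2} + sum ?f {n div 2..<n}"
    by (rule sum.union_disjoint) auto
  also have "\<dots> = (\<Sum>k<n div 2. ?t k) - (\<Sum>k\<in>{n div 2..<n}. ?t k)"
    by (simp add: half_sign_def mult_ac sum_negf)
  finally show ?thesis
    by (simp add: Xplus_def Xminus_def split_beta Let_def right_diff_distrib)
qed

text \<open>Agrees with |x| up to K and descends to 0 at 2 K: a truncation with compact support, to
  which the approximation theorems for functions vanishing at infinity apply.\<close>

definition tent :: "real \<Rightarrow> real \<Rightarrow> real" where
  "tent K x = max 0 (min \<bar>x\<bar> (2 * K - \<bar>x\<bar>))"

lemma tent_bounds:
  assumes "K > 0"
  shows "0 \<le> tent K x" "tent K x \<le> K" "\<bar>\<bar>x\<bar> - tent K x\<bar> \<le> x\<^sup>2 / K" "\<bar>x\<bar> \<le> K \<Longrightarrow> tent K x = \<bar>x\<bar>"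
proof -
  show "0 \<le> tent K x" "tent K x \<le> K" using assms by (auto simp: tent_def)
  show eq: "tent K x = \<bar>x\<bar>" if "\<bar>x\<bar> \<le> K" using that by (auto simp: tent_def)
  show "\<bar>\<bar>x\<bar> - tent K x\<bar> \<le> x\<^sup>2 / K"
  proof (cases "\<bar>x\<bar> \<le> K")
    case True then show ?thesis using eq assms by simp
  next
    case False
    have "tent K x \<le> \<bar>x\<bar>" "0 \<le> tent K x" by (simp_all add: tent_def)
    then have "\<bar>\<bar>x\<bar> - tent K x\<bar> \<le> \<bar>x\<bar>" by simp
    moreover have "K * \<bar>x\<bar> \<le> \<bar>x\<bar> * \<bar>x\<bar>" using False by (intro mult_right_mono) auto
    then have "\<bar>x\<bar> \<le> x\<^sup>2 / K" using assms by (simp add: pos_le_divide_eq power2_eq_square mult.commute)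
    ultimately show ?thesis by simp
  qed
qed

lemma tent_C0:
  assumes "K > 0"
  shows "continuous_on UNIV (tent K)" "(tent K \<longlongrightarrow> 0) at_infinity"
proof -
  show "continuous_on UNIV (tent K)" unfolding tent_def by (intro continuous_intros)
  show "(tent K \<longlongrightarrow> 0) at_infinity"
  proof (rule tendsto_eventually)
    show "\<forall>\<^sub>F x in at_infinity. tent K x = 0"
      unfolding eventually_at_infinity
      by (intro exI[of _ "2 * K"]) (auto simp: tent_def)
  qed
qed

lemma integral_tent_semicircle:
  assumes "K \<ge> 2"
  shows "(\<integral>x. tent K x \<partial>semicircle 1) = 8 / (3 * pi)"
proof -
  have "(\<integral>x. tent K x \<partial>semicircle 1) = (\<integral>x. semicircle_density 1 x * tent K x \<partial>lborel)"
    using assms by (intro integral_semicircle borel_measurable_continuous_onI tent_C0) auto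
  also have "\<dots> = (\<integral>x. semicircle_density 1 x * \<bar>x\<bar> \<partial>lborel)"
    using assms tent_bounds(4)[of K]
    by (intro Bochner_Integration.integral_cong refl) (auto simp: semicircle_density_def)
  also have "\<dots> = (\<integral>x. \<bar>x\<bar> \<partial>semicircle 1)"
    by (intro integral_semicircle[symmetric]) auto
  finally show ?thesis using integral_semicircle_abs[of 1] by simp
qed

lemma sum_abs_half_square: "i < n \<Longrightarrow> (\<Sum>j<n. (abs_half n (sym_mat g) i j)\<^sup>2) = (\<Sum>j<n. (sym_mat g i j)\<^sup>2)"
proof -
  assume i: "i < n"
  have "(\<Sum>j<n. (sym_mat g i j)\<^sup>2) = (\<Sum>j<n. (\<Sum>k<n. eigvec n (sym_mat g) k i * eigvec n (sym_mat g) k j * eigval n (sym_mat g) k)\<^sup>2)"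
    using i by (intro sum.cong refl) (simp add: spec_fun_id[symmetric] spec_fun_eq)
  also have "\<dots> = (\<Sum>j<n. (abs_half n (sym_mat g) i j)\<^sup>2)"
    unfolding eigvec_sum_square abs_half_def by (intro sum.cong refl) (auto simp: half_sign_def)
  finally show ?thesis by simp
qed

lemma eigval_square_row:
  assumes "i < n"
  shows "(\<Sum>k<n. eigvec n (sym_mat g) k i * eigvec n (sym_mat g) k i * (eigval n (sym_mat g) k)\<^sup>2) = (\<Sum>j<n. (sym_mat g i j)\<^sup>2)"
proof -
  have "(\<Sum>k<n. eigvec n (sym_mat g) k i * eigvec n (sym_mat g) k j * eigval n (sym_mat g) k) = sym_mat g i j" if "j < n" for j
    using spec_fun_id[OF assms that, of g] by (simp add: spec_fun_eq)
  then show ?thesis unfolding eigvec_sum_square[symmetric] by (intro sum.cong refl) simp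
qed

text \<open>A sign differs from that of the eigenvalue only when the eigenvalue has modulus at most
  t, which costs 2 t. Truncation costs at most lambda^2 / K; weighted by the eigenvector entries,
  lambda^2 sums to the row norm of the matrix, at most 2.\<close>

lemma abs_half_approx:
  assumes med: "\<And>k. k < n div 2 \<Longrightarrow> eigval n (sym_mat g) k \<ge> - t" "\<And>k. k < n \<Longrightarrow> n div 2 \<le> k \<Longrightarrow> eigval n (sym_mat g) k \<le> t"
    and t: "t > 0" and K: "K > 0" and ij: "i < n" "j < n"
    and row: "\<And>i. i < n \<Longrightarrow> (\<Sum>j<n. (sym_mat g i j)\<^sup>2) \<le> 2"
  shows "\<bar>abs_half n (sym_mat g) i j - spec_fun n (sym_mat g) (tent K) i j\<bar> \<le> 2 * t + 2 / K"
proof -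
  let ?l = "eigval n (sym_mat g)" and ?u = "eigvec n (sym_mat g)"
  let ?c = "\<lambda>k. half_sign n (sym_mat g) k - tent K (?l k)"
  have c: "\<bar>?c k\<bar> \<le> 2 * t + (?l k)\<^sup>2 / K" if "k < n" for k
  proof -
    have "\<bar>half_sign n (sym_mat g) k - \<bar>?l k\<bar>\<bar> \<le> 2 * t"
      using med(1)[of k] med(2)[OF that] t by (auto simp: half_sign_def)
    then show ?thesis using tent_bounds(3)[OF K, of "?l k"] by linarith
  qed
  have diag: "(\<Sum>k<n. ?u k i * ?u k i * \<bar>?c k\<bar>) \<le> 2 * t + 2 / K" if "i < n" for i
  proof -
    have "(\<Sum>k<n. ?u k i * ?u k i * \<bar>?c k\<bar>) \<le> (\<Sum>k<n. ?u k i * ?u k i * (2 * t + (?l k)\<^sup>2 / K))"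
      using c by (intro sum_mono mult_left_mono) auto
    also have "\<dots> = (\<Sum>k<n. ?u k i * ?u k i) * (2 * t) + (\<Sum>k<n. ?u k i * ?u k i * (?l k)\<^sup>2) / K"
      by (simp add: distrib_left sum.distrib sum_distrib_right sum_divide_distrib)
    also have "\<dots> \<le> 2 * t + 2 / K"
      using row[OF that] K unfolding eigval_square_row[OF that] eigvec_complete[OF that that]
      by (simp add: divide_right_mono)
    finally show ?thesis .
  qed
  have eq: "abs_half n (sym_mat g) i j - spec_fun n (sym_mat g) (tent K) i j = (\<Sum>k<n. ?u k i * ?u k j * ?c k)"
    by (simp add: abs_half_def spec_fun_eq right_diff_distrib sum_subtractf)
  have "\<bar>\<Sum>k<n. ?u k i * ?u k j * ?c k\<bar> \<le> ((\<Sum>k<n. ?u k i * ?u k i * \<bar>?c k\<bar>) + (\<Sum>k<n. ?u k j * ?u k j * \<bar>?c k\<bar>)) / 2"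
    by (rule eigvec_sum_abs_le)
  also have "\<dots> \<le> ((2 * t + 2 / K) + (2 * t + 2 / K)) / 2"
    by (intro divide_right_mono add_mono diag ij) auto
  finally show ?thesis unfolding eq by simp
qed

context mat_seq
begin

text \<open>Eventually more than half of the eigenvalues exceed -t and more than half lie below t.
  As they are sorted, an eigenvalue of the upper half below -t, or of the lower half above t, would
  contradict one of these counts.\<close>

lemma eventually_median:
  assumes conv: "\<And>q. q \<in> \<rat> \<Longrightarrow> q \<ge> 2 \<Longrightarrow> (\<lambda>m. res_dev (N m) (g m) \<alpha> q) \<longlonglongrightarrow> 0" and t: "t > 0"
  shows "\<forall>\<^sub>F m in sequentially. (\<forall>k<N m div 2. eigval (N m) (A m) k \<ge> -t) \<and>
     (\<forall>k<N m. N m div 2 \<le> k \<longrightarrow> eigval (N m) (A m) k \<le> t)"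
proof -
  interpret prob_space "semicircle \<alpha>" by (rule prob_space_semicircle[OF \<alpha>])
  \<comment> \<open>Beyond the support, so that half-lines may be replaced by the bounded intervals
    of \<open>eigenvalue_fraction_ge\<close> without losing mass.\<close>
  define b where "b = 2 * \<alpha> + 1"
  define p where "p = min (measure (semicircle \<alpha>) {-t<..<b}) (measure (semicircle \<alpha>) {-b<..<t}) - 1/2"
  have "measure (semicircle \<alpha>) {-t<..} \<le> measure (semicircle \<alpha>) ({-t<..<b} \<union> {b..})"
    by (intro finite_measure_mono) (auto simp: \<alpha>)
  also have "\<dots> \<le> measure (semicircle \<alpha>) {-t<..<b} + measure (semicircle \<alpha>) {b..}"
    by (rule measure_Un_le) (auto simp: \<alpha>)
  also have "measure (semicircle \<alpha>) {b..} = 0"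
    by (rule measure_semicircle_outside[OF \<alpha>]) (auto simp: b_def)
  finally have 1: "1/2 < measure (semicircle \<alpha>) {-t<..<b}" using semicircle_median(2)[OF \<alpha> t] by simp
  have "measure (semicircle \<alpha>) {..<t} \<le> measure (semicircle \<alpha>) ({-b<..<t} \<union> {..-b})"
    by (intro finite_measure_mono) (auto simp: \<alpha>)
  also have "\<dots> \<le> measure (semicircle \<alpha>) {-b<..<t} + measure (semicircle \<alpha>) {..-b}"
    by (rule measure_Un_le) (auto simp: \<alpha>)
  also have "measure (semicircle \<alpha>) {..-b} = 0"
    by (rule measure_semicircle_outside[OF \<alpha>]) (auto simp: b_def)
  finally have 2: "1/2 < measure (semicircle \<alpha>) {-b<..<t}" using semicircle_median(1)[OF \<alpha> t] by simp
  have p: "p > 0" using 1 2 by (auto simp: p_def)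
  then have p2: "p/2 > 0" by simp
  have ev: "\<forall>\<^sub>F m in sequentially. real (card {k. k < N m \<and> a < eigval (N m) (A m) k \<and> eigval (N m) (A m) k < b}) / N m
     \<ge> measure (semicircle \<alpha>) {a<..<b} - p / 2" for a b
    by (intro eigenvalue_fraction_ge conv p2)
  have half_lt: "n < 2 * c" if "1/2 < real c / real n" "n > 0" for c n :: nat
  proof -
    have "real n < 2 * real c" using that by (simp add: field_simps)
    then show ?thesis by linarith
  qed
  show ?thesis
    using N ev[of "-t" b] ev[of "-b" t]
  proof eventually_elim
    case (elim m)
    let ?n = "N m" and ?l = "eigval (N m) (A m)"
    have "p \<le> measure (semicircle \<alpha>) {-t<..<b} - 1/2" "p \<le> measure (semicircle \<alpha>) {-b<..<t} - 1/2"
      by (auto simp: p_def)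
    then have "1/2 < real (card {k. k < ?n \<and> -t < ?l k \<and> ?l k < b}) / ?n" "1/2 < real (card {k. k < ?n \<and> -b < ?l k \<and> ?l k < t}) / ?n"
      using elim p by linarith+
    then have c: "?n < 2 * card {k. k < ?n \<and> -t < ?l k \<and> ?l k < b}" "?n < 2 * card {k. k < ?n \<and> -b < ?l k \<and> ?l k < t}"
      using half_lt elim(1) by blast+
    show ?case
    proof (intro conjI allI impI)
      fix k assume k: "k < ?n div 2"
      show "?l k \<ge> -t"
      proof (rule ccontr)
        assume "\<not> ?l k \<ge> -t"
        then have "{k. k < ?n \<and> -t < ?l k \<and> ?l k < b} \<subseteq> {..<k}"
        proof (intro subsetI)
          fix l assume l: "l \<in> {k. k < ?n \<and> -t < ?l k \<and> ?l k < b}"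
          have "?l l \<le> ?l k" if "k \<le> l" using eigval_mono[OF that] l by auto
          then show "l \<in> {..<k}" using \<open>\<not> ?l k \<ge> -t\<close> l by fastforce
        qed
        from card_mono[OF _ this] show False using c(1) k by simp
      qed
    next
      fix k assume k: "k < ?n" "?n div 2 \<le> k"
      show "?l k \<le> t"
      proof (rule ccontr)
        assume "\<not> ?l k \<le> t"
        then have "{k. k < ?n \<and> -b < ?l k \<and> ?l k < t} \<subseteq> {k<..<?n}"
        proof (intro subsetI)
          fix l assume l: "l \<in> {k. k < ?n \<and> -b < ?l k \<and> ?l k < t}"
          have "?l k \<le> ?l l" if "l \<le> k" using eigval_mono[OF that] k by auto
          then show "l \<in> {k<..<?n}" using \<open>\<not> ?l k \<le> t\<close> l by fastforce
        qed
        from card_mono[OF _ this] show False using c(2) k by simp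
      qed
    qed
  qed
qed

end

text \<open>What the good event guarantees about X / sqrt n. The variance profile of W is analysed
  from these three properties: diagonal resolvent, off-diagonal resolvent, row norms.\<close>

locale gauss_seq = mat_seq N g 1 for N g +
  assumes conv: "\<And>q. q \<in> \<rat> \<Longrightarrow> q \<ge> 2 \<Longrightarrow> (\<lambda>m. res_dev (N m) (g m) 1 q) \<longlonglongrightarrow> 0"
    and off: "\<And>q e. q \<in> \<rat> \<Longrightarrow> q \<ge> 2 \<Longrightarrow> e > 0 \<Longrightarrow> \<forall>\<^sub>F m in sequentially. \<forall>i<N m. \<forall>j<N m. i \<noteq> j \<longrightarrow>
       cmod (res (N m) (sym_mat (g m)) (Complex 0 q) i j) \<le> e"
    and rows: "\<And>e. e > 0 \<Longrightarrow> \<forall>\<^sub>F m in sequentially. \<forall>i<N m. \<bar>(\<Sum>j<N m. (sym_mat (g m) i j)\<^sup>2) - 1\<bar> \<le> e"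
begin

lemma eventually_abs_half_approx:
  assumes e: "e > 0"
  shows "\<exists>K\<ge>2. \<forall>\<^sub>F m in sequentially. \<forall>i<N m. \<forall>j<N m.
     \<bar>abs_half (N m) (A m) i j - spec_fun (N m) (A m) (tent K) i j\<bar> \<le> e"
proof -
  \<comment> \<open>The lower bound 2 places the support of the semicircle law where the tent equals
    |x|; 4 / e makes the truncation error 2 / K at most e / 2.\<close>
  define K where "K = max 2 (4 / e)"
  have K: "K \<ge> 2" "4 / e \<le> K" by (auto simp: K_def)
  then have Ke: "2 / K \<le> e / 2" using e by (simp add: field_simps)
  have t: "e / 4 > 0" using e by simp
  have med: "\<forall>\<^sub>F m in sequentially. (\<forall>k<N m div 2. eigval (N m) (A m) k \<ge> -(e/4)) \<and>
     (\<forall>k<N m. N m div 2 \<le> k \<longrightarrow> eigval (N m) (A m) k \<le> e/4)"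
    by (intro eventually_median conv t)
  have "\<forall>\<^sub>F m in sequentially. \<forall>i<N m. \<forall>j<N m. \<bar>abs_half (N m) (A m) i j - spec_fun (N m) (A m) (tent K) i j\<bar> \<le> e"
    using med rows[OF zero_less_one]
  proof eventually_elim
    case (elim m)
    show ?case
    proof (intro allI impI)
      fix i j assume ij: "i < N m" "j < N m"
      have "\<bar>abs_half (N m) (A m) i j - spec_fun (N m) (A m) (tent K) i j\<bar> \<le> 2 * (e/4) + 2 / K"
      proof (rule abs_half_approx[OF _ _ t _ ij])
        show "(\<Sum>j<N m. (A m i j)\<^sup>2) \<le> 2" if "i < N m" for i
          using elim(2) that by (auto simp: abs_le_iff)
      qed (use elim(1) K in auto)
      then show "\<bar>abs_half (N m) (A m) i j - spec_fun (N m) (A m) (tent K) i j\<bar> \<le> e" using Ke by simp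
    qed
  qed
  then show ?thesis using K by blast
qed

theorem abs_half_offdiag_small:
  assumes e: "e > 0"
  shows "\<forall>\<^sub>F m in sequentially. \<forall>i<N m. \<forall>j<N m. i \<noteq> j \<longrightarrow> \<bar>abs_half (N m) (A m) i j\<bar> \<le> e"
proof -
  have e2: "e/2 > 0" using e by simp
  obtain K where K: "K \<ge> 2" and ap: "\<forall>\<^sub>F m in sequentially. \<forall>i<N m. \<forall>j<N m.
     \<bar>abs_half (N m) (A m) i j - spec_fun (N m) (A m) (tent K) i j\<bar> \<le> e/2"
    using eventually_abs_half_approx[OF e2] by blast
  have "offdiag_small (tent K)"
    using K by (intro offdiag_small_C0 off tent_C0) auto
  then have "\<forall>\<^sub>F m in sequentially. \<forall>i<N m. \<forall>j<N m. i \<noteq> j \<longrightarrow> \<bar>spec_fun (N m) (A m) (tent K) i j\<bar> \<le> e/2"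
    unfolding offdiag_small_def using e2 by blast
  with ap show ?thesis
  proof eventually_elim
    case (elim m)
    show ?case
    proof (intro allI impI)
      fix i j assume "i < N m" "j < N m" "i \<noteq> j"
      then have "\<bar>abs_half (N m) (A m) i j - spec_fun (N m) (A m) (tent K) i j\<bar> \<le> e/2" "\<bar>spec_fun (N m) (A m) (tent K) i j\<bar> \<le> e/2"
        using elim by auto
      then show "\<bar>abs_half (N m) (A m) i j\<bar> \<le> e" by linarith
    qed
  qed
qed

theorem abs_half_row_sum:
  "(\<lambda>m. (\<Sum>i<N m. \<bar>row_sum (N m) (\<lambda>p. (abs_half (N m) (A m) (fst p) (snd p))\<^sup>2) i - (1 - 64 / (9 * pi\<^sup>2))\<bar>) / N m) \<longlonglongrightarrow> 0"
proof (rule tendstoI)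
  fix e :: real assume e: "e > 0"
  define c where "c = 8 / (3 * pi)"
  have c: "0 \<le> c" "c \<le> 1" "c\<^sup>2 = 64 / (9 * pi\<^sup>2)" using pi_gt3 by (auto simp: c_def power_divide power_mult_distrib)
  \<comment> \<open>The passage from B_ii to its square costs |B_ii + c| <= 3. Hence three quarters
    of \<open>e\<close> are spent: e/4 on the row norm, 3 e/12 on replacing |x| by the tent, and 3
    e/12 on the diagonal of the tent.\<close>
  have e2: "e/12 > 0" using e by simp
  obtain K where K: "K \<ge> 2" and ap: "\<forall>\<^sub>F m in sequentially. \<forall>i<N m. \<forall>j<N m.
     \<bar>abs_half (N m) (A m) i j - spec_fun (N m) (A m) (tent K) i j\<bar> \<le> e/12"
    using eventually_abs_half_approx[OF e2] by blast
  have "diag_dev (tent K) \<longlonglongrightarrow> 0"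
    using K tent_bounds(1,2)[of K] by (intro diag_dev_C0[where B = K] conv tent_C0) auto
  then have dd: "\<forall>\<^sub>F m in sequentially. dist (diag_dev (tent K) m) 0 < e/12" by (rule tendstoD) (rule e2)
  have mi: "min 1 (e/4) > 0" using e by simp
  show "\<forall>\<^sub>F m in sequentially. dist ((\<Sum>i<N m. \<bar>row_sum (N m) (\<lambda>p. (abs_half (N m) (A m) (fst p) (snd p))\<^sup>2) i - (1 - 64 / (9 * pi\<^sup>2))\<bar>) / N m) 0 < e"
    using N ap dd rows[OF mi]
  proof eventually_elim
    case (elim m)
    let ?n = "N m" and ?B = "abs_half (N m) (A m)" and ?S = "spec_fun (N m) (A m) (tent K)"
    have each: "\<bar>row_sum ?n (\<lambda>p. (?B (fst p) (snd p))\<^sup>2) i - (1 - 64 / (9 * pi\<^sup>2))\<bar> \<le> e/2 + 3 * \<bar>?S i i - c\<bar>" if i: "i < ?n" for i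
    proof -
      have "row_sum ?n (\<lambda>p. (?B (fst p) (snd p))\<^sup>2) i = (\<Sum>j\<in>{..<?n}-{i}. (?B i j)\<^sup>2)"
        unfolding row_sum_def by (intro sum.cong refl) (auto simp: sym_mat_def abs_half_commute[of _ _ i])
      also have "\<dots> = (\<Sum>j<?n. (?B i j)\<^sup>2) - (?B i i)\<^sup>2"
        using i by (simp add: sum_diff1)
      finally have r: "row_sum ?n (\<lambda>p. (?B (fst p) (snd p))\<^sup>2) i = (\<Sum>j<?n. (A m i j)\<^sup>2) - (?B i i)\<^sup>2"
        using sum_abs_half_square[OF i] by simp
      have row: "\<bar>(\<Sum>j<?n. (A m i j)\<^sup>2) - 1\<bar> \<le> min 1 (e/4)" using elim i by auto
      have "(?B i i)\<^sup>2 \<le> (\<Sum>j<?n. (?B i j)\<^sup>2)" using i by (intro member_le_sum) auto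
      moreover have "(\<Sum>j<?n. (A m i j)\<^sup>2) \<le> 2" using row by (auto simp: abs_le_iff)
      ultimately have "(?B i i)\<^sup>2 \<le> 2\<^sup>2" using sum_abs_half_square[OF i, of "g m"] by simp
      then have B2: "\<bar>?B i i\<bar> \<le> 2" using abs_le_square_iff[of "?B i i" 2] by simp
      have "\<bar>(?B i i)\<^sup>2 - c\<^sup>2\<bar> = \<bar>?B i i + c\<bar> * \<bar>?B i i - c\<bar>"
        by (simp add: abs_mult[symmetric] power2_eq_square algebra_simps)
      also have "\<dots> \<le> 3 * \<bar>?B i i - c\<bar>" using B2 c by (intro mult_right_mono) auto
      also have "\<dots> \<le> 3 * (e/12 + \<bar>?S i i - c\<bar>)"
      proof -
        have "\<bar>?B i i - ?S i i\<bar> \<le> e/12" using elim i by auto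
        then have "\<bar>?B i i - c\<bar> \<le> e/12 + \<bar>?S i i - c\<bar>"
          using abs_triangle_ineq[of "?B i i - ?S i i" "?S i i - c"] by simp
        then show ?thesis by simp
      qed
      finally have "\<bar>(?B i i)\<^sup>2 - c\<^sup>2\<bar> \<le> e/4 + 3 * \<bar>?S i i - c\<bar>" by simp
      moreover have "\<bar>(\<Sum>j<?n. (A m i j)\<^sup>2) - 1\<bar> \<le> e/4" using row by simp
      ultimately have "\<bar>(\<Sum>j<?n. (A m i j)\<^sup>2) - 1\<bar> + \<bar>(?B i i)\<^sup>2 - c\<^sup>2\<bar> \<le> e/2 + 3 * \<bar>?S i i - c\<bar>" by simp
      moreover have "(\<Sum>j<?n. (A m i j)\<^sup>2) - (?B i i)\<^sup>2 - (1 - c\<^sup>2) = ((\<Sum>j<?n. (A m i j)\<^sup>2) - 1) - ((?B i i)\<^sup>2 - c\<^sup>2)" by simp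
      ultimately show ?thesis unfolding r c(3)[symmetric]
        by (metis (no_types, lifting) abs_triangle_ineq4 order_trans)
    qed
    have "(\<Sum>i<?n. \<bar>row_sum ?n (\<lambda>p. (?B (fst p) (snd p))\<^sup>2) i - (1 - 64 / (9 * pi\<^sup>2))\<bar>) / ?n
       \<le> (\<Sum>i<?n. e/2 + 3 * \<bar>?S i i - c\<bar>) / ?n"
      by (intro divide_right_mono sum_mono each) auto
    also have "\<dots> = e/2 + 3 * diag_dev (tent K) m"
      using elim(1) K by (simp add: diag_dev_def sum.distrib add_divide_distrib integral_tent_semicircle c_def sum_distrib_left)
    also have "\<dots> < e" using elim by (auto simp: dist_real_def)
    finally have "(\<Sum>i<?n. \<bar>row_sum ?n (\<lambda>p. (?B (fst p) (snd p))\<^sup>2) i - (1 - 64 / (9 * pi\<^sup>2))\<bar>) / ?n < e" .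
    moreover have "0 \<le> (\<Sum>i<?n. \<bar>row_sum ?n (\<lambda>p. (?B (fst p) (snd p))\<^sup>2) i - (1 - 64 / (9 * pi\<^sup>2))\<bar>) / ?n"
      by (intro divide_nonneg_nonneg sum_nonneg) auto
    ultimately show ?case by (simp only: dist_real_def diff_zero abs_of_nonneg)
  qed
qed

end

section \<open>Gaussian tail bounds\<close>

definition normal_law :: "real \<Rightarrow> real measure" where
  "normal_law \<sigma> = density lborel (\<lambda>x. ennreal (normal_density 0 \<sigma> x))"

context
  fixes \<sigma> :: real
  assumes \<sigma>: "\<sigma> > 0"
begin

lemma prob_space_normal_law: "prob_space (normal_law \<sigma>)"
  unfolding normal_law_def by (rule prob_space_normal_density[OF \<sigma>])

lemma gauss_like_normal_law: "gauss_like (normal_law \<sigma>) (\<sigma>\<^sup>2)"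
proof -
  have b: "integrable (normal_law \<sigma>) (\<lambda>x. x ^ k)" for k
    unfolding normal_law_def using integrable_normal_moment[OF \<sigma>, of 0 k]
    by (subst integrable_density) (auto simp: mult.commute)
  have e: "(\<integral>x. x ^ k \<partial>normal_law \<sigma>) = (\<integral>x. normal_density 0 \<sigma> x * (x - 0) ^ k \<partial>lborel)" for k
    unfolding normal_law_def by (subst integral_density) auto
  have "(\<integral>x. x ^ 1 \<partial>normal_law \<sigma>) = 0"
    unfolding e using integral_normal_moment_odd[OF \<sigma>, of 0 0] by simp
  moreover have "(\<integral>x. x ^ 2 \<partial>normal_law \<sigma>) = \<sigma>\<^sup>2"
    unfolding e using integral_normal_moment_even[OF \<sigma>, of 0 1] by simp
  moreover have "(\<integral>x. x ^ 3 \<partial>normal_law \<sigma>) = 0"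
    unfolding e using integral_normal_moment_odd[OF \<sigma>, of 0 1] by (simp add: eval_nat_numeral)
  moreover have "(\<integral>x. x ^ 4 \<partial>normal_law \<sigma>) = 3 * (\<sigma>\<^sup>2)\<^sup>2"
    unfolding e using integral_normal_moment_even[OF \<sigma>, of 0 2] \<sigma>
    by (simp add: fact_numeral power_divide)
  ultimately show ?thesis
    using b prob_space_normal_law by (simp add: gauss_like_def) (simp add: normal_law_def)
qed

lemma nn_integral_normal_law:
  assumes "f \<in> borel_measurable borel" "\<And>x. f x \<ge> 0"
  shows "(\<integral>\<^sup>+ x. ennreal (f x) \<partial>normal_law \<sigma>) = (\<integral>\<^sup>+ x. ennreal (normal_density 0 \<sigma> x * f x) \<partial>lborel)"
  unfolding normal_law_def using assms
  by (subst nn_integral_density) (auto simp: ennreal_mult'')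

lemma nn_integral_normal_density: "(\<integral>\<^sup>+ x. ennreal (normal_density \<mu> \<sigma> x) \<partial>lborel) = 1"
  using prob_space.emeasure_space_1[OF prob_space_normal_density[OF \<sigma>, of \<mu>]]
  by (simp add: emeasure_density)

lemma normal_law_mgf: "(\<integral>\<^sup>+ x. ennreal (exp (t * x)) \<partial>normal_law \<sigma>) = ennreal (exp (t\<^sup>2 * \<sigma>\<^sup>2 / 2))"
proof -
  have "normal_density 0 \<sigma> x * exp (t * x) = exp (t\<^sup>2 * \<sigma>\<^sup>2 / 2) * normal_density (t * \<sigma>\<^sup>2) \<sigma> x" for x
  proof -
    have "- x\<^sup>2 / (2 * \<sigma>\<^sup>2) + t * x = t\<^sup>2 * \<sigma>\<^sup>2 / 2 + - (x - t * \<sigma>\<^sup>2)\<^sup>2 / (2 * \<sigma>\<^sup>2)"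
      using \<sigma> by (simp add: power2_diff field_simps power2_eq_square)
    then show ?thesis by (simp add: normal_density_def exp_add[symmetric] mult_ac)
  qed
  then have "(\<integral>\<^sup>+ x. ennreal (exp (t * x)) \<partial>normal_law \<sigma>)
      = (\<integral>\<^sup>+ x. ennreal (exp (t\<^sup>2 * \<sigma>\<^sup>2 / 2)) * ennreal (normal_density (t * \<sigma>\<^sup>2) \<sigma> x) \<partial>lborel)"
    by (subst nn_integral_normal_law) (auto simp: ennreal_mult'[symmetric])
  then show ?thesis by (simp add: nn_integral_cmult nn_integral_normal_density)
qed

end

text \<open>Tilting by exp(t x^2) turns the Gaussian density into 1 / r times the one with standard
  deviation \<sigma> / r, where r is the square root on the right-hand side.\<close>

lemma normal_law_square_mgf:
  assumes \<sigma>: "\<sigma> > 0" and t: "2 * t * \<sigma>\<^sup>2 < 1"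
  shows "(\<integral>\<^sup>+ x. ennreal (exp (t * x\<^sup>2)) \<partial>normal_law \<sigma>) = ennreal (1 / sqrt (1 - 2 * t * \<sigma>\<^sup>2))"
proof -
  define r where "r = sqrt (1 - 2 * t * \<sigma>\<^sup>2)"
  have r: "r > 0" "r\<^sup>2 = 1 - 2 * t * \<sigma>\<^sup>2" using t by (auto simp: r_def)
  have s: "\<sigma> / r > 0" using \<sigma> r by simp
  have "normal_density 0 \<sigma> x * exp (t * x\<^sup>2) = (1 / r) * normal_density 0 (\<sigma> / r) x" for x
  proof -
    have "- x\<^sup>2 / (2 * \<sigma>\<^sup>2) + t * x\<^sup>2 = - (x\<^sup>2 * (1 - 2 * t * \<sigma>\<^sup>2)) / (2 * \<sigma>\<^sup>2)"
      using \<sigma> by (simp add: field_simps)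
    also have "\<dots> = - x\<^sup>2 / (2 * (\<sigma> / r)\<^sup>2)"
      unfolding r(2)[symmetric] by (simp add: power_divide)
    finally have 1: "- x\<^sup>2 / (2 * \<sigma>\<^sup>2) + t * x\<^sup>2 = - x\<^sup>2 / (2 * (\<sigma> / r)\<^sup>2)" .
    have 2: "1 / sqrt (2 * pi * \<sigma>\<^sup>2) = (1 / r) * (1 / sqrt (2 * pi * (\<sigma> / r)\<^sup>2))"
      using \<sigma> r(1) by (simp add: real_sqrt_mult real_sqrt_divide power_divide)
    have "normal_density 0 \<sigma> x * exp (t * x\<^sup>2) = 1 / sqrt (2 * pi * \<sigma>\<^sup>2) * exp (- x\<^sup>2 / (2 * \<sigma>\<^sup>2) + t * x\<^sup>2)"
      unfolding normal_density_def exp_add by simp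
    then show ?thesis unfolding 1 2 by (simp add: normal_density_def)
  qed
  then have "(\<integral>\<^sup>+ x. ennreal (exp (t * x\<^sup>2)) \<partial>normal_law \<sigma>) = (\<integral>\<^sup>+ x. ennreal (1 / r) * ennreal (normal_density 0 (\<sigma> / r) x) \<partial>lborel)"
    using r by (subst nn_integral_normal_law[OF \<sigma>]) (auto simp: ennreal_mult'[symmetric])
  then show ?thesis unfolding r_def[symmetric] by (simp add: nn_integral_cmult nn_integral_normal_density[OF s])
qed

text \<open>Second-order expansion of - ln (1 - y) / 2. In \<open>normal_law_square_mgf_le\<close>
  its linear term cancels against the centring of x^2 and leaves an exponent quadratic in t.\<close>

lemma inverse_sqrt_le_exp:
  fixes y :: real
  assumes "\<bar>y\<bar> \<le> 1/2"
  shows "1 / sqrt (1 - y) \<le> exp (y / 2 + y\<^sup>2)"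
proof -
  have l: "ln (1 - y) \<ge> - y - 2 * y\<^sup>2"
  proof (cases "y \<ge> 0")
    case True
    then show ?thesis using ln_one_minus_pos_lower_bound[of y] assms by simp
  next
    case False
    then have "- y - (- y)\<^sup>2 \<le> ln (1 + - y)"
      using assms by (intro ln_one_plus_pos_lower_bound) auto
    moreover have "- y - 2 * y\<^sup>2 \<le> - y - (- y)\<^sup>2" by simp
    ultimately show ?thesis by (metis add_uminus_conv_diff order_trans)
  qed
  have y: "1 - y > 0" using assms by auto
  have "1 / sqrt (1 - y) = exp (- ln (1 - y) / 2)"
    using y by (simp add: exp_minus inverse_eq_divide ln_sqrt[symmetric])
  also have "\<dots> \<le> exp (y / 2 + y\<^sup>2)" using l by simp
  finally show ?thesis .
qed

lemma normal_law_square_mgf_le: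
  assumes \<sigma>: "\<sigma> > 0" "\<sigma>\<^sup>2 \<le> 2" and t: "\<bar>t\<bar> \<le> 1/8"
  shows "(\<integral>\<^sup>+ x. ennreal (exp (t * (x\<^sup>2 - \<sigma>\<^sup>2))) \<partial>normal_law \<sigma>) \<le> ennreal (exp (16 * t\<^sup>2))"
proof -
  have "\<bar>t\<bar> * \<sigma>\<^sup>2 \<le> 1/8 * 2" using \<sigma> t by (intro mult_mono) auto
  then have y: "\<bar>2 * t * \<sigma>\<^sup>2\<bar> \<le> 1/2" by (simp add: abs_mult)
  have eq: "(\<integral>\<^sup>+ x. ennreal (exp (t * (x\<^sup>2 - \<sigma>\<^sup>2))) \<partial>normal_law \<sigma>) = ennreal (exp (- t * \<sigma>\<^sup>2)) * (\<integral>\<^sup>+ x. ennreal (exp (t * x\<^sup>2)) \<partial>normal_law \<sigma>)"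
    by (subst nn_integral_cmult[symmetric])
       (auto simp: normal_law_def ennreal_mult'[symmetric] exp_add[symmetric] right_diff_distrib intro!: nn_integral_cong)
  have "2 * t * \<sigma>\<^sup>2 < 1" using y by (auto simp: abs_le_iff)
  note eq
  also note normal_law_square_mgf[OF \<sigma>(1) \<open>2 * t * \<sigma>\<^sup>2 < 1\<close>]
  also have "ennreal (exp (- t * \<sigma>\<^sup>2)) * ennreal (1 / sqrt (1 - 2 * t * \<sigma>\<^sup>2)) \<le> ennreal (exp (- t * \<sigma>\<^sup>2)) * ennreal (exp (2 * t * \<sigma>\<^sup>2 / 2 + (2 * t * \<sigma>\<^sup>2)\<^sup>2))"
    by (intro mult_left_mono ennreal_leI inverse_sqrt_le_exp y) auto
  also have "\<dots> = ennreal (exp (4 * t\<^sup>2 * (\<sigma>\<^sup>2)\<^sup>2))"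
    by (simp add: ennreal_mult'[symmetric] exp_add[symmetric] power_mult_distrib mult_ac)
  also have "\<dots> \<le> ennreal (exp (4 * t\<^sup>2 * 2\<^sup>2))"
    using \<sigma>(2) by (intro ennreal_leI iffD2[OF exp_le_cancel_iff] mult_left_mono power_mono) auto
  finally show ?thesis by simp
qed

subsection \<open>The Gaussian ensemble\<close>

definition goe_entry :: "nat \<times> nat \<Rightarrow> real measure" where
  "goe_entry p = normal_law (if fst p = snd p then sqrt 2 else 1)"

definition goe_var :: "nat \<times> nat \<Rightarrow> real" where
  "goe_var p = (if fst p = snd p then 2 else 1)"

lemma gauss_ens_eq: "gauss_ens n = PiM (upper_idx n) goe_entry"
proof -
  have "(\<lambda>p. if fst p = snd p then density lborel (\<lambda>x. ennreal (normal_density 0 (sqrt 2) x))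
       else density lborel (\<lambda>x. ennreal (normal_density 0 1 x))) = goe_entry"
    by (auto simp: goe_entry_def normal_law_def fun_eq_iff)
  then show ?thesis by (simp only: gauss_ens_def upper_idx_def)
qed

lemma gauss_like_goe_entry: "gauss_like (goe_entry p) (goe_var p)"
  using gauss_like_normal_law[of "sqrt 2"] gauss_like_normal_law[of 1]
  by (simp add: goe_entry_def goe_var_def)

lemma prob_space_goe_entry: "prob_space (goe_entry p)"
  using gauss_like_goe_entry[of p] by (simp add: gauss_like_def)

lemma prob_space_gauss_ens: "prob_space (gauss_ens n)"
  unfolding gauss_ens_eq by (intro prob_space_PiM prob_space_goe_entry)

lemma sets_goe_entry: "sets (goe_entry p) = sets borel"
  using gauss_like_goe_entry[of p] by (simp add: gauss_like_def)

lemma goe_entry_measurable: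
  "p \<in> upper_idx n \<Longrightarrow> (\<lambda>x. x p) \<in> borel_measurable (gauss_ens n)"
  unfolding gauss_ens_eq by (rule borel_measurable_component[OF sets_goe_entry])

text \<open>Chernoff bound for a sum of independent squares; the sign \<open>w\<close> selects the
  tail. The mean is n + 1 because the diagonal entry of the row has variance 2.\<close>

lemma goe_row_tail_one_sided:
  fixes w e :: real
  assumes i: "i < n" and e: "0 < e" "e \<le> 1" and w: "w = 1 \<or> w = -1"
  shows "measure (gauss_ens n) {x\<in>space (gauss_ens n). w * ((\<Sum>b<n. (x (row_idx i b))\<^sup>2) - (real n + 1)) \<ge> n * e / 2} \<le> exp (- e\<^sup>2 / 256 * n)"
proof -
  interpret product_prob_space goe_entry "upper_idx n" by (rule product_prob_spaceI) (rule prob_space_goe_entry)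
  \<comment> \<open>Minimises - t n e / 2 + 16 t^2 n; the resulting exponent is - e^2 n /
    256.\<close>
  define t where "t = e / 64"
  have t: "t > 0" "t \<le> 1/8" using e by (auto simp: t_def)
  have wt: "\<bar>t * w\<bar> \<le> 1/8" "(t * w)\<^sup>2 = t\<^sup>2" using t w by auto
  have ri: "row_idx i b \<in> upper_idx n" if "b < n" for b using i that by (auto simp: row_idx_def upper_idx_def)
  have ms: "(\<lambda>x. w * ((\<Sum>b<n. (x (row_idx i b))\<^sup>2) - (real n + 1))) \<in> borel_measurable (gauss_ens n)"
    using goe_entry_measurable ri by measurable
  let ?J = "{p\<in>upper_idx n. fst p = i \<or> snd p = i}"
  have vsum: "(\<Sum>b<n. goe_var (row_idx i b)) = real n + 1"
  proof -
    have "(\<Sum>b<n. goe_var (row_idx i b)) = (\<Sum>b<n. 1 + (if b = i then 1 else 0))"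
      by (intro sum.cong refl) (auto simp: goe_var_def row_idx_def min_def max_def)
    then show ?thesis using i by (simp add: sum.distrib)
  qed
  have mg: "(\<integral>\<^sup>+ x. ennreal (exp (t * (w * ((\<Sum>b<n. (x (row_idx i b))\<^sup>2) - (real n + 1))))) \<partial>gauss_ens n) \<le> ennreal (exp (16 * t\<^sup>2 * n))"
  proof -
    define f where "f p y = (if p \<in> ?J then ennreal (exp ((t * w) * (y\<^sup>2 - goe_var p))) else 1)" for p and y :: real
    have "ennreal (exp (t * (w * ((\<Sum>b<n. (x (row_idx i b))\<^sup>2) - (real n + 1))))) = (\<Prod>p\<in>upper_idx n. f p (x p))" for x
    proof -
      have "t * (w * ((\<Sum>b<n. (x (row_idx i b))\<^sup>2) - (real n + 1))) = (\<Sum>b<n. (t * w) * ((x (row_idx i b))\<^sup>2 - goe_var (row_idx i b)))"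
        unfolding vsum[symmetric] sum_subtractf[symmetric] sum_distrib_left by (simp add: mult_ac)
      also have "\<dots> = (\<Sum>p\<in>?J. (t * w) * ((x p)\<^sup>2 - goe_var p))" by (rule sum_row_idx[OF i, symmetric])
      finally have "ennreal (exp (t * (w * ((\<Sum>b<n. (x (row_idx i b))\<^sup>2) - (real n + 1))))) = (\<Prod>p\<in>?J. ennreal (exp ((t * w) * ((x p)\<^sup>2 - goe_var p))))"
        by (simp add: exp_sum prod_ennreal)
      also have "\<dots> = (\<Prod>p\<in>upper_idx n. f p (x p))"
        unfolding f_def by (simp add: prod.If_cases Int_def)
      finally show ?thesis .
    qed
    then have "(\<integral>\<^sup>+ x. ennreal (exp (t * (w * ((\<Sum>b<n. (x (row_idx i b))\<^sup>2) - (real n + 1))))) \<partial>gauss_ens n)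
        = (\<Prod>p\<in>upper_idx n. (\<integral>\<^sup>+ y. f p y \<partial>goe_entry p))"
      unfolding gauss_ens_eq
      by (simp only:) (rule product_nn_integral_prod, auto simp: f_def measurable_cong_sets[OF sets_goe_entry refl])
    also have "\<dots> \<le> (\<Prod>p\<in>upper_idx n. if p \<in> ?J then ennreal (exp (16 * t\<^sup>2)) else 1)"
    proof (rule prod_mono_ennreal)
      fix p assume "p \<in> upper_idx n"
      show "(\<integral>\<^sup>+ y. f p y \<partial>goe_entry p) \<le> (if p \<in> ?J then ennreal (exp (16 * t\<^sup>2)) else 1)"
      proof (cases "p \<in> ?J")
        case True
        have "(\<integral>\<^sup>+ x. ennreal (exp ((t * w) * (x\<^sup>2 - goe_var p))) \<partial>goe_entry p) \<le> ennreal (exp (16 * (t * w)\<^sup>2))"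
          using normal_law_square_mgf_le[OF _ _ wt(1), of "sqrt 2"] normal_law_square_mgf_le[OF _ _ wt(1), of 1]
          by (simp add: goe_entry_def goe_var_def)
        then show ?thesis using True wt by (simp add: f_def)
      next
        case False
        then have "f p = (\<lambda>_. 1)" by (auto simp: f_def fun_eq_iff)
        then show ?thesis using False prob_space.emeasure_space_1[OF prob_space_goe_entry[of p]] by auto
      qed
    qed
    also have "\<dots> = (\<Prod>p\<in>?J. ennreal (exp (16 * t\<^sup>2)))" by (simp add: prod.If_cases Int_def)
    also have "\<dots> = ennreal (exp (16 * t\<^sup>2)) ^ n"
      using bij_betw_same_card[OF bij_betw_row_idx[OF i]] by simp
    also have "\<dots> = ennreal (exp (16 * t\<^sup>2 * n))"
      by (simp add: ennreal_power exp_of_nat_mult[symmetric] mult_ac)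
    finally show ?thesis .
  qed
  have "measure (gauss_ens n) {x\<in>space (gauss_ens n). w * ((\<Sum>b<n. (x (row_idx i b))\<^sup>2) - (real n + 1)) \<ge> n * e / 2} \<le> exp (- t * (n * e / 2)) * exp (16 * t\<^sup>2 * n)"
    by (rule measure_ge_le_exp[OF prob_space_gauss_ens ms t(1) mg]) simp
  also have "\<dots> = exp (- e\<^sup>2 / 256 * n)"
    by (simp add: exp_add[symmetric] t_def power2_eq_square algebra_simps)
  finally show ?thesis .
qed

lemma goe_row_tail:
  fixes e :: real
  assumes i: "i < n" and e: "0 < e" "e \<le> 1" and n: "2 \<le> real n * e"
  shows "measure (gauss_ens n) {x\<in>space (gauss_ens n). \<bar>(\<Sum>b<n. (sym_mat (\<lambda>p. x p / sqrt n) i b)\<^sup>2) - 1\<bar> > e}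
     \<le> 2 * exp (- e\<^sup>2 / 256 * n)"
proof -
  interpret prob_space "gauss_ens n" by (rule prob_space_gauss_ens)
  have n0: "n > 0" using i by simp
  let ?S = "\<lambda>x. (\<Sum>b<n. (x (row_idx i b))\<^sup>2)"
  let ?B = "\<lambda>w. {x\<in>space (gauss_ens n). w * (?S x - (real n + 1)) \<ge> n * e / 2}"
  have ri: "row_idx i b \<in> upper_idx n" if "b < n" for b using i that by (auto simp: row_idx_def upper_idx_def)
  have [measurable]: "?S \<in> borel_measurable (gauss_ens n)"
    using goe_entry_measurable ri by measurable
  have "measure (gauss_ens n) {x\<in>space (gauss_ens n). \<bar>(\<Sum>b<n. (sym_mat (\<lambda>p. x p / sqrt n) i b)\<^sup>2) - 1\<bar> > e}
     \<le> measure (gauss_ens n) (?B 1 \<union> ?B (-1))"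
  proof (intro finite_measure_mono subsetI)
    fix x assume x: "x \<in> {x\<in>space (gauss_ens n). \<bar>(\<Sum>b<n. (sym_mat (\<lambda>p. x p / sqrt n) i b)\<^sup>2) - 1\<bar> > e}"
    have "(\<Sum>b<n. (sym_mat (\<lambda>p. x p / sqrt n) i b)\<^sup>2) = ?S x / n"
      by (simp add: sym_mat_row_idx power_divide sum_divide_distrib)
    with x have "\<bar>?S x / n - 1\<bar> > e" by simp
    then consider "?S x / n - 1 > e" | "1 - ?S x / n > e" by linarith
    then have "?S x - n > n * e \<or> n - ?S x > n * e"
      by cases (use n0 in \<open>auto simp: field_simps\<close>)
    \<comment> \<open>The shift of the mean from n to n + 1 is absorbed by half of the deviation,
      since 1 <= n e / 2.\<close>
    then have "?S x - (real n + 1) \<ge> n * e / 2 \<or> - (?S x - (real n + 1)) \<ge> n * e / 2"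
      using n by auto
    then show "x \<in> ?B 1 \<union> ?B (-1)" using x by auto
  qed measurable
  also have "\<dots> \<le> measure (gauss_ens n) (?B 1) + measure (gauss_ens n) (?B (-1))"
    by (rule measure_Un_le) measurable
  also have "\<dots> \<le> exp (- e\<^sup>2 / 256 * n) + exp (- e\<^sup>2 / 256 * n)"
    by (intro add_mono goe_row_tail_one_sided i e) auto
  finally show ?thesis by simp
qed

section \<open>Off-diagonal entries of the resolvent\<close>

definition row_form :: "nat \<Rightarrow> nat \<Rightarrow> nat \<Rightarrow> complex \<Rightarrow> (nat \<times> nat \<Rightarrow> real) \<Rightarrow> complex" where
  "row_form n i j z g = (\<Sum>c\<in>{..<n}-{i}. of_real (sym_mat g i c) * res n (sym_mat (zero_row i g)) z c j)"

text \<open>By \<open>res_row_eq\<close> an off-diagonal entry R_ij equals - R_ii times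
  \<open>row_form\<close>. Given the other rows this form is linear in independent Gaussians; its
  projection on the direction \<open>w\<close> has variance at most 1 / (4 n) by Ward's identity and
  q >= 2.\<close>

lemma row_form_tail:
  fixes e q :: real and w :: complex
  assumes q: "q \<ge> 2" and ij: "i < n" "j < n" and e: "e > 0" and w: "cmod w = 1"
  shows "measure (gauss_ens n) {x\<in>space (gauss_ens n). Re (w * row_form n i j (Complex 0 q) (\<lambda>p. x p / sqrt n)) \<ge> e}
     \<le> exp (- 2 * e\<^sup>2 * n)"
proof -
  have n0: "n > 0" using ij by simp
  let ?z = "Complex 0 q"
  have q0: "Im ?z = q" "q > 0" using q by auto
  \<comment> \<open>Minimises the Chernoff exponent - t e + t^2 / (8 n).\<close>
  define t where "t = 4 * n * e"
  have t: "t > 0" using e n0 by (simp add: t_def)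
  have ms: "(\<lambda>x. row_form n i j ?z (\<lambda>p. x p / sqrt n)) \<in> borel_measurable (gauss_ens n)"
    unfolding row_form_def gauss_ens_eq
    by (intro borel_measurable_sum borel_measurable_times measurable_compose[OF _ borel_measurable_of_real]
        measurable_res_entries(2)[OF gauss_like_goe_entry n0] measurable_sym_mat_entry[OF gauss_like_goe_entry n0])
       (use ij q0 in auto)
  then have [measurable]: "(\<lambda>x. row_form n i j ?z (\<lambda>p. x p / sqrt n)) \<in> borel_measurable (PiM (upper_idx n) goe_entry)"
    by (simp add: gauss_ens_eq)
  have "(\<integral>\<^sup>+ x. ennreal (exp (t * Re (w * row_form n i j ?z (\<lambda>p. x p / sqrt n)))) \<partial>gauss_ens n) \<le> ennreal (exp (t\<^sup>2 / (8 * n)))"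
    unfolding gauss_ens_eq
  proof (rule nn_integral_upper_idx_le[OF prob_space_goe_entry _ ij(1)])
    fix x
    let ?O = "{p\<in>upper_idx n. \<not> (fst p = i \<or> snd p = i)}" and ?J = "{p\<in>upper_idx n. fst p = i \<or> snd p = i}"
    interpret product_prob_space goe_entry ?J by (rule product_prob_spaceI) (rule prob_space_goe_entry)
    define S where "S = res n (sym_mat (zero_row i (\<lambda>p. x p / sqrt n))) ?z"
    define a where "a c = (if c = i then 0 else Re (w * S c j) / sqrt n)" for c
    have sq: "(\<Sum>c<n. (a c)\<^sup>2) \<le> 1 / (4 * n)"
    proof -
      have "(\<Sum>c<n. (a c)\<^sup>2) \<le> (\<Sum>c<n. (cmod (S j c))\<^sup>2 / n)"
      proof (intro sum_mono)
        fix c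
        have "\<bar>Re (w * S c j)\<bar> \<le> cmod (S j c)"
          using abs_Re_le_cmod[of "w * S c j"] w res_commute[OF q0] by (simp add: norm_mult S_def)
        then have "(Re (w * S c j))\<^sup>2 \<le> (cmod (S j c))\<^sup>2" by (metis abs_le_square_iff abs_norm_cancel)
        then show "(a c)\<^sup>2 \<le> (cmod (S j c))\<^sup>2 / n" by (simp add: a_def power_divide divide_right_mono)
      qed
      also have "\<dots> = (\<Sum>c<n. (cmod (S j c))\<^sup>2) / n" by (simp add: sum_divide_distrib)
      also have "\<dots> \<le> (1 / q\<^sup>2) / n"
        unfolding S_def by (intro divide_right_mono sum_norm_res_le'[OF q0 ij(2)]) auto
      also have "\<dots> \<le> (1 / 2\<^sup>2) / n" using q by (intro divide_right_mono divide_left_mono power_mono) auto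
      finally show ?thesis by simp
    qed
    have form: "Re (w * row_form n i j ?z (\<lambda>p. merge ?O ?J (x, y) p / sqrt n)) = (\<Sum>p\<in>?J. a (other_idx i p) * y p)" for y
    proof -
      have m: "sym_mat (\<lambda>p. merge ?O ?J (x, y) p / sqrt n) i b = y (row_idx i b) / sqrt n" if "b < n" for b
        unfolding sym_mat_row_idx row_merge[OF ij(1) that] ..
      have "row_form n i j ?z (\<lambda>p. merge ?O ?J (x, y) p / sqrt n) = (\<Sum>c\<in>{..<n}-{i}. of_real (y (row_idx i c) / sqrt n) * S c j)"
        unfolding row_form_def res_zero_row_merge S_def[symmetric]
      proof (intro sum.cong refl)
        fix c assume "c \<in> {..<n}-{i}"
        then have c: "c < n" by simp
        show "complex_of_real (sym_mat (\<lambda>p. merge ?O ?J (x, y) p / sqrt n) i c) * S c j = of_real (y (row_idx i c) / sqrt n) * S c j"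
          unfolding m[OF c] ..
      qed
      then have "Re (w * row_form n i j ?z (\<lambda>p. merge ?O ?J (x, y) p / sqrt n)) = (\<Sum>c\<in>{..<n}-{i}. Re (w * S c j) / sqrt n * y (row_idx i c))"
      proof -
        have "Re (w * (of_real r * s)) = Re (w * s) * r" for r s
          by (simp add: algebra_simps)
        moreover assume "row_form n i j ?z (\<lambda>p. merge ?O ?J (x, y) p / sqrt n) = (\<Sum>c\<in>{..<n}-{i}. of_real (y (row_idx i c) / sqrt n) * S c j)"
        ultimately show ?thesis
          by (simp add: sum_distrib_left Re_sum del: of_real_divide times_complex.sel)
      qed
      also have "\<dots> = (\<Sum>c<n. a c * y (row_idx i c))"
        by (intro sum.mono_neutral_cong_left) (auto simp: a_def)
      also have "\<dots> = (\<Sum>p\<in>?J. a (other_idx i p) * y p)"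
        by (simp add: sum_row_idx[OF ij(1)])
      finally show ?thesis .
    qed
    have "(\<integral>\<^sup>+ y. ennreal (exp (t * Re (w * row_form n i j ?z (\<lambda>p. merge ?O ?J (x, y) p / sqrt n)))) \<partial>PiM ?J goe_entry)
       = (\<integral>\<^sup>+ y. (\<Prod>p\<in>?J. ennreal (exp (t * a (other_idx i p) * y p))) \<partial>PiM ?J goe_entry)"
      unfolding form by (intro nn_integral_cong) (simp add: sum_distrib_left exp_sum prod_ennreal mult_ac)
    also have "\<dots> = (\<Prod>p\<in>?J. (\<integral>\<^sup>+ y. ennreal (exp (t * a (other_idx i p) * y)) \<partial>goe_entry p))"
      by (rule product_nn_integral_prod) (auto simp: measurable_cong_sets[OF sets_goe_entry refl])
    also have "\<dots> = (\<Prod>p\<in>?J. ennreal (exp ((t * a (other_idx i p))\<^sup>2 / 2)))"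
    proof (rule prod.cong[OF refl])
      fix p assume p: "p \<in> ?J"
      show "(\<integral>\<^sup>+ y. ennreal (exp (t * a (other_idx i p) * y)) \<partial>goe_entry p) = ennreal (exp ((t * a (other_idx i p))\<^sup>2 / 2))"
      \<comment> \<open>The coordinate (i, i), the one with variance 2, has coefficient 0; all the
        others have variance 1.\<close>
      proof (cases "fst p = snd p")
        case True
        then have "a (other_idx i p) = 0" using p by (auto simp: other_idx_def a_def)
        then show ?thesis using prob_space.emeasure_space_1[OF prob_space_goe_entry[of p]] by simp
      next
        case False
        then show ?thesis using normal_law_mgf[of 1 "t * a (other_idx i p)"] by (simp add: goe_entry_def)
      qed
    qed
    also have "\<dots> = ennreal (exp (\<Sum>p\<in>?J. (t * a (other_idx i p))\<^sup>2 / 2))"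
      by (simp add: exp_sum prod_ennreal)
    also have "(\<Sum>p\<in>?J. (t * a (other_idx i p))\<^sup>2 / 2) = t\<^sup>2 / 2 * (\<Sum>c<n. (a c)\<^sup>2)"
      by (simp add: sum_row_idx[OF ij(1)] power_mult_distrib sum_distrib_left)
    also have "ennreal (exp (t\<^sup>2 / 2 * (\<Sum>c<n. (a c)\<^sup>2))) \<le> ennreal (exp (t\<^sup>2 / 2 * (1 / (4 * n))))"
      by (intro ennreal_leI iffD2[OF exp_le_cancel_iff] mult_left_mono sq) auto
    finally show "(\<integral>\<^sup>+ y. ennreal (exp (t * Re (w * row_form n i j ?z (\<lambda>p. merge ?O ?J (x, y) p / sqrt n)))) \<partial>PiM ?J goe_entry)
       \<le> ennreal (exp (t\<^sup>2 / (8 * n)))" by simp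
  qed measurable
  then have "measure (gauss_ens n) {x\<in>space (gauss_ens n). Re (w * row_form n i j ?z (\<lambda>p. x p / sqrt n)) \<ge> e} \<le> exp (- t * e) * exp (t\<^sup>2 / (8 * n))"
    using ms by (intro measure_ge_le_exp[OF prob_space_gauss_ens _ t]) auto
  also have "\<dots> = exp (- 2 * e\<^sup>2 * n)"
    using n0 by (simp add: exp_add[symmetric] t_def power2_eq_square field_simps)
  finally show ?thesis .
qed

text \<open>As |R_ii| <= 1/2, a large R_ij forces |row_form| > 2 e, and then the real or the
  imaginary part has modulus at least \<open>e\<close>. The four units 1, -1, i, -i turn this into
  one-sided events.\<close>

lemma goe_offdiag_tail:
  fixes e q :: real
  assumes q: "q \<ge> 2" and ij: "i < n" "j < n" "i \<noteq> j" and e: "e > 0"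
  shows "measure (gauss_ens n) {x\<in>space (gauss_ens n). cmod (res n (sym_mat (\<lambda>p. x p / sqrt n)) (Complex 0 q) i j) > e}
     \<le> 4 * exp (- 2 * e\<^sup>2 * n)"
proof -
  interpret prob_space "gauss_ens n" by (rule prob_space_gauss_ens)
  have n0: "n > 0" using ij by simp
  let ?z = "Complex 0 q"
  have q0: "Im ?z = q" "q > 0" using q by auto
  let ?Z = "\<lambda>x. row_form n i j ?z (\<lambda>p. x p / sqrt n)"
  let ?B = "\<lambda>w. {x\<in>space (gauss_ens n). Re (w * ?Z x) \<ge> e}"
  have [measurable]: "?Z \<in> borel_measurable (gauss_ens n)"
    unfolding row_form_def gauss_ens_eq
    by (intro borel_measurable_sum borel_measurable_times measurable_compose[OF _ borel_measurable_of_real]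
        measurable_res_entries(2)[OF gauss_like_goe_entry n0] measurable_sym_mat_entry[OF gauss_like_goe_entry n0])
       (use ij q0 in auto)
  have Bm: "?B w \<in> sets (gauss_ens n)" for w by measurable
  have "measure (gauss_ens n) {x\<in>space (gauss_ens n). cmod (res n (sym_mat (\<lambda>p. x p / sqrt n)) ?z i j) > e}
     \<le> measure (gauss_ens n) (\<Union>w\<in>{1, -1, \<i>, -\<i>}. ?B w)"
  proof (intro finite_measure_mono subsetI)
    fix x assume x: "x \<in> {x\<in>space (gauss_ens n). cmod (res n (sym_mat (\<lambda>p. x p / sqrt n)) ?z i j) > e}"
    let ?R = "res n (sym_mat (\<lambda>p. x p / sqrt n)) ?z"
    have "cmod (?R i j) = cmod (?R i i) * cmod (?Z x)"
      using res_row_eq[OF q0 ij(1,2) ij(3)[symmetric], of "\<lambda>p. x p / sqrt n"] by (simp add: row_form_def norm_mult)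
    also have "\<dots> \<le> 1/2 * cmod (?Z x)"
    proof (rule mult_right_mono)
      have "cmod (?R i i) \<le> 1 / q" by (rule norm_res_le[OF q0 ij(1,1)])
      also have "\<dots> \<le> 1/2" using q by (simp add: field_simps)
      finally show "cmod (?R i i) \<le> 1/2" .
    qed auto
    finally have "2 * e < cmod (?Z x)" using x by simp
    also have "\<dots> \<le> \<bar>Re (?Z x)\<bar> + \<bar>Im (?Z x)\<bar>" by (rule cmod_le)
    finally have "Re (?Z x) \<ge> e \<or> - Re (?Z x) \<ge> e \<or> - Im (?Z x) \<ge> e \<or> Im (?Z x) \<ge> e" by linarith
    then show "x \<in> (\<Union>w\<in>{1, -1, \<i>, -\<i>}. ?B w)" using x by auto
  qed (intro sets.finite_UN Bm, auto)
  also have "\<dots> \<le> (\<Sum>w\<in>{1, -1, \<i>, -\<i>}. measure (gauss_ens n) (?B w))"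
    by (rule finite_measure_subadditive_finite) (auto intro: Bm)
  also have "\<dots> \<le> (\<Sum>w\<in>{1, -1, \<i>, -\<i>}. exp (- 2 * e\<^sup>2 * n))"
    by (intro sum_mono row_form_tail[OF q ij(1,2) e]) auto
  also have "\<dots> = real (card {1, -1, \<i>, -\<i>}) * exp (- 2 * e\<^sup>2 * n)" by simp
  also have "\<dots> \<le> 4 * exp (- 2 * e\<^sup>2 * n)"
  proof (rule mult_right_mono)
    have "card {1, -1, \<i>, -\<i>} \<le> 4" by (simp add: card_insert_if)
    then show "real (card {1, -1, \<i>, -\<i>}) \<le> 4" by linarith
  qed auto
  finally show ?thesis .
qed

text \<open>The normalised profile has entries at most 2 / n, the 2 coming from the diagonal, and
  off-diagonal row sums (n - 1) / n, so the mean row-sum defect is 1 / n and the smallness condition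
  holds eventually.\<close>

lemma goe_res_dev_tail:
  fixes e q :: real
  assumes q: "q \<ge> 2" and e: "e > 0"
  shows "\<forall>\<^sub>F n in sequentially. measure (gauss_ens n) {x\<in>space (gauss_ens n). res_dev n (\<lambda>p. x p / sqrt n) 1 q \<ge> e}
     \<le> exp (- e\<^sup>2 / 72 * n)"
proof -
  have l0: "(\<lambda>n. c / real n) \<longlonglongrightarrow> 0" for c :: real by (rule lim_const_over_n)
  have s0: "(\<lambda>n. sqrt (2 / real n)) \<longlonglongrightarrow> 0" using tendsto_real_sqrt[OF l0[of 2]] by simp
  have "(\<lambda>n. 2 * sqrt (2 / real n) + sqrt (2 / real n) * (1 / real n) + 2 / real n + 1 / real n) \<longlonglongrightarrow> 2 * 0 + 0 * 0 + 0 + 0"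
    by (intro tendsto_intros s0 l0)
  then have "\<forall>\<^sub>F n in sequentially. 2 * sqrt (2 / real n) + sqrt (2 / real n) * (1 / real n) + 2 / real n + 1 / real n < e/2"
    using e by (intro order_tendstoD(2)[of _ 0]) auto
  with eventually_gt_at_top[of 0] show ?thesis
  proof eventually_elim
    case (elim n)
    have rs: "row_sum n (\<lambda>p. goe_var p / n) i = (real n - 1) / n" if "i < n" for i
    proof -
      have "row_sum n (\<lambda>p. goe_var p / n) i = (\<Sum>j\<in>{..<n}-{i}. 1 / n)"
        unfolding row_sum_def by (intro sum.cong refl) (auto simp: sym_mat_def goe_var_def)
      then show ?thesis using that by simp
    qed
    have ee: "1 / n = (\<Sum>i<n. \<bar>row_sum n (\<lambda>p. goe_var p / n) i - 1\<^sup>2\<bar>) / n"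
    proof -
      have "(\<Sum>i<n. \<bar>row_sum n (\<lambda>p. goe_var p / n) i - 1\<^sup>2\<bar>) = (\<Sum>i<n. 1 / n)"
      proof (intro sum.cong refl)
        fix i assume "i \<in> {..<n}"
        then have "row_sum n (\<lambda>p. goe_var p / n) i - 1\<^sup>2 = - (1 / n)" using elim by (simp add: rs diff_divide_distrib)
        then show "\<bar>row_sum n (\<lambda>p. goe_var p / n) i - 1\<^sup>2\<bar> = 1 / n" by simp
      qed
      then show ?thesis using elim by simp
    qed
    show ?case
      unfolding gauss_ens_eq
      by (rule prob_res_dev_le[OF gauss_like_goe_entry elim(1) q _ _ _ _ ee, where \<delta> = "2 / n"])
         (use elim e in \<open>auto simp: goe_var_def divide_right_mono\<close>)
  qed
qed

subsection \<open>A good event of probability at least \<open>1 - n\<^sup>-\<^sup>3\<close>\<close>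

lemma eventually_poly_exp_le:
  fixes b c C :: real
  assumes b: "b > 0" and c: "c > 0"
  shows "\<forall>\<^sub>F n in sequentially. real n ^ k * (C * exp (- b * real n)) \<le> c"
proof -
  have "filterlim (\<lambda>n. b * real n) at_top sequentially"
    by (rule filterlim_tendsto_pos_mult_at_top[OF tendsto_const b filterlim_real_sequentially])
  from filterlim_compose[OF tendsto_power_div_exp_0[of k] this]
  have "(\<lambda>n. C / b ^ k * ((b * real n) ^ k / exp (b * real n))) \<longlonglongrightarrow> C / b ^ k * 0"
    by (intro tendsto_intros)
  then have "\<forall>\<^sub>F n in sequentially. C / b ^ k * ((b * real n) ^ k / exp (b * real n)) < c"
    using c by (intro order_tendstoD(2)) auto
  then show ?thesis
    by eventually_elim (use b in \<open>simp add: power_mult_distrib exp_minus field_simps\<close>)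
qed

text \<open>Since each \<open>E k\<close> fails with probability \<open>o(n\<^sup>-\<^sup>3)\<close>, imposing \<open>E k\<close> only from a sufficiently large \<open>n\<close> on
  makes the failure probabilities summable over \<open>k\<close>.\<close>

lemma eventually_good_event:
  fixes M :: "nat \<Rightarrow> 'a measure" and E :: "nat \<Rightarrow> nat \<Rightarrow> 'a set"
  assumes ps: "\<And>n. prob_space (M n)" and E: "\<And>k n. E k n \<in> sets (M n)"
    and lim: "\<And>k c. c > 0 \<Longrightarrow> \<forall>\<^sub>F n in sequentially. real n ^ 3 * measure (M n) (space (M n) - E k n) \<le> c"
  obtains G where "\<And>n. G n \<in> sets (M n)" "\<And>n. n > 0 \<Longrightarrow> measure (M n) (G n) \<ge> 1 - 1 / real n ^ 3"
    "\<And>k. \<forall>\<^sub>F n in sequentially. G n \<subseteq> E k n"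
proof -
  define w where "w k = (1/2 :: real) ^ Suc k" for k
  have "\<exists>N. \<forall>n\<ge>N. real n ^ 3 * measure (M n) (space (M n) - E k n) \<le> w k" for k
    using lim[of "w k" k] by (simp add: eventually_sequentially w_def)
  then obtain N where N: "\<And>k n. n \<ge> N k \<Longrightarrow> real n ^ 3 * measure (M n) (space (M n) - E k n) \<le> w k"
    by metis
  define B where "B k n = (if N k \<le> n then space (M n) - E k n else {})" for k n
  define G where "G n = space (M n) - (\<Union>k. B k n)" for n
  have B: "B k n \<in> sets (M n)" for k n using E by (auto simp: B_def)
  have "G n \<in> sets (M n)" for n unfolding G_def using B by auto
  moreover have "measure (M n) (G n) \<ge> 1 - 1 / real n ^ 3" if n: "n > 0" for n
  proof -
    interpret prob_space "M n" by (rule ps)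
    have le: "measure (M n) (B k n) \<le> w k / real n ^ 3" for k
      using N[of k n] n by (auto simp: B_def w_def field_simps)
    have s: "(\<lambda>k. w k / real n ^ 3) sums (1 / real n ^ 3)"
      unfolding w_def by (intro sums_divide power_half_series)
    have sm: "summable (\<lambda>k. measure (M n) (B k n))"
      by (rule summable_comparison_test'[OF sums_summable[OF s], of 0]) (use le in auto)
    have "measure (M n) (\<Union>k. B k n) \<le> (\<Sum>k. measure (M n) (B k n))"
      by (rule finite_measure_subadditive_countably) (use B sm in auto)
    also have "\<dots> \<le> (\<Sum>k. w k / real n ^ 3)"
      by (rule suminf_le[OF le sm sums_summable[OF s]])
    also have "\<dots> = 1 / real n ^ 3" by (rule sums_unique[OF s, symmetric])
    finally show ?thesis unfolding G_def using B by (subst prob_compl) auto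
  qed
  moreover have "\<forall>\<^sub>F n in sequentially. G n \<subseteq> E k n" for k
    using eventually_ge_at_top[of "N k"]
    by eventually_elim (auto simp: G_def B_def)
  ultimately show ?thesis using that by blast
qed

definition goe_good :: "real \<Rightarrow> real \<Rightarrow> nat \<Rightarrow> (nat \<times> nat \<Rightarrow> real) set" where
  "goe_good e q n = {x\<in>space (gauss_ens n).
     (\<forall>i\<in>{..<n}. \<bar>(\<Sum>b<n. (sym_mat (\<lambda>p. x p / sqrt n) i b)\<^sup>2) - 1\<bar> \<le> e) \<and>
     res_dev n (\<lambda>p. x p / sqrt n) 1 q < e \<and>
     (\<forall>i\<in>{..<n}. \<forall>j\<in>{..<n}-{i}. cmod (res n (sym_mat (\<lambda>p. x p / sqrt n)) (Complex 0 q) i j) \<le> e)}"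

lemma goe_measurable:
  assumes "q > 0" "i < n" "j < n"
  shows "(\<lambda>x. sym_mat (\<lambda>p. x p / sqrt n) i j) \<in> borel_measurable (gauss_ens n)"
    "(\<lambda>x. res n (sym_mat (\<lambda>p. x p / sqrt n)) (Complex 0 q) i j) \<in> borel_measurable (gauss_ens n)"
  unfolding gauss_ens_eq
  using assms measurable_sym_mat_entry[OF gauss_like_goe_entry, of n i j]
    measurable_res_entries(1)[OF gauss_like_goe_entry, of n q i j] by auto

lemma goe_good_measurable:
  assumes "q > 0"
  shows "goe_good e q n \<in> sets (gauss_ens n)"
proof (cases "n = 0")
  case True
  then show ?thesis by (auto simp: goe_good_def res_dev_def)
next
  case False
  have [measurable]: "(\<lambda>x. res_dev n (\<lambda>p. x p / sqrt n) 1 q) \<in> borel_measurable (gauss_ens n)"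
    unfolding gauss_ens_eq using False assms by (intro measurable_res_dev[OF gauss_like_goe_entry]) auto
  have 1: "{x\<in>space (gauss_ens n). \<forall>i\<in>{..<n}. \<bar>(\<Sum>b<n. (sym_mat (\<lambda>p. x p / sqrt n) i b)\<^sup>2) - 1\<bar> \<le> e} \<in> sets (gauss_ens n)"
  proof (rule sets.sets_Collect_finite_All)
    fix i assume "i \<in> {..<n}"
    then have "(\<lambda>x. \<Sum>b<n. (sym_mat (\<lambda>p. x p / sqrt n) i b)\<^sup>2) \<in> borel_measurable (gauss_ens n)"
      using goe_measurable(1)[OF assms, of i n] by (intro borel_measurable_sum borel_measurable_power) auto
    then show "{x\<in>space (gauss_ens n). \<bar>(\<Sum>b<n. (sym_mat (\<lambda>p. x p / sqrt n) i b)\<^sup>2) - 1\<bar> \<le> e} \<in> sets (gauss_ens n)"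
      by measurable
  qed simp
  have 2: "{x\<in>space (gauss_ens n). \<forall>i\<in>{..<n}. \<forall>j\<in>{..<n}-{i}. cmod (res n (sym_mat (\<lambda>p. x p / sqrt n)) (Complex 0 q) i j) \<le> e} \<in> sets (gauss_ens n)"
  proof (intro sets.sets_Collect_finite_All)
    fix i j assume "i \<in> {..<n}" "j \<in> {..<n}-{i}"
    then have "(\<lambda>x. res n (sym_mat (\<lambda>p. x p / sqrt n)) (Complex 0 q) i j) \<in> borel_measurable (gauss_ens n)"
      by (intro goe_measurable(2)[OF assms]) auto
    then show "{x\<in>space (gauss_ens n). cmod (res n (sym_mat (\<lambda>p. x p / sqrt n)) (Complex 0 q) i j) \<le> e} \<in> sets (gauss_ens n)"
      by measurable
  qed auto
  have "goe_good e q n = {x\<in>space (gauss_ens n). \<forall>i\<in>{..<n}. \<bar>(\<Sum>b<n. (sym_mat (\<lambda>p. x p / sqrt n) i b)\<^sup>2) - 1\<bar> \<le> e}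
      \<inter> ({x\<in>space (gauss_ens n). res_dev n (\<lambda>p. x p / sqrt n) 1 q < e}
      \<inter> {x\<in>space (gauss_ens n). \<forall>i\<in>{..<n}. \<forall>j\<in>{..<n}-{i}. cmod (res n (sym_mat (\<lambda>p. x p / sqrt n)) (Complex 0 q) i j) \<le> e})"
    by (auto simp: goe_good_def)
  then show ?thesis using 1 2 by auto
qed

text \<open>Union bound over n row norms, one averaged deviation and fewer than n^2 off-diagonal
  entries. With the prefactor n^3 this leaves the powers 4, 3 and 5 of n against
  exponentials.\<close>

lemma goe_good_tail:
  assumes q: "q \<ge> 2" and e: "0 < e" "e \<le> 1" and c: "c > 0"
  shows "\<forall>\<^sub>F n in sequentially. real n ^ 3 * measure (gauss_ens n) (space (gauss_ens n) - goe_good e q n) \<le> c"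
proof -
  have c3: "c/3 > 0" using c by simp
  have b: "e\<^sup>2 / 256 > 0" "e\<^sup>2 / 72 > 0" "2 * e\<^sup>2 > 0" using e by auto
  show ?thesis
    using eventually_gt_at_top[of 0] eventually_ge_at_top[of "nat \<lceil>2 / e\<rceil>"] goe_res_dev_tail[OF q e(1)]
      eventually_poly_exp_le[OF b(1) c3, of 4 2] eventually_poly_exp_le[OF b(2) c3, of 3 1] eventually_poly_exp_le[OF b(3) c3, of 5 4]
  proof eventually_elim
    case (elim n)
    interpret prob_space "gauss_ens n" by (rule prob_space_gauss_ens)
    have q0: "q > 0" using q by simp
    have ne: "2 \<le> real n * e"
    proof -
      have "2 / e \<le> real n" using elim(2) by linarith
      then show ?thesis using e by (simp add: field_simps)
    qed
    let ?A = "\<lambda>i. {x\<in>space (gauss_ens n). \<bar>(\<Sum>b<n. (sym_mat (\<lambda>p. x p / sqrt n) i b)\<^sup>2) - 1\<bar> > e}"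
    let ?D = "{x\<in>space (gauss_ens n). res_dev n (\<lambda>p. x p / sqrt n) 1 q \<ge> e}"
    let ?O = "\<lambda>i j. {x\<in>space (gauss_ens n). cmod (res n (sym_mat (\<lambda>p. x p / sqrt n)) (Complex 0 q) i j) > e}"
    have Dm: "?D \<in> events"
    proof -
      have [measurable]: "(\<lambda>x. res_dev n (\<lambda>p. x p / sqrt n) 1 q) \<in> borel_measurable (gauss_ens n)"
        unfolding gauss_ens_eq using elim(1) q0 by (intro measurable_res_dev[OF gauss_like_goe_entry]) auto
      show ?thesis by measurable
    qed
    have Am: "?A i \<in> events" if "i < n" for i
    proof -
      have "(\<lambda>x. \<Sum>b<n. (sym_mat (\<lambda>p. x p / sqrt n) i b)\<^sup>2) \<in> borel_measurable (gauss_ens n)"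
        using goe_measurable(1)[OF q0 that] by (intro borel_measurable_sum borel_measurable_power) auto
      then show ?thesis by measurable
    qed
    have Om: "?O i j \<in> events" if "i < n" "j < n" for i j
      using goe_measurable(2)[OF q0 that] by measurable
    have "measure (gauss_ens n) (space (gauss_ens n) - goe_good e q n)
      \<le> measure (gauss_ens n) ((\<Union>i\<in>{..<n}. ?A i) \<union> (?D \<union> (\<Union>i\<in>{..<n}. \<Union>j\<in>{..<n}-{i}. ?O i j)))"
    proof (intro finite_measure_mono subsetI)
      fix x assume "x \<in> space (gauss_ens n) - goe_good e q n"
      then show "x \<in> (\<Union>i\<in>{..<n}. ?A i) \<union> (?D \<union> (\<Union>i\<in>{..<n}. \<Union>j\<in>{..<n}-{i}. ?O i j))"
        unfolding goe_good_def by (auto simp: not_le not_less)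
    qed (intro sets.Un sets.finite_UN Am Om Dm, auto)
    also have "\<dots> \<le> measure (gauss_ens n) (\<Union>i\<in>{..<n}. ?A i) + (measure (gauss_ens n) ?D + measure (gauss_ens n) (\<Union>i\<in>{..<n}. \<Union>j\<in>{..<n}-{i}. ?O i j))"
      by (intro order.trans[OF measure_Un_le] add_left_mono measure_Un_le sets.Un sets.finite_UN Am Om Dm) auto
    also have "\<dots> \<le> real n * (2 * exp (- e\<^sup>2 / 256 * n)) + (exp (- e\<^sup>2 / 72 * n) + real n * (real n * (4 * exp (- 2 * e\<^sup>2 * n))))"
    proof (intro add_mono elim(3))
      have "measure (gauss_ens n) (\<Union>i\<in>{..<n}. ?A i) \<le> (\<Sum>i\<in>{..<n}. measure (gauss_ens n) (?A i))"
        by (rule finite_measure_subadditive_finite) (use Am in auto)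
      also have "\<dots> \<le> (\<Sum>i\<in>{..<n}. 2 * exp (- e\<^sup>2 / 256 * n))"
        by (intro sum_mono goe_row_tail e ne) auto
      finally show "measure (gauss_ens n) (\<Union>i\<in>{..<n}. ?A i) \<le> real n * (2 * exp (- e\<^sup>2 / 256 * n))" by simp
      have "measure (gauss_ens n) (\<Union>i\<in>{..<n}. \<Union>j\<in>{..<n}-{i}. ?O i j) \<le> (\<Sum>i\<in>{..<n}. measure (gauss_ens n) (\<Union>j\<in>{..<n}-{i}. ?O i j))"
        by (rule finite_measure_subadditive_finite) (use Om in \<open>auto intro!: sets.finite_UN\<close>)
      also have "\<dots> \<le> (\<Sum>i\<in>{..<n}. \<Sum>j\<in>{..<n}-{i}. measure (gauss_ens n) (?O i j))"
        by (intro sum_mono finite_measure_subadditive_finite) (use Om in auto)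
      also have "\<dots> \<le> (\<Sum>i\<in>{..<n}. \<Sum>j\<in>{..<n}-{i}. 4 * exp (- 2 * e\<^sup>2 * n))"
        by (intro sum_mono goe_offdiag_tail q e) auto
      also have "\<dots> \<le> (\<Sum>i\<in>{..<n}. \<Sum>j\<in>{..<n}. 4 * exp (- 2 * e\<^sup>2 * n))"
        by (intro sum_mono sum_mono2) auto
      finally show "measure (gauss_ens n) (\<Union>i\<in>{..<n}. \<Union>j\<in>{..<n}-{i}. ?O i j) \<le> real n * (real n * (4 * exp (- 2 * e\<^sup>2 * n)))"
        by simp
    qed
    finally have P: "measure (gauss_ens n) (space (gauss_ens n) - goe_good e q n)
      \<le> real n * (2 * exp (- e\<^sup>2 / 256 * n)) + (exp (- e\<^sup>2 / 72 * n) + real n * (real n * (4 * exp (- 2 * e\<^sup>2 * n))))" .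
    have "real n ^ 3 * measure (gauss_ens n) (space (gauss_ens n) - goe_good e q n)
      \<le> real n ^ 3 * (real n * (2 * exp (- e\<^sup>2 / 256 * n)) + (exp (- e\<^sup>2 / 72 * n) + real n * (real n * (4 * exp (- 2 * e\<^sup>2 * n)))))"
      by (intro mult_left_mono P) auto
    also have "\<dots> = real n ^ 4 * (2 * exp (- (e\<^sup>2 / 256) * n)) + real n ^ 3 * (1 * exp (- (e\<^sup>2 / 72) * n)) + real n ^ 5 * (4 * exp (- (2 * e\<^sup>2) * n))"
      by (simp add: distrib_left power_numeral_reduce mult_ac)
    also have "\<dots> \<le> c/3 + c/3 + c/3" by (intro add_mono elim)
    finally show ?case by simp
  qed
qed

text \<open>The event is chosen before the realisation \<open>g\<close> and has to serve every
  accuracy and every rational q at once. The requirements are therefore enumerated and combined by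
  \<open>eventually_good_event\<close>.\<close>

theorem exists_good_event:
  obtains G where "\<And>n. G n \<in> sets (gauss_ens n)" "\<And>n. n > 0 \<Longrightarrow> measure (gauss_ens n) (G n) \<ge> 1 - 1 / real n ^ 3"
    "\<And>g. \<forall>\<^sub>F m in sequentially. g m \<in> G (2 * m) \<Longrightarrow> gauss_seq (\<lambda>m. 2 * m) (\<lambda>m p. g m p / sqrt (real (2 * m)))"
proof -
  \<comment> \<open>The index k codes a pair of an accuracy and a rational q. The maximum with 2
    makes every code admissible and changes none of the q that are used.\<close>
  define ee where "ee k = 1 / real (Suc (fst (from_nat k :: nat \<times> rat)))" for k
  define qq where "qq k = max 2 (real_of_rat (snd (from_nat k :: nat \<times> rat)))" for k
  have eq: "0 < ee k" "ee k \<le> 1" "qq k \<ge> 2" for k by (auto simp: ee_def qq_def)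
  obtain G where G: "\<And>n. G n \<in> sets (gauss_ens n)" "\<And>n. n > 0 \<Longrightarrow> measure (gauss_ens n) (G n) \<ge> 1 - 1 / real n ^ 3"
    "\<And>k. \<forall>\<^sub>F n in sequentially. G n \<subseteq> goe_good (ee k) (qq k) n"
  proof (rule eventually_good_event[of gauss_ens "\<lambda>k n. goe_good (ee k) (qq k) n"])
    show "goe_good (ee k) (qq k) n \<in> sets (gauss_ens n)" for k n
      by (rule goe_good_measurable) (use eq[of k] in auto)
  qed (use prob_space_gauss_ens goe_good_tail eq in auto)
  have "gauss_seq (\<lambda>m. 2 * m) (\<lambda>m p. g m p / sqrt (real (2 * m)))"
    if g: "\<forall>\<^sub>F m in sequentially. g m \<in> G (2 * m)" for g
  proof -
    have ev: "\<forall>\<^sub>F m in sequentially. \<exists>e'\<le>e. g m \<in> goe_good e' q (2 * m)" if e: "e > 0" and q: "q \<in> \<rat>" "q \<ge> 2" for e q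
    proof -
      obtain j where j: "1 / real (Suc j) < e" using nat_approx_posE[OF e] by auto
      obtain r where r: "q = real_of_rat r" using q(1) by (auto elim: Rats_cases)
      obtain k where k: "from_nat k = (j, r)" using surj_from_nat by (metis surjD)
      have "ee k < e" "qq k = q" using j r q by (auto simp: ee_def qq_def k)
      have "filterlim (\<lambda>m::nat. 2 * m) sequentially sequentially"
        by (rule filterlim_subseq) (auto simp: strict_mono_def)
      with G(3)[of k] have "\<forall>\<^sub>F m in sequentially. G (2 * m) \<subseteq> goe_good (ee k) (qq k) (2 * m)"
        by (rule eventually_compose_filterlim)
      with g show ?thesis
      proof eventually_elim
        case (elim m)
        then show ?case using \<open>ee k < e\<close> \<open>qq k = q\<close> by (intro exI[of _ "ee k"]) auto
      qed
    qed
    show ?thesis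
    proof
      show "\<forall>\<^sub>F m in sequentially. (0::nat) < 2 * m" using eventually_gt_at_top[of 0] by eventually_elim simp
      show "(0::real) < 1" by simp
    next
      fix q :: real assume q: "q \<in> \<rat>" "q \<ge> 2"
      show "(\<lambda>m. res_dev (2 * m) (\<lambda>p. g m p / sqrt (real (2 * m))) 1 q) \<longlonglongrightarrow> 0"
      proof (rule tendstoI)
        fix e :: real assume "e > 0"
        from ev[OF this q] show "\<forall>\<^sub>F m in sequentially. dist (res_dev (2 * m) (\<lambda>p. g m p / sqrt (real (2 * m))) 1 q) 0 < e"
        proof eventually_elim
          case (elim m)
          have "res_dev (2 * m) (\<lambda>p. g m p / sqrt (real (2 * m))) 1 q \<ge> 0"
            unfolding res_dev_def by (intro divide_nonneg_nonneg sum_nonneg) auto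
          then show ?case using elim by (auto simp: goe_good_def dist_real_def)
        qed
      qed
    next
      fix q e :: real assume q: "q \<in> \<rat>" "q \<ge> 2" and e: "e > 0"
      from ev[OF e q] show "\<forall>\<^sub>F m in sequentially. \<forall>i<2 * m. \<forall>j<2 * m. i \<noteq> j \<longrightarrow>
         cmod (res (2 * m) (sym_mat (\<lambda>p. g m p / sqrt (real (2 * m)))) (Complex 0 q) i j) \<le> e"
        by eventually_elim (force simp: goe_good_def)
    next
      fix e :: real assume e: "e > 0"
      from ev[OF e, of 2] show "\<forall>\<^sub>F m in sequentially. \<forall>i<2 * m.
         \<bar>(\<Sum>j<2 * m. (sym_mat (\<lambda>p. g m p / sqrt (real (2 * m))) i j)\<^sup>2) - 1\<bar> \<le> e"
        by (auto elim!: eventually_mono simp: goe_good_def intro: order_trans)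
    qed
  qed
  with G show ?thesis using that by blast
qed

section \<open>The random sign matrix\<close>

definition sign_entry :: "(nat \<times> nat \<Rightarrow> real) \<Rightarrow> nat \<times> nat \<Rightarrow> bool \<Rightarrow> real" where
  "sign_entry a p b = (if fst p = snd p then 0 else if b then a p else - a p)"

definition sign_law :: "(nat \<times> nat \<Rightarrow> real) \<Rightarrow> nat \<times> nat \<Rightarrow> real measure" where
  "sign_law a p = distr (measure_pmf (bernoulli_pmf (1/2))) borel (sign_entry a p)"

text \<open>A symmetric two-point law has fourth moment v^2 <= 3 v^2 and vanishing odd moments; on
  the diagonal the law is the point mass at 0.\<close>

lemma gauss_like_sign_law:
  "gauss_like (sign_law a p) (if fst p = snd p then 0 else (a p)\<^sup>2)"
proof -
  have ps: "prob_space (sign_law a p)"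
    unfolding sign_law_def by (rule measure_pmf.prob_space_distr) simp
  have int: "integrable (sign_law a p) (\<lambda>x. x ^ k)" for k
    unfolding sign_law_def by (subst integrable_distr_eq) (auto intro: integrable_measure_pmf_finite)
  have ex: "(\<integral>x. x ^ k \<partial>sign_law a p) = (if fst p = snd p then 0 ^ k else ((a p) ^ k + (- a p) ^ k) / 2)" for k
    unfolding sign_law_def by (subst integral_distr) (auto simp: sign_entry_def field_simps)
  show ?thesis
    unfolding gauss_like_def
    using ps int ex[of 1] ex[of 2] ex[of 3] ex[of 4] by (auto simp: sign_law_def)
qed

lemma prob_space_sign_law: "prob_space (sign_law a p)"
  using gauss_like_sign_law[of a p] by (simp add: gauss_like_def)

lemma prob_space_sign_space: "prob_space sign_space"
  unfolding sign_space_def by (intro prob_space_PiM) (rule measure_pmf.prob_space_axioms)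

definition sign_sample :: "nat \<Rightarrow> (nat \<times> nat \<Rightarrow> real) \<Rightarrow> (nat \<times> nat \<times> nat \<Rightarrow> bool) \<Rightarrow> nat \<times> nat \<Rightarrow> real" where
  "sign_sample n a \<omega> p = sign_entry a p (\<omega> (n, p))"

lemma sign_coord_measurable: "(\<lambda>\<omega>. f (\<omega> (n, p))) \<in> measurable sign_space borel"
proof -
  have "(\<lambda>\<omega>. \<omega> (n, p)) \<in> measurable sign_space (measure_pmf (bernoulli_pmf (1/2)))"
    unfolding sign_space_def by (rule measurable_component_singleton) simp
  then show ?thesis by (rule measurable_compose) simp
qed

lemma sign_sample_measurable:
  "(\<lambda>\<omega>. \<lambda>p\<in>upper_idx n. sign_sample n a \<omega> p) \<in> measurable sign_space (PiM (upper_idx n) (sign_law a))"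
proof (rule measurable_restrict)
  fix p
  have "(\<lambda>\<omega>. sign_sample n a \<omega> p) \<in> measurable sign_space borel"
    unfolding sign_sample_def by (rule sign_coord_measurable)
  then show "(\<lambda>\<omega>. sign_sample n a \<omega> p) \<in> measurable sign_space (sign_law a p)"
    by (simp add: sign_law_def)
qed

text \<open>One probability space carries the signs for all sizes. At a fixed size the signed
  entries have the finite product law, so tail bounds proved on finite products transfer to
  \<open>sign_space\<close>.\<close>

lemma distr_sign_sample:
  "distr sign_space (PiM (upper_idx n) (sign_law a)) (\<lambda>\<omega>. \<lambda>p\<in>upper_idx n. sign_sample n a \<omega> p)
    = PiM (upper_idx n) (sign_law a)"
proof -
  interpret L: product_prob_space "sign_law a" "upper_idx n"
    by (rule product_prob_spaceI) (rule prob_space_sign_law)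
  interpret S: product_prob_space "\<lambda>p :: nat \<times> nat \<times> nat. measure_pmf (bernoulli_pmf (1/2))" UNIV
    by (rule product_prob_spaceI) (rule measure_pmf.prob_space_axioms)
  show ?thesis
  proof (rule L.PiM_eqI)
    fix X assume X: "\<And>p. p \<in> upper_idx n \<Longrightarrow> X p \<in> sets (sign_law a p)"
    let ?f = "\<lambda>\<omega>. \<lambda>p\<in>upper_idx n. sign_sample n a \<omega> p"
    have "emeasure (distr sign_space (PiM (upper_idx n) (sign_law a)) ?f) (PiE (upper_idx n) X)
       = emeasure sign_space (?f -` (PiE (upper_idx n) X) \<inter> space sign_space)"
      by (rule emeasure_distr[OF sign_sample_measurable]) (auto intro!: sets_PiM_I_finite X)
    also have "?f -` (PiE (upper_idx n) X) \<inter> space sign_space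
       = {\<omega>\<in>space sign_space. \<forall>k\<in>Pair n ` upper_idx n. \<omega> k \<in> sign_entry a (snd k) -` X (snd k)}"
      by (auto simp: sign_sample_def PiE_iff)
    also have "emeasure sign_space \<dots> = (\<Prod>k\<in>Pair n ` upper_idx n. emeasure (measure_pmf (bernoulli_pmf (1/2))) (sign_entry a (snd k) -` X (snd k)))"
      unfolding sign_space_def by (rule S.emeasure_PiM_Collect) auto
    also have "\<dots> = (\<Prod>p\<in>upper_idx n. emeasure (measure_pmf (bernoulli_pmf (1/2))) (sign_entry a p -` X p))"
      by (subst prod.reindex) (auto simp: inj_on_def)
    also have "\<dots> = (\<Prod>p\<in>upper_idx n. emeasure (sign_law a p) (X p))"
      using X by (intro prod.cong refl) (simp add: sign_law_def emeasure_distr)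
    finally show "emeasure (distr sign_space (PiM (upper_idx n) (sign_law a)) ?f) (PiE (upper_idx n) X)
       = (\<Prod>p\<in>upper_idx n. emeasure (sign_law a p) (X p))" .
  qed simp_all
qed

lemma res_dev_restrict: "res_dev n (\<lambda>p. restrict x (upper_idx n) p / c) \<alpha> q = res_dev n (\<lambda>p. x p / c) \<alpha> q"
proof -
  have "res n (sym_mat (\<lambda>p. restrict x (upper_idx n) p / c)) = res n (sym_mat (\<lambda>p. x p / c))"
    by (rule res_cong) (auto simp: sym_mat_def upper_idx_def)
  then show ?thesis by (simp add: res_dev_def)
qed

lemma sign_sample_res_dev_measurable:
  assumes "n > 0" "q > 0"
  shows "(\<lambda>\<omega>. res_dev n (\<lambda>p. sign_sample n a \<omega> p / sqrt n) \<alpha> q) \<in> borel_measurable sign_space"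
proof -
  have "(\<lambda>x. res_dev n (\<lambda>p. x p / sqrt n) \<alpha> q) \<in> borel_measurable (PiM (upper_idx n) (sign_law a))"
    by (rule measurable_res_dev[OF gauss_like_sign_law assms])
  from measurable_compose[OF sign_sample_measurable this]
  show ?thesis by (simp only: res_dev_restrict)
qed

text \<open>Smallness is required of the off-diagonal amplitudes alone: the diagonal of
  \<open>a\<close> will be the diagonal of B, which does not become small, but
  \<open>sign_entry\<close> sets it to 0 and \<open>row_sum\<close> skips it.\<close>

lemma sign_res_dev_tail:
  assumes n: "n > 0" and q: "q \<ge> 2" and \<alpha>: "0 < \<alpha>" "\<alpha> \<le> 1"
    and d: "\<And>p. p \<in> upper_idx n \<Longrightarrow> fst p \<noteq> snd p \<Longrightarrow> (a p)\<^sup>2 / n \<le> \<delta>" and d0: "\<delta> > 0"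
    and e: "e = (\<Sum>i<n. \<bar>row_sum n (\<lambda>p. (a p)\<^sup>2 / n) i - \<alpha>\<^sup>2\<bar>) / n"
    and small: "2 * sqrt \<delta> + sqrt \<delta> * e + \<delta> + e \<le> \<epsilon> / 2" and \<epsilon>: "\<epsilon> > 0"
  shows "measure sign_space {\<omega>\<in>space sign_space. res_dev n (\<lambda>p. sign_sample n a \<omega> p / sqrt n) \<alpha> q \<ge> \<epsilon>} \<le> exp (- \<epsilon>\<^sup>2 / 72 * n)"
proof -
  let ?P = "PiM (upper_idx n) (sign_law a)"
  let ?v = "\<lambda>p. if fst p = snd p then 0 else (a p)\<^sup>2"
  have q0: "q > 0" using q by simp
  note [measurable] = measurable_res_dev[OF gauss_like_sign_law[of a] n q0, of "sqrt n" \<alpha>]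
  have "measure sign_space {\<omega>\<in>space sign_space. res_dev n (\<lambda>p. sign_sample n a \<omega> p / sqrt n) \<alpha> q \<ge> \<epsilon>}
     = measure (distr sign_space ?P (\<lambda>\<omega>. \<lambda>p\<in>upper_idx n. sign_sample n a \<omega> p)) {x\<in>space ?P. res_dev n (\<lambda>p. x p / sqrt n) \<alpha> q \<ge> \<epsilon>}"
  proof (subst measure_distr[OF sign_sample_measurable])
    show "{x \<in> space ?P. \<epsilon> \<le> res_dev n (\<lambda>p. x p / sqrt n) \<alpha> q} \<in> sets ?P" by measurable
    have "(\<lambda>\<omega>. \<lambda>p\<in>upper_idx n. sign_sample n a \<omega> p) -` {x\<in>space ?P. res_dev n (\<lambda>p. x p / sqrt n) \<alpha> q \<ge> \<epsilon>} \<inter> space sign_space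
      = {\<omega>\<in>space sign_space. res_dev n (\<lambda>p. sign_sample n a \<omega> p / sqrt n) \<alpha> q \<ge> \<epsilon>}"
      using measurable_space[OF sign_sample_measurable[of n a]] by (auto simp only: vimage_def res_dev_restrict)
    then show "measure sign_space {\<omega>\<in>space sign_space. res_dev n (\<lambda>p. sign_sample n a \<omega> p / sqrt n) \<alpha> q \<ge> \<epsilon>}
      = measure sign_space ((\<lambda>\<omega>. \<lambda>p\<in>upper_idx n. sign_sample n a \<omega> p) -` {x\<in>space ?P. res_dev n (\<lambda>p. x p / sqrt n) \<alpha> q \<ge> \<epsilon>} \<inter> space sign_space)"
      by simp
  qed
  also have "\<dots> = measure ?P {x\<in>space ?P. res_dev n (\<lambda>p. x p / sqrt n) \<alpha> q \<ge> \<epsilon>}"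
    by (simp only: distr_sign_sample)
  also have "\<dots> \<le> exp (- \<epsilon>\<^sup>2 / 72 * n)"
  proof (rule prob_res_dev_le[OF gauss_like_sign_law n q \<alpha> _ d0 _ small \<epsilon>])
    show "(if fst p = snd p then 0 else (a p)\<^sup>2) / n \<le> \<delta>" if "p \<in> upper_idx n" for p
      using d[OF that] d0 by auto
    have "row_sum n (\<lambda>p. (if fst p = snd p then 0 else (a p)\<^sup>2) / n) i = row_sum n (\<lambda>p. (a p)\<^sup>2 / n) i" for i
      unfolding row_sum_def by (intro sum.cong refl) (auto simp: sym_mat_def)
    then show "e = (\<Sum>i<n. \<bar>row_sum n (\<lambda>p. (if fst p = snd p then 0 else (a p)\<^sup>2) / n) i - \<alpha>\<^sup>2\<bar>) / n"
      unfolding e by simp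
  qed
  finally show ?thesis .
qed

text \<open>For fixed \<epsilon> the failure probabilities are eventually at most exp(- \<epsilon>^2
  N m / 72), summable because N m >= m, and the first Borel-Cantelli lemma applies. The thresholds 1
  / (k + 1) then give convergence off a single null set.\<close>

theorem sign_res_dev_AE:
  fixes N :: "nat \<Rightarrow> nat" and a :: "nat \<Rightarrow> nat \<times> nat \<Rightarrow> real"
  assumes N: "\<And>m. N m \<ge> m" and q: "q \<ge> 2" and \<alpha>: "0 < \<alpha>" "\<alpha> \<le> 1"
    and small: "\<And>d. d > 0 \<Longrightarrow> \<forall>\<^sub>F m in sequentially. \<forall>p\<in>upper_idx (N m). fst p \<noteq> snd p \<longrightarrow> (a m p)\<^sup>2 / N m \<le> d"
    and rows: "(\<lambda>m. (\<Sum>i<N m. \<bar>row_sum (N m) (\<lambda>p. (a m p)\<^sup>2 / N m) i - \<alpha>\<^sup>2\<bar>) / N m) \<longlonglongrightarrow> 0"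
  shows "AE \<omega> in sign_space. (\<lambda>m. res_dev (N m) (\<lambda>p. sign_sample (N m) (a m) \<omega> p / sqrt (N m)) \<alpha> q) \<longlonglongrightarrow> 0"
proof -
  interpret prob_space sign_space by (rule prob_space_sign_space)
  let ?F = "\<lambda>m \<omega>. res_dev (N m) (\<lambda>p. sign_sample (N m) (a m) \<omega> p / sqrt (N m)) \<alpha> q"
  have F0: "?F m \<omega> \<ge> 0" for m \<omega> unfolding res_dev_def by (intro divide_nonneg_nonneg sum_nonneg) auto
  have each: "AE \<omega> in sign_space. \<forall>\<^sub>F m in sequentially. ?F m \<omega> < \<epsilon>" if \<epsilon>: "\<epsilon> > 0" for \<epsilon>
  proof -
    \<comment> \<open>Makes sqrt d and d at most \<epsilon> / 16 and sqrt d at most 1, so the four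
      terms of the smallness condition stay below \<epsilon> / 2.\<close>
    define d where "d = min 1 ((\<epsilon> / 16)\<^sup>2)"
    have d: "d > 0" "sqrt d \<le> \<epsilon> / 16" "sqrt d \<le> 1" "d \<le> \<epsilon> / 16"
    proof -
      show "d > 0" using \<epsilon> by (simp add: d_def)
      have "sqrt d \<le> sqrt ((\<epsilon> / 16)\<^sup>2)" unfolding d_def by (intro real_sqrt_le_mono) simp
      then show s: "sqrt d \<le> \<epsilon> / 16" using \<epsilon> by simp
      show s1: "sqrt d \<le> 1" by (simp add: d_def)
      have "d = sqrt d * sqrt d" using \<open>d > 0\<close> by simp
      also have "\<dots> \<le> sqrt d * 1" using s1 \<open>d > 0\<close> by (intro mult_left_mono) auto
      finally show "d \<le> \<epsilon> / 16" using s by simp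
    qed
    define A where "A m = (if N m > 0 then {\<omega>\<in>space sign_space. ?F m \<omega> \<ge> \<epsilon>} else {})" for m
    have Am: "A m \<in> events" for m
    proof (cases "N m > 0")
      case True
      have "(\<lambda>\<omega>. ?F m \<omega>) \<in> borel_measurable sign_space"
        by (rule sign_sample_res_dev_measurable) (use True q in auto)
      then have "{\<omega>\<in>space sign_space. ?F m \<omega> \<ge> \<epsilon>} \<in> events" by measurable
      then show ?thesis using True by (simp add: A_def)
    qed (simp add: A_def)
    have "\<forall>\<^sub>F m in sequentially. (\<Sum>i<N m. \<bar>row_sum (N m) (\<lambda>p. (a m p)\<^sup>2 / N m) i - \<alpha>\<^sup>2\<bar>) / N m < \<epsilon> / 16"
      using \<epsilon> by (intro order_tendstoD(2)[OF rows]) auto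
    with small[OF d(1)] eventually_gt_at_top[of 0]
    have "\<forall>\<^sub>F m in sequentially. norm (prob (A m)) \<le> exp (- \<epsilon>\<^sup>2 / 72) ^ m"
    proof eventually_elim
      case (elim m)
      have n: "N m > 0" using N[of m] elim by simp
      let ?e = "(\<Sum>i<N m. \<bar>row_sum (N m) (\<lambda>p. (a m p)\<^sup>2 / N m) i - \<alpha>\<^sup>2\<bar>) / N m"
      have "0 \<le> ?e" by (intro divide_nonneg_nonneg sum_nonneg) auto
      then have "sqrt d * ?e \<le> 1 * ?e" using d by (intro mult_right_mono) auto
      moreover have "2 * s + t + d + e \<le> \<epsilon> / 2"
        if "s \<le> \<epsilon> / 16" "t \<le> 1 * e" "d \<le> \<epsilon> / 16" "e < \<epsilon> / 16" for s t d e :: real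
        using that \<epsilon> by argo
      ultimately have sm: "2 * sqrt d + sqrt d * ?e + d + ?e \<le> \<epsilon> / 2"
        using d(2,4) elim(3) by blast
      have "prob (A m) \<le> exp (- \<epsilon>\<^sup>2 / 72 * N m)"
        unfolding A_def using n elim(1)
        by (simp only: if_True) (rule sign_res_dev_tail[OF n q \<alpha> _ d(1) refl sm \<epsilon>], auto)
      also have "\<dots> \<le> exp (- \<epsilon>\<^sup>2 / 72 * m)" using N[of m] by (simp add: mult_left_mono)
      also have "\<dots> = exp (- \<epsilon>\<^sup>2 / 72) ^ m" by (simp add: exp_of_nat_mult[symmetric] mult.commute)
      finally show ?case by simp
    qed
    moreover have "summable (\<lambda>m. exp (- \<epsilon>\<^sup>2 / 72) ^ m)" using \<epsilon> by (intro summable_geometric) auto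
    ultimately have "summable (\<lambda>m. prob (A m))" by (rule summable_comparison_test_ev)
    then have "AE \<omega> in sign_space. \<forall>\<^sub>F m in sequentially. \<omega> \<in> space sign_space - A m"
      using Am by (intro borel_cantelli_AE1) (auto simp: less_top[symmetric])
    then show ?thesis
    proof (eventually_elim)
      case (elim \<omega>)
      with eventually_gt_at_top[of 0] show ?case
      proof eventually_elim
        case (elim m)
        have "N m > 0" using N[of m] elim by simp
        then show ?case using elim by (auto simp: A_def)
      qed
    qed
  qed
  have "AE \<omega> in sign_space. \<forall>k::nat. \<forall>\<^sub>F m in sequentially. ?F m \<omega> < 1 / Suc k"
    by (intro AE_all_countable[THEN iffD2] allI each) simp
  then show ?thesis
  proof eventually_elim
    case (elim \<omega>)
    show ?case
    proof (rule tendstoI)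
      fix e :: real assume "e > 0"
      then obtain k where k: "1 / Suc k < e" using nat_approx_posE by blast
      from elim have "\<forall>\<^sub>F m in sequentially. ?F m \<omega> < 1 / Suc k" by blast
      then show "\<forall>\<^sub>F m in sequentially. dist (?F m \<omega>) 0 < e"
        by eventually_elim (use k F0 in \<open>simp add: dist_real_def\<close>)
    qed
  qed
qed

section \<open>Weak convergence of the empirical spectral distribution\<close>

lemma cdf_ESD:
  assumes "n > 0"
  shows "cdf (ESD n A) x = real (card {k. k < n \<and> eigval n (\<lambda>a b. A a b / sqrt n) k \<le> x}) / n"
proof -
  have ne: "{..<n} \<noteq> {}" using assms by auto
  have "{..<n} \<inter> eigval n (\<lambda>a b. A a b / sqrt n) -` {..x} = {k. k < n \<and> eigval n (\<lambda>a b. A a b / sqrt n) k \<le> x}" by auto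
  then show ?thesis
    unfolding cdf_def ESD_def by (simp add: measure_pmf_of_set[OF ne finite_lessThan])
qed

context mat_seq
begin

text \<open>Counting from below on an interval left of x bounds the distribution function from
  below; counting on an interval right of x bounds it from above. The semicircle law has no atoms,
  so convergence holds at every x.\<close>

theorem weak_conv_spectrum:
  assumes conv: "\<And>q. q \<in> \<rat> \<Longrightarrow> q \<ge> 2 \<Longrightarrow> (\<lambda>m. res_dev (N m) (g m) \<alpha> q) \<longlonglongrightarrow> 0"
    and W: "\<And>m. (\<lambda>a b. W m a b / sqrt (N m)) = A m"
  shows "weak_conv_m (\<lambda>m. ESD (N m) (W m)) (semicircle \<alpha>)"
  unfolding weak_conv_m_def weak_conv_def
proof (intro allI impI)
  fix x
  interpret prob_space "semicircle \<alpha>" by (rule prob_space_semicircle[OF \<alpha>])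
  \<comment> \<open>Beyond both the support and x, so that the half-lines outside (-b, b) have mass
    0.\<close>
  define b where "b = 2 * \<alpha> + 1 + \<bar>x\<bar>"
  have lo: "cdf (semicircle \<alpha>) x \<le> measure (semicircle \<alpha>) {-b<..<x}"
  proof -
    have "measure (semicircle \<alpha>) {..x} \<le> measure (semicircle \<alpha>) ({..-b} \<union> ({-b<..<x} \<union> {x}))"
      by (intro finite_measure_mono) (auto simp: \<alpha>)
    also have "\<dots> \<le> measure (semicircle \<alpha>) {..-b} + (measure (semicircle \<alpha>) {-b<..<x} + measure (semicircle \<alpha>) {x})"
      by (intro order.trans[OF measure_Un_le] add_left_mono measure_Un_le) (auto simp: \<alpha>)
    also have "measure (semicircle \<alpha>) {..-b} = 0"
      by (rule measure_semicircle_outside[OF \<alpha>]) (auto simp: b_def)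
    finally show ?thesis using measure_semicircle_singleton[OF \<alpha>] by (simp add: cdf_def)
  qed
  have hi: "1 - cdf (semicircle \<alpha>) x \<le> measure (semicircle \<alpha>) {x<..<b}"
  proof -
    have "1 = measure (semicircle \<alpha>) UNIV"
      using prob_space by (simp add: semicircle_def)
    also have "\<dots> \<le> measure (semicircle \<alpha>) ({..x} \<union> ({x<..<b} \<union> {b..}))"
      by (intro finite_measure_mono) (auto simp: \<alpha>)
    also have "\<dots> \<le> measure (semicircle \<alpha>) {..x} + (measure (semicircle \<alpha>) {x<..<b} + measure (semicircle \<alpha>) {b..})"
      by (intro order.trans[OF measure_Un_le] add_left_mono measure_Un_le) (auto simp: \<alpha>)
    also have "measure (semicircle \<alpha>) {b..} = 0"
      by (rule measure_semicircle_outside[OF \<alpha>]) (auto simp: b_def)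
    finally show ?thesis by (simp add: cdf_def)
  qed
  show "(\<lambda>m. cdf (ESD (N m) (W m)) x) \<longlonglongrightarrow> cdf (semicircle \<alpha>) x"
  proof (rule tendstoI)
    fix e :: real assume e: "e > 0"
    then have e2: "e/2 > 0" by simp
    have ev: "\<forall>\<^sub>F m in sequentially. real (card {k. k < N m \<and> a < eigval (N m) (A m) k \<and> eigval (N m) (A m) k < c}) / N m
       \<ge> measure (semicircle \<alpha>) {a<..<c} - e / 2" for a c
      by (intro eigenvalue_fraction_ge conv e2)
    show "\<forall>\<^sub>F m in sequentially. dist (cdf (ESD (N m) (W m)) x) (cdf (semicircle \<alpha>) x) < e"
      using N ev[of "-b" x] ev[of x b]
    proof eventually_elim
      case (elim m)
      let ?n = "N m" and ?l = "eigval (N m) (A m)"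
      let ?L = "{k. k < ?n \<and> ?l k \<le> x}"
      have c: "cdf (ESD ?n (W m)) x = real (card ?L) / ?n"
        unfolding cdf_ESD[OF elim(1)] W ..
      have "card {k. k < ?n \<and> -b < ?l k \<and> ?l k < x} \<le> card ?L" by (intro card_mono) auto
      then have "real (card {k. k < ?n \<and> -b < ?l k \<and> ?l k < x}) / ?n \<le> real (card ?L) / ?n"
        by (intro divide_right_mono) auto
      then have 1: "cdf (semicircle \<alpha>) x - e/2 \<le> cdf (ESD ?n (W m)) x" using elim(2) lo unfolding c by linarith
      have "card ?L + card {k. k < ?n \<and> x < ?l k \<and> ?l k < b} = card (?L \<union> {k. k < ?n \<and> x < ?l k \<and> ?l k < b})"
        by (rule card_Un_disjoint[symmetric]) auto
      also have "\<dots> \<le> card {..<?n}" by (intro card_mono) auto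
      finally have "real (card ?L) + real (card {k. k < ?n \<and> x < ?l k \<and> ?l k < b}) \<le> ?n" by simp
      then have "real (card ?L) / ?n + real (card {k. k < ?n \<and> x < ?l k \<and> ?l k < b}) / ?n \<le> 1"
        using elim(1) by (simp add: add_divide_distrib[symmetric])
      then have 2: "cdf (ESD ?n (W m)) x \<le> cdf (semicircle \<alpha>) x + e/2" using elim(3) hi unfolding c by linarith
      show ?case using 1 2 e by (simp add: dist_real_def abs_less_iff)
    qed
  qed
qed

end

text \<open>The equality is between functions, so that the decomposition chosen inside
  \<open>ESD\<close> is the one of a \<open>sym_mat\<close>, to which the resolvent theory applies.
  The amplitudes carry a factor sqrt n, matching the normalisation of
  \<open>sign_sample\<close>.\<close>

lemma Wmat_eq_sign_sample:
  "(\<lambda>i j. Wmat n (sym_mat g) (\<lambda>i j. \<omega> (n, i, j)) i j / sqrt n)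
    = sym_mat (\<lambda>p. sign_sample n (\<lambda>p. sqrt n * abs_half n (sym_mat (\<lambda>p. g p / sqrt n)) (fst p) (snd p)) \<omega> p / sqrt n)"
proof -
  have s: "(\<lambda>a b. sym_mat g a b / sqrt n) = sym_mat (\<lambda>p. g p / sqrt n)"
    by (auto simp: sym_mat_def fun_eq_iff)
  have "Xminus n (sym_mat g) i j - Xplus n (sym_mat g) i j = - (sqrt n * abs_half n (sym_mat (\<lambda>p. g p / sqrt n)) i j)" for i j
    using Xplus_minus_Xminus[of n "sym_mat g" i j] unfolding s by simp
  then show ?thesis
    using Xplus_minus_Xminus[of n "sym_mat g"] unfolding s
    by (intro ext) (auto simp: Wmat_def sym_mat_def sign_sample_def sign_entry_def Let_def min_def max_def)
qed

text \<open>The exceptional set of X depends on n alone, since G is fixed before \<open>g\<close>.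
  For every sequence of realisations that eventually lies in G, the almost sure statement concerns
  the signs; even sizes are written 2 m. The proof gives C = 1.\<close>

theorem theoremF1:
  shows "\<exists>C::real. \<exists>G :: nat \<Rightarrow> (nat \<times> nat \<Rightarrow> real) set.
    (\<forall>n. G n \<in> sets (gauss_ens n)) \<and>
    (\<forall>n. even n \<and> n > 0 \<longrightarrow> measure (gauss_ens n) (G n) \<ge> 1 - C / real n ^ 3) \<and>
    (\<forall>g :: nat \<Rightarrow> (nat \<times> nat \<Rightarrow> real).
       (\<forall>\<^sub>F m in sequentially. g m \<in> G (2 * m)) \<longrightarrow>
       (AE \<omega> in sign_space.
          weak_conv_m
            (\<lambda>m. ESD (2 * m) (Wmat (2 * m) (sym_mat (g m)) (\<lambda>i j. \<omega> (2 * m, i, j))))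
            (semicircle (sqrt (1 - 64 / (9 * pi\<^sup>2))))))"
proof -
  define \<alpha> where "\<alpha> = sqrt (1 - 64 / (9 * pi\<^sup>2))"
  \<comment> \<open>Since pi > 3, the final variance is positive.\<close>
  have "3\<^sup>2 < pi\<^sup>2" using pi_gt3 by (intro power_strict_mono) auto
  then have "64 / (9 * pi\<^sup>2) < 1" by simp
  then have \<alpha>: "0 < \<alpha>" "\<alpha> \<le> 1" "\<alpha>\<^sup>2 = 1 - 64 / (9 * pi\<^sup>2)" by (auto simp: \<alpha>_def)
  obtain G where G: "\<And>n. G n \<in> sets (gauss_ens n)" "\<And>n. n > 0 \<Longrightarrow> measure (gauss_ens n) (G n) \<ge> 1 - 1 / real n ^ 3"
    "\<And>g. \<forall>\<^sub>F m in sequentially. g m \<in> G (2 * m) \<Longrightarrow> gauss_seq (\<lambda>m. 2 * m) (\<lambda>m p. g m p / sqrt (real (2 * m)))"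
    by (rule exists_good_event) blast
  have "AE \<omega> in sign_space. weak_conv_m
      (\<lambda>m. ESD (2 * m) (Wmat (2 * m) (sym_mat (g m)) (\<lambda>i j. \<omega> (2 * m, i, j)))) (semicircle \<alpha>)"
    if g: "\<forall>\<^sub>F m in sequentially. g m \<in> G (2 * m)" for g
  proof -
    interpret S: gauss_seq "\<lambda>m. 2 * m" "\<lambda>m p. g m p / sqrt (real (2 * m))" by (rule G(3)[OF g])
    define B where "B m = abs_half (2 * m) (S.A m)" for m
    define a where "a m p = sqrt (real (2 * m)) * B m (fst p) (snd p)" for m p
    have aB: "(a m p)\<^sup>2 / real (2 * m) = (B m (fst p) (snd p))\<^sup>2" if "m > 0" for m p
      using that by (simp add: a_def power_mult_distrib)
    have small: "\<forall>\<^sub>F m in sequentially. \<forall>p\<in>upper_idx (2 * m). fst p \<noteq> snd p \<longrightarrow> (a m p)\<^sup>2 / real (2 * m) \<le> d" if d: "d > 0" for d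
    proof -
      have "sqrt d > 0" using d by simp
      from S.abs_half_offdiag_small[OF this] eventually_gt_at_top[of 0] show ?thesis
      proof eventually_elim
        case (elim m)
        show ?case
        proof (intro ballI impI)
          fix p assume p: "p \<in> upper_idx (2 * m)" "fst p \<noteq> snd p"
          then have "\<bar>B m (fst p) (snd p)\<bar> \<le> sqrt d"
            using elim(1) by (auto simp: upper_idx_def B_def)
          then have "(B m (fst p) (snd p))\<^sup>2 \<le> d"
            using d by (metis abs_ge_zero power2_abs power_mono real_sqrt_pow2 less_imp_le)
          then show "(a m p)\<^sup>2 / real (2 * m) \<le> d" using aB[OF elim(2)] by simp
        qed
      qed
    qed
    have rows: "(\<lambda>m. (\<Sum>i<2 * m. \<bar>row_sum (2 * m) (\<lambda>p. (a m p)\<^sup>2 / real (2 * m)) i - \<alpha>\<^sup>2\<bar>) / real (2 * m)) \<longlonglongrightarrow> 0"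
    proof (rule Lim_transform_eventually[OF S.abs_half_row_sum], rule eventually_mono[OF eventually_gt_at_top[of 0]])
      fix m :: nat assume m: "m > 0"
      show "(\<Sum>i<2 * m. \<bar>row_sum (2 * m) (\<lambda>p. (abs_half (2 * m) (S.A m) (fst p) (snd p))\<^sup>2) i - (1 - 64 / (9 * pi\<^sup>2))\<bar>) / real (2 * m)
        = (\<Sum>i<2 * m. \<bar>row_sum (2 * m) (\<lambda>p. (a m p)\<^sup>2 / real (2 * m)) i - \<alpha>\<^sup>2\<bar>) / real (2 * m)"
        unfolding aB[OF m] B_def \<alpha>(3) ..
    qed
    have each: "AE \<omega> in sign_space. (\<lambda>m. res_dev (2 * m) (\<lambda>p. sign_sample (2 * m) (a m) \<omega> p / sqrt (real (2 * m))) \<alpha> q) \<longlonglongrightarrow> 0"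
      if "q \<ge> 2" for q
      by (rule sign_res_dev_AE[where N = "\<lambda>m. 2 * m"]) (use that \<alpha> small rows in auto)
    \<comment> \<open>Countability of the rational q allows one null set of signs for all of
      them.\<close>
    have "AE \<omega> in sign_space. \<forall>q\<in>\<rat> \<inter> {2..}. (\<lambda>m. res_dev (2 * m) (\<lambda>p. sign_sample (2 * m) (a m) \<omega> p / sqrt (real (2 * m))) \<alpha> q) \<longlonglongrightarrow> 0"
    proof (subst AE_ball_countable)
      show "countable (\<rat> \<inter> {2::real..})" by (rule countable_Int1[OF countable_rat])
    qed (use each in auto)
    then show ?thesis
    proof eventually_elim
      case (elim \<omega>)
      interpret T: mat_seq "\<lambda>m. 2 * m" "\<lambda>m p. sign_sample (2 * m) (a m) \<omega> p / sqrt (real (2 * m))" \<alpha>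
        by unfold_locales (use S.N \<alpha> in auto)
      show ?case
      proof (rule T.weak_conv_spectrum)
        fix m
        show "(\<lambda>i j. Wmat (2 * m) (sym_mat (g m)) (\<lambda>i j. \<omega> (2 * m, i, j)) i j / sqrt (real (2 * m))) = T.A m"
          unfolding a_def B_def by (rule Wmat_eq_sign_sample)
      qed (use elim in auto)
    qed
  qed
  then show ?thesis
    using G(1,2) unfolding \<alpha>_def by (intro exI[of _ 1] exI[of _ G]) auto
qed

end
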